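(* For any plane graph $G$, $$T(G;x,y)=T_c(\mathrm{alt}_{\mathrm c}(G);x,y)=T_a(\mathrm{alt}_{\mathrm a}(G);x,y),$$ where $T(G;x,y)$ is the Tutte polynomial of $G$.
   Context: An \emph{alternating dimap} is a finite directed graph (loops and multiple edges allowed) without isolated vertices, 2-cell-embedded in a disjoint union of oriented surfaces, one for each component, such that around each vertex the incident edges are directed alternately into and out of the vertex. The empty alternating dimap is allowed. All edges around a face go in the same direction; a face is a \emph{c-face} (clockwise) or \emph{a-face} (anticlockwise) accordingly. Each edge $e$ lies in exactly one c-face $C(e)$, one a-face $A(e)$, and one in-star $I(e)$ (the set of edges with the same head as $e$). The \emph{left successor} (resp. \emph{right successor}) of $e$ is the next edge after $e$ going around $A(e)$ (resp. $C(e)$) in the direction of $e$. Let $\omega=\exp(2\pi i/3)$. The permutations $\sigma_1,\sigma_\omega,\sigma_{\omega^2}$ of $E(G)$ send $e$ to the next edge in clockwise order around $I(e)$, $A(e)$, $C(e)$ respectively; the left successor of $e$ is $\sigma_\omega^{-1}(e)$ and the right successor is $\sigma_{\omega^2}(e)$. They satisfy $\sigma_1\sigma_\omega\sigma_{\omega^2}=\mathrm{id}$ (rightmost applied first), and alternating dimaps correspond bijectively to such triples. \emph{Minor operations.} Let $e$ be an edge from $u$ to $v$. $G[1]e$ (contraction): if $e$ is not a loop, delete $e$ and identify its endpoints, preserving orders around vertices; if $e$ alone forms an a-face or a c-face, delete $e$; if $e$ is any other loop, delete $e$ and split $v$ into two vertices, one carrying the edge-ends strictly between the two ends of $e$ on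 one side and the other carrying those on the other side. $G[\omega]e$: delete $e$ and, if the left successor $g$ of $e$ is not $e$, change the tail of $g$ from $v$ to $u$ so that $g$ takes the place of $e,g$ in $A(e)$. $G[\omega^2]e$: the same with the right successor and $C(e)$. A vertex left without edges disappears. Equivalently, with $\pi\setminus e$ the permutation obtained from $\pi$ by removing $e$ from its cycle: in $G[1]e$, $\sigma_\omega,\sigma_{\omega^2}$ become $\sigma_\omega\setminus e,\sigma_{\omega^2}\setminus e$; in $G[\omega]e$, $\sigma_1,\sigma_\omega$ become $\sigma_1\setminus e,\sigma_\omega\setminus e$; in $G[\omega^2]e$, $\sigma_1,\sigma_{\omega^2}$ become $\sigma_1\setminus e,\sigma_{\omega^2}\setminus e$; the third permutation is determined by the product identity. \emph{Loops and semiloops.} A 1-loop is an edge whose head has degree 2; an $\omega$-loop (resp. $\omega^2$-loop) is an edge forming a single-edge a-face (resp. c-face). A triloop is a $\mu$-loop for some $\mu\in\{1,\omega,\omega^2\}$; for a triloop all three reductions coincide and are written $G[*]e$. An ultraloop is a triloop that with its vertex constitutes a component. A 1-semiloop is a loop in the usual graph sense. An $\omega$-semiloop (resp. $\omega^2$-semiloop) is an edge $e$ such that, with $f$ its right successor (resp. left successor), either $f=e$ or $k(G\setminus\{e,f\})-\gamma(G\setminus\{e,f\})>k(G)-\gamma(G)$, where the deletion is in the underlying undirected embedded graph, $k$ is the number of components, and the genus $\gamma$ is given by $|V|-|E|+|F|=2(k-\gamma)$. A semiloop is a $\mu$-semiloop for some $\mu$; it is proper if it is not a triloop. \emph{The functions.}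 The Tutte polynomial: $T(G;x,y)=1$ if $E(G)=\emptyset$; otherwise, for any $e\in E(G)$, it is $x\,T(G\setminus e;x,y)$ if $e$ is a coloop, $y\,T(G/e;x,y)$ if $e$ is a loop, and $T(G/e;x,y)+T(G\setminus e;x,y)$ otherwise. For an orientably 2-cell-embedded undirected graph $G$, $\mathrm{alt}_{\mathrm c}(G)$ (resp. $\mathrm{alt}_{\mathrm a}(G)$) is the alternating dimap obtained by replacing each edge $uv$ by a pair of oppositely directed edges $(u,v),(v,u)$ forming a clockwise (resp. anticlockwise) face of size two. $T_c(H;x,y)$ and $T_a(H;x,y)$ are defined recursively for alternating dimaps $H$: both equal 1 if $E(H)=\emptyset$; otherwise, for any $e\in E(H)$, $T_c(H;x,y)$ equals $T_c(H[*]e;x,y)$ if $e$ is an $\omega^2$-loop (including an ultraloop); $x\,T_c(H[\omega^2]e;x,y)$ if $e$ is an $\omega$-semiloop (not covered by the preceding case); $y\,T_c(H[1]e;x,y)$ if $e$ is a proper 1-semiloop or an $\omega$-loop (not covered by the preceding cases); $T_c(H[1]e;x,y)+T_c(H[\omega^2]e;x,y)$ if $e$ is not a semiloop; and $T_a(H;x,y)$ equals $T_a(H[*]e;x,y)$ if $e$ is an $\omega$-loop (including an ultraloop); $x\,T_a(H[\omega]e;x,y)$ if $e$ is an $\omega^2$-semiloop (not covered by the preceding case); $y\,T_a(H[1]e;x,y)$ if $e$ is a proper 1-semiloop or an $\omega^2$-loop (not covered by the preceding cases); $T_a(H[1]e;x,y)+T_a(H[\omega]e;x,y)$ if $e$ is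 not a semiloop. For general $H$ the outcome can depend on the choice of edges made in the recursion; for $H=\mathrm{alt}_{\mathrm c}(G)$ (for $T_c$) or $H=\mathrm{alt}_{\mathrm a}(G)$ (for $T_a$) with $G$ plane, the equality is asserted for the value obtained with any choice of edge at each stage. A plane graph is a graph embedded with genus 0 (each component in its own sphere when disconnected). *)

theory Defs
  imports Complex_Main "HOL-Combinatorics.Combinatorics"
begin

section \<open>Multigraphs and the Tutte polynomial\<close>

text \<open>
  Every edge \<open>e\<close> has two ends, the darts \<open>(e, False)\<close> and \<open>(e, True)\<close>. For undirected graphs the
  labels \<open>False\<close> and \<open>True\<close> carry no meaning.
\<close>

type_synonym 'e dart = "'e \<times> bool"

definition opp :: "'e dart \<Rightarrow> 'e dart" where
  "opp d = (fst d, \<not> snd d)"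

record ('v, 'e) multigraph =
  verts :: "'v set"
  edges :: "'e set"
  endpt :: "'e dart \<Rightarrow> 'v"

definition darts :: "('v, 'e, 'z) multigraph_scheme \<Rightarrow> 'e dart set" where
  "darts G = edges G \<times> UNIV"

definition adjacency :: "('v, 'e, 'z) multigraph_scheme \<Rightarrow> 'v rel" where
  "adjacency G = {(endpt G d, endpt G (opp d)) | d. d \<in> darts G}"

definition num_components :: "('v, 'e, 'z) multigraph_scheme \<Rightarrow> nat" where
  "num_components G = card (verts G // (adjacency G)\<^sup>*)"

definition delete :: "('v, 'e) multigraph \<Rightarrow> 'e \<Rightarrow> ('v, 'e) multigraph" where
  "delete G e = G\<lparr>edges := edges G - {e}\<rparr>"

definition contract :: "('v, 'e) multigraph \<Rightarrow> 'e \<Rightarrow> ('v, 'e) multigraph" where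
  "contract G e =
     (let merge = (\<lambda>w. if w = endpt G (e, False) then endpt G (e, True) else w)
      in \<lparr>verts = merge ` verts G, edges = edges G - {e}, endpt = merge \<circ> endpt G\<rparr>)"

definition is_loop :: "('v, 'e) multigraph \<Rightarrow> 'e \<Rightarrow> bool" where
  "is_loop G e \<longleftrightarrow> endpt G (e, False) = endpt G (e, True)"

definition is_coloop :: "('v, 'e) multigraph \<Rightarrow> 'e \<Rightarrow> bool" where
  "is_coloop G e \<longleftrightarrow> num_components (delete G e) > num_components G"

text \<open>
  \<open>tutte_value x y G p\<close> says that the recursion for \<open>T(G; x, y)\<close> yields \<open>p\<close>, whichever edge is
  chosen at each stage. Here \<open>x\<close> and \<open>y\<close> are elements of any commutative ring; they may be
  taken to be the indeterminates of a polynomial ring.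
\<close>

inductive tutte_value :: "'r::comm_ring_1 \<Rightarrow> 'r \<Rightarrow> ('v, 'e) multigraph \<Rightarrow> 'r \<Rightarrow> bool"
  for x y :: 'r where
  empty: "edges G = {} \<Longrightarrow> tutte_value x y G 1"
| step: "tutte_value x y G p"
  if "edges G \<noteq> {}"
  and "\<And>e. \<lbrakk>e \<in> edges G; is_coloop G e\<rbrakk>
         \<Longrightarrow> \<exists>q. tutte_value x y (delete G e) q \<and> p = x * q"
  and "\<And>e. \<lbrakk>e \<in> edges G; is_loop G e\<rbrakk>
         \<Longrightarrow> \<exists>q. tutte_value x y (contract G e) q \<and> p = y * q"
  and "\<And>e. \<lbrakk>e \<in> edges G; \<not> is_coloop G e; \<not> is_loop G e\<rbrakk>
         \<Longrightarrow> \<exists>q r. tutte_value x y (contract G e) q \<and> tutte_value x y (delete G e) r \<and> p = q + r"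


section \<open>Embedded graphs\<close>

text \<open>
  A 2-cell embedding in oriented surfaces, one for each component, is given by the rotation system
  \<open>rot\<close>, which sends each dart to the next dart in clockwise order around their common vertex. Isolated
  vertices are allowed; each of them lies on its own sphere.
\<close>

record ('v, 'e) embedded_graph = "('v, 'e) multigraph" +
  rot :: "'e dart \<Rightarrow> 'e dart"

definition embedded_graph :: "('v, 'e) embedded_graph \<Rightarrow> bool" where
  "embedded_graph G \<longleftrightarrow>
     finite (verts G) \<and> finite (edges G) \<and> endpt G ` darts G \<subseteq> verts G \<and>
     rot G permutes darts G \<and>
     (\<forall>d \<in> darts G. \<forall>d' \<in> darts G. endpt G d = endpt G d' \<longleftrightarrow> d' \<in> orbit (rot G) d)"

text \<open>
  The faces are the orbits of \<open>rot \<circ> opp\<close> (leave along an edge and, at its far end, take the next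
  edge on the left), together with one face for each isolated vertex.
\<close>

definition num_faces :: "('v, 'e) embedded_graph \<Rightarrow> nat" where
  "num_faces G = card (orbit (rot G \<circ> opp) ` darts G) + card (verts G - endpt G ` darts G)"

definition genus :: "('v, 'e) embedded_graph \<Rightarrow> rat" where
  "genus G = of_nat (num_components G) -
     (of_nat (card (verts G)) - of_nat (card (edges G)) + of_nat (num_faces G)) / 2"

definition plane_graph :: "('v, 'e) embedded_graph \<Rightarrow> bool" where
  "plane_graph G \<longleftrightarrow> embedded_graph G \<and> genus G = 0"

text \<open>\<open>bypass d \<pi>\<close> is \<open>\<pi>\<close> with \<open>d\<close> removed from its cycle.\<close>

definition bypass :: "'a \<Rightarrow> ('a \<Rightarrow> 'a) \<Rightarrow> 'a \<Rightarrow> 'a" where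
  "bypass d \<pi> = (\<lambda>z. if z = d then d else if \<pi> z = d then \<pi> d else \<pi> z)"

definition bypass_edge :: "'e \<Rightarrow> ('e dart \<Rightarrow> 'e dart) \<Rightarrow> 'e dart \<Rightarrow> 'e dart" where
  "bypass_edge e \<pi> = bypass (e, False) (bypass (e, True) \<pi>)"

definition embedded_delete :: "('v, 'e) embedded_graph \<Rightarrow> 'e \<Rightarrow> ('v, 'e) embedded_graph" where
  "embedded_delete G e = G\<lparr>edges := edges G - {e}, rot := bypass_edge e (rot G)\<rparr>"


section \<open>Alternating dimaps\<close>

text \<open>
  The dart \<open>(e, False)\<close> is the tail end of the arc \<open>e\<close> and \<open>(e, True)\<close> is its head end; again \<open>turn\<close> is
  the clockwise rotation around the vertices. Since there are no isolated vertices, the vertices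
  are just the cycles of \<open>turn\<close>.
\<close>

record 'e dimap =
  arcs :: "'e set"
  turn :: "'e dart \<Rightarrow> 'e dart"

definition alternating_dimap :: "'e dimap \<Rightarrow> bool" where
  "alternating_dimap H \<longleftrightarrow>
     finite (arcs H) \<and> turn H permutes (arcs H \<times> UNIV) \<and>
     (\<forall>d \<in> arcs H \<times> UNIV. snd (turn H d) \<noteq> snd d)"

definition tail_vertex :: "'e dimap \<Rightarrow> 'e \<Rightarrow> 'e dart set" where
  "tail_vertex H e = orbit (turn H) (e, False)"

definition head_vertex :: "'e dimap \<Rightarrow> 'e \<Rightarrow> 'e dart set" where
  "head_vertex H e = orbit (turn H) (e, True)"

definition underlying :: "'e dimap \<Rightarrow> ('e dart set, 'e) embedded_graph" where
  "underlying H =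
     \<lparr>verts = orbit (turn H) ` (arcs H \<times> UNIV), edges = arcs H,
      endpt = orbit (turn H), rot = turn H\<rparr>"

text \<open>
  Arriving at a vertex along \<open>e\<close>, the clockwise-next edge-end is that of the edge immediately to
  the left. The face on the left of an edge is its a-face, the face on the right its c-face.
\<close>

definition left_succ :: "'e dimap \<Rightarrow> 'e \<Rightarrow> 'e" where
  "left_succ H e = fst (turn H (e, True))"

definition right_succ :: "'e dimap \<Rightarrow> 'e \<Rightarrow> 'e" where
  "right_succ H e = fst (inv (turn H) (e, True))"

definition a_face :: "'e dimap \<Rightarrow> 'e \<Rightarrow> 'e set" where
  "a_face H e = orbit (left_succ H) e"

definition c_face :: "'e dimap \<Rightarrow> 'e \<Rightarrow> 'e set" where
  "c_face H e = orbit (right_succ H) e"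


subsection \<open>Minor operations\<close>

definition remove_arc :: "'e \<Rightarrow> 'e dimap \<Rightarrow> 'e dimap" where
  "remove_arc e H = \<lparr>arcs = arcs H - {e}, turn = bypass_edge e (turn H)\<rparr>"

text \<open>
  Contraction. Write \<open>t\<close> and \<open>h\<close> for the tail and head ends of \<open>e\<close>. Composing \<open>turn\<close> with the
  transposition of \<open>t\<close> and \<open>h\<close> turns the two cycles \<open>(t P)\<close>, \<open>(h Q)\<close> of a non-loop into the single cycle
  \<open>(t Q h P)\<close>, and the cycle \<open>(t P h Q)\<close> of a loop into \<open>(t Q)\<close>, \<open>(h P)\<close>. Removing \<open>t\<close> and \<open>h\<close> then
  leaves the identified vertex \<open>(P Q)\<close>, respectively the two vertices \<open>(P)\<close>, \<open>(Q)\<close>. If \<open>P\<close> or \<open>Q\<close> is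
  empty for a loop, that is, if \<open>e\<close> alone forms a face, this just deletes \<open>e\<close>.
\<close>

definition reduce_1 :: "'e dimap \<Rightarrow> 'e \<Rightarrow> 'e dimap" where
  "reduce_1 H e = remove_arc e (H\<lparr>turn := turn H \<circ> transpose (e, False) (e, True)\<rparr>)"

text \<open>
  Exchanging the tail ends of \<open>e\<close> and \<open>g\<close> in \<open>turn\<close> puts the tail of \<open>g\<close> where the tail of \<open>e\<close> was.
  If \<open>g = e\<close> nothing is exchanged.
\<close>

definition exchange_tails :: "'e \<Rightarrow> 'e \<Rightarrow> 'e dimap \<Rightarrow> 'e dimap" where
  "exchange_tails e g H =
     H\<lparr>turn := transpose (e, False) (g, False) \<circ> turn H \<circ> transpose (e, False) (g, False)\<rparr>"

definition reduce_\<omega> :: "'e dimap \<Rightarrow> 'e \<Rightarrow> 'e dimap" where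
  "reduce_\<omega> H e = remove_arc e (exchange_tails e (left_succ H e) H)"

definition reduce_\<omega>2 :: "'e dimap \<Rightarrow> 'e \<Rightarrow> 'e dimap" where
  "reduce_\<omega>2 H e = remove_arc e (exchange_tails e (right_succ H e) H)"

text \<open>The reduction of a triloop, for which all three reductions coincide.\<close>

abbreviation (input) reduce_triloop :: "'e dimap \<Rightarrow> 'e \<Rightarrow> 'e dimap" where
  "reduce_triloop \<equiv> reduce_1"


subsection \<open>Loops and semiloops\<close>

definition loop_1 :: "'e dimap \<Rightarrow> 'e \<Rightarrow> bool" where
  "loop_1 H e \<longleftrightarrow> card (head_vertex H e) = 2"

definition loop_\<omega> :: "'e dimap \<Rightarrow> 'e \<Rightarrow> bool" where
  "loop_\<omega> H e \<longleftrightarrow> a_face H e = {e}"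

definition loop_\<omega>2 :: "'e dimap \<Rightarrow> 'e \<Rightarrow> bool" where
  "loop_\<omega>2 H e \<longleftrightarrow> c_face H e = {e}"

definition triloop :: "'e dimap \<Rightarrow> 'e \<Rightarrow> bool" where
  "triloop H e \<longleftrightarrow> loop_1 H e \<or> loop_\<omega> H e \<or> loop_\<omega>2 H e"

text \<open>
  In the underlying graph, deleting edges keeps all vertices, including those that become isolated.
\<close>

definition separating_pair :: "'e dimap \<Rightarrow> 'e \<Rightarrow> 'e \<Rightarrow> bool" where
  "separating_pair H e f \<longleftrightarrow>
     (let G = underlying H; G' = embedded_delete (embedded_delete G e) f
      in of_nat (num_components G') - genus G' > of_nat (num_components G) - genus G)"

definition semiloop_1 :: "'e dimap \<Rightarrow> 'e \<Rightarrow> bool" where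
  "semiloop_1 H e \<longleftrightarrow> tail_vertex H e = head_vertex H e"

definition semiloop_\<omega> :: "'e dimap \<Rightarrow> 'e \<Rightarrow> bool" where
  "semiloop_\<omega> H e \<longleftrightarrow> right_succ H e = e \<or> separating_pair H e (right_succ H e)"

definition semiloop_\<omega>2 :: "'e dimap \<Rightarrow> 'e \<Rightarrow> bool" where
  "semiloop_\<omega>2 H e \<longleftrightarrow> left_succ H e = e \<or> separating_pair H e (left_succ H e)"

definition semiloop :: "'e dimap \<Rightarrow> 'e \<Rightarrow> bool" where
  "semiloop H e \<longleftrightarrow> semiloop_1 H e \<or> semiloop_\<omega> H e \<or> semiloop_\<omega>2 H e"

definition proper_semiloop_1 :: "'e dimap \<Rightarrow> 'e \<Rightarrow> bool" where
  "proper_semiloop_1 H e \<longleftrightarrow> semiloop_1 H e \<and> \<not> triloop H e"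


subsection \<open>The dimap invariants\<close>

text \<open>
  \<open>Tc_value x y H p\<close> says that the recursion for \<open>T\<^sub>c(H; x, y)\<close> yields \<open>p\<close>, whichever edge is
  chosen at each stage; similarly for \<open>Ta_value\<close>. The last premise of each step rule also requires
  that no arc escapes the four cases, since an arc may be a semiloop without falling under any of
  the first three.
\<close>

inductive Tc_value :: "'r::comm_ring_1 \<Rightarrow> 'r \<Rightarrow> 'e dimap \<Rightarrow> 'r \<Rightarrow> bool"
  for x y :: 'r where
  empty: "arcs H = {} \<Longrightarrow> Tc_value x y H 1"
| step: "Tc_value x y H p"
  if "arcs H \<noteq> {}"
  and "\<And>e. \<lbrakk>e \<in> arcs H; loop_\<omega>2 H e\<rbrakk> \<Longrightarrow> Tc_value x y (reduce_triloop H e) p"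
  and "\<And>e. \<lbrakk>e \<in> arcs H; \<not> loop_\<omega>2 H e; semiloop_\<omega> H e\<rbrakk>
         \<Longrightarrow> \<exists>q. Tc_value x y (reduce_\<omega>2 H e) q \<and> p = x * q"
  and "\<And>e. \<lbrakk>e \<in> arcs H; \<not> loop_\<omega>2 H e; \<not> semiloop_\<omega> H e; proper_semiloop_1 H e \<or> loop_\<omega> H e\<rbrakk>
         \<Longrightarrow> \<exists>q. Tc_value x y (reduce_1 H e) q \<and> p = y * q"
  and "\<And>e. \<lbrakk>e \<in> arcs H; \<not> loop_\<omega>2 H e; \<not> semiloop_\<omega> H e; \<not> (proper_semiloop_1 H e \<or> loop_\<omega> H e)\<rbrakk>
         \<Longrightarrow> \<not> semiloop H e \<and>
             (\<exists>q r. Tc_value x y (reduce_1 H e) q \<and> Tc_value x y (reduce_\<omega>2 H e) r \<and> p = q + r)"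

inductive Ta_value :: "'r::comm_ring_1 \<Rightarrow> 'r \<Rightarrow> 'e dimap \<Rightarrow> 'r \<Rightarrow> bool"
  for x y :: 'r where
  empty: "arcs H = {} \<Longrightarrow> Ta_value x y H 1"
| step: "Ta_value x y H p"
  if "arcs H \<noteq> {}"
  and "\<And>e. \<lbrakk>e \<in> arcs H; loop_\<omega> H e\<rbrakk> \<Longrightarrow> Ta_value x y (reduce_triloop H e) p"
  and "\<And>e. \<lbrakk>e \<in> arcs H; \<not> loop_\<omega> H e; semiloop_\<omega>2 H e\<rbrakk>
         \<Longrightarrow> \<exists>q. Ta_value x y (reduce_\<omega> H e) q \<and> p = x * q"
  and "\<And>e. \<lbrakk>e \<in> arcs H; \<not> loop_\<omega> H e; \<not> semiloop_\<omega>2 H e; proper_semiloop_1 H e \<or> loop_\<omega>2 H e\<rbrakk>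
         \<Longrightarrow> \<exists>q. Ta_value x y (reduce_1 H e) q \<and> p = y * q"
  and "\<And>e. \<lbrakk>e \<in> arcs H; \<not> loop_\<omega> H e; \<not> semiloop_\<omega>2 H e; \<not> (proper_semiloop_1 H e \<or> loop_\<omega>2 H e)\<rbrakk>
         \<Longrightarrow> \<not> semiloop H e \<and>
             (\<exists>q r. Ta_value x y (reduce_1 H e) q \<and> Ta_value x y (reduce_\<omega> H e) r \<and> p = q + r)"


subsection \<open>Doubling the edges of an embedded graph\<close>

text \<open>
  Each dart \<open>d\<close> of \<open>G\<close> becomes an arc of the dimap, directed from the vertex of \<open>d\<close> to the vertex of
  \<open>opp d\<close>. So the place of \<open>d\<close> in the rotation at its vertex is taken by the tail end of the arc \<open>d\<close> and
  the head end of the arc \<open>opp d\<close>: in this clockwise order for \<open>alt_c\<close>, which makes the face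
  between the arcs \<open>d\<close> and \<open>opp d\<close> clockwise, and in the reverse order for \<open>alt_a\<close>.
\<close>

definition alt_c :: "('v, 'e) embedded_graph \<Rightarrow> 'e dart dimap" where
  "alt_c G =
     \<lparr>arcs = darts G,
      turn = (\<lambda>(d, at_head). if d \<notin> darts G then (d, at_head)
                else if at_head then (rot G (opp d), False) else (opp d, True))\<rparr>"

definition alt_a :: "('v, 'e) embedded_graph \<Rightarrow> 'e dart dimap" where
  "alt_a G =
     \<lparr>arcs = darts G,
      turn = (\<lambda>(d, at_head). if d \<notin> darts G then (d, at_head)
                else if at_head then (opp d, False) else (opp (rot G d), True))\<rparr>"

lemma opp_simps [simp]: "opp (opp d) = d" "opp d \<in> darts G \<longleftrightarrow> d \<in> darts G" "opp d \<noteq> d" "d \<noteq> opp d"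
  by (cases d; auto simp: opp_def darts_def)+

lemma alternating_dimap_alt_c: assumes "embedded_graph G" shows "alternating_dimap (alt_c G)"
proof -
  have p: "rot G permutes darts G" and f: "finite (darts G)"
    using assms by (auto simp: embedded_graph_def darts_def)
  have m: "d \<in> darts G \<Longrightarrow> rot G d \<in> darts G" for d using p by (simp add: permutes_in_image)
  have i: "rot G a = rot G b \<Longrightarrow> a = b" for a b using permutes_inj[OF p] by (simp add: inj_eq)
  have oi: "opp a = opp b \<Longrightarrow> a = b" for a b :: "'b dart" by (metis opp_simps(1))
  have "turn (alt_c G) permutes (darts G \<times> UNIV)"
  proof (rule inj_imp_permutes)
    show "inj_on (turn (alt_c G)) (darts G \<times> UNIV)"
      by (rule inj_onI) (auto simp: alt_c_def split: if_splits dest!: i dest: oi)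
    show "finite (darts G \<times> (UNIV::bool set))" using f by simp
  qed (auto simp: alt_c_def m split: if_splits)
  then show ?thesis using f by (auto simp: alternating_dimap_def alt_c_def)
qed

lemma alternating_dimap_alt_a: assumes "embedded_graph G" shows "alternating_dimap (alt_a G)"
proof -
  have p: "rot G permutes darts G" and f: "finite (darts G)"
    using assms by (auto simp: embedded_graph_def darts_def)
  have m: "d \<in> darts G \<Longrightarrow> rot G d \<in> darts G" for d using p by (simp add: permutes_in_image)
  have i: "rot G a = rot G b \<Longrightarrow> a = b" for a b using permutes_inj[OF p] by (simp add: inj_eq)
  have oi: "opp a = opp b \<Longrightarrow> a = b" for a b :: "'b dart" by (metis opp_simps(1))
  have "turn (alt_a G) permutes (darts G \<times> UNIV)"
  proof (rule inj_imp_permutes)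
    show "inj_on (turn (alt_a G)) (darts G \<times> UNIV)"
      by (rule inj_onI) (auto simp: alt_a_def split: if_splits dest!: oi dest: i)
    show "finite (darts G \<times> (UNIV::bool set))" using f by simp
  qed (auto simp: alt_a_def m split: if_splits)
  then show ?thesis using f by (auto simp: alternating_dimap_def alt_a_def)
qed

text \<open>The arcs \<open>d\<close> and \<open>opp d\<close> form an a-face of \<open>alt_a G\<close> and a c-face of \<open>alt_c G\<close>.\<close>

lemma left_succ_alt_a: "d \<in> darts G \<Longrightarrow> left_succ (alt_a G) d = opp d"
  by (simp add: left_succ_def alt_a_def)

lemma right_succ_alt_c: assumes "embedded_graph G" "d \<in> darts G" shows "right_succ (alt_c G) d = opp d"
proof -
  have "turn (alt_c G) (opp d, False) = (d, True)" using assms by (simp add: alt_c_def)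
  moreover have "inj (turn (alt_c G))" using alternating_dimap_alt_c[OF assms(1)]
    by (auto simp: alternating_dimap_def permutes_inj)
  ultimately have "inv (turn (alt_c G)) (d, True) = (opp d, False)" by (metis inv_f_f)
  then show ?thesis by (simp add: right_succ_def)
qed

end

theory Submission
  imports Defs
begin

text \<open>
  All dimaps that arise from \<open>alt_c G\<close> have c-faces of size at most two, so they are given by the
  rotation \<open>S\<close> of the in-stars and an involution \<open>C\<close>, the right successor: a map whose edges are the
  2-cycles of \<open>C\<close> and in which the fixed points of \<open>C\<close> (the \<open>\<omega>\<^sup>2\<close>-loops) are dangling half-edges. If
  \<open>f = C e \<noteq> e\<close> and \<open>\<tau>\<close> is the transposition of \<open>e\<close> and \<open>f\<close>, the \<open>\<omega>\<^sup>2\<close>-reduction of \<open>e\<close> replaces \<open>C\<close> by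
  \<open>\<tau> \<circ> C\<close> (deletion of the edge \<open>ef\<close>), the 1-reduction replaces \<open>(S, C)\<close> by \<open>(\<tau> \<circ> S, \<tau> \<circ> C)\<close> (contraction),
  and both then drop the half-edge \<open>e\<close>. The rank generating polynomial of the underlying graph does not see
  half-edges and satisfies the recursion for any choice of arc. The one place where contraction in the dimap
  differs from contraction in the graph is a loop, whose vertex is split in two; Euler's
  formula shows that in the plane this adds exactly one component, which leaves the polynomial unchanged.
  \<open>T\<^sub>a\<close> is \<open>T\<^sub>c\<close> of the mirror image.
\<close>

section \<open>Classes of a generated equivalence relation\<close>

text \<open>The dimaps met during the recursion are no longer of the form \<open>alt_c G\<close>:
  reducing one arc of a pair leaves its partner alone, as an \<omega>2-loop that disappears only
  when it is chosen itself. The induction therefore needs a class closed under removal of single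
  arcs. The value is pinned down by a closed formula rather than by comparing two recursions, so
  that independence of the choices and agreement with the Tutte polynomial come out of the same kind
  of induction. The formula tolerates what the reductions do to the vertex set because its exponents
  contain only differences of component counts. The topological conditions in the dimap recursion
  have to become conditions on connectivity: a separating pair is defined through components minus
  genus, and in the plane the genus stays zero under deletion, so that only components remain.
  Components, cycles and vertices are all counted as classes of a generated equivalence, where one
  more generator lowers the count by one or not at all.\<close>

definition eqv :: "'a rel \<Rightarrow> 'a rel" where
  "eqv r = (r \<union> r\<inverse>)\<^sup>*"

text \<open>Classes are formed in the whole type and only those that meet \<open>V\<close> are
  counted, so one relation can be counted over different carriers.\<close>

definition ncl :: "'a set \<Rightarrow> 'a rel \<Rightarrow> nat" where
  "ncl V r = card (V // eqv r)"

lemma eqv_refl [simp, intro]: "(a, a) \<in> eqv r"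
  by (simp add: eqv_def)

lemma eqv_sym: "(a, b) \<in> eqv r \<Longrightarrow> (b, a) \<in> eqv r"
  using sym_rtrancl[of "r \<union> r\<inverse>"] by (auto simp: eqv_def sym_def)

lemma eqv_trans: "(a, b) \<in> eqv r \<Longrightarrow> (b, c) \<in> eqv r \<Longrightarrow> (a, c) \<in> eqv r"
  by (auto simp: eqv_def)

lemma eqv_base: "(a, b) \<in> r \<Longrightarrow> (a, b) \<in> eqv r"
  by (auto simp: eqv_def)

lemma eqv_least:
  assumes "r \<subseteq> eqv s" shows "eqv r \<subseteq> eqv s"
proof -
  have "r \<union> r\<inverse> \<subseteq> eqv s" using assms eqv_sym by fastforce
  then have "eqv r \<subseteq> (eqv s)\<^sup>*" unfolding eqv_def[of r] by (rule rtrancl_mono)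
  then show ?thesis by (simp add: eqv_def)
qed

lemma eqv_mono: "r \<subseteq> s \<Longrightarrow> eqv r \<subseteq> eqv s"
  by (rule eqv_least) (auto intro: eqv_base)

lemma eqv_eqI: "r \<subseteq> eqv s \<Longrightarrow> s \<subseteq> eqv r \<Longrightarrow> eqv r = eqv s"
  by (simp add: eqv_least subset_antisym)

lemma eqv_union: "eqv r = eqv r' \<Longrightarrow> eqv (r \<union> s) = eqv (r' \<union> s)"
  by (rule eqv_eqI; rule subrelI; elim UnE;
      metis eqv_base eqv_mono Un_upper1 UnI2 subset_iff)

lemma eqv_closed:
  assumes "(a, b) \<in> eqv r" "\<And>u v. (u, v) \<in> r \<Longrightarrow> u \<in> X \<longleftrightarrow> v \<in> X" shows "a \<in> X \<longleftrightarrow> b \<in> X"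
  using assms(1) unfolding eqv_def by induction (use assms(2) in auto)

text \<open>A chain that crosses the new pair several times can be shortcut to one with at most one
  crossing, in one of two directions.\<close>

lemma eqv_insert_iff:
  "(a, b) \<in> eqv (insert (u, v) r) \<longleftrightarrow> (a, b) \<in> eqv r \<or>
     (a, u) \<in> eqv r \<and> (v, b) \<in> eqv r \<or> (a, v) \<in> eqv r \<and> (u, b) \<in> eqv r" (is "_ \<longleftrightarrow> ?R b")
proof
  assume "(a, b) \<in> eqv (insert (u, v) r)"
  then show "?R b" unfolding eqv_def[of "insert _ _"]
  proof induction
    case (step y z)
    then have "(y, z) \<in> eqv r \<or> (y, z) = (u, v) \<or> (y, z) = (v, u)"
      using eqv_base eqv_sym by fast
    then show ?case using step(3) by (auto intro: eqv_trans dest: eqv_sym)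
  qed simp
next
  have m: "(c, d) \<in> eqv r \<Longrightarrow> (c, d) \<in> eqv (insert (u, v) r)" for c d
    using eqv_mono[of r "insert (u, v) r"] by blast
  have "(u, v) \<in> eqv (insert (u, v) r)" by (simp add: eqv_base)
  then show "?R b \<Longrightarrow> (a, b) \<in> eqv (insert (u, v) r)" by (meson m eqv_trans eqv_sym)
qed

lemma eqv_insert_absorb: "(u, v) \<in> eqv r \<Longrightarrow> eqv (insert (u, v) r) = eqv r"
  by (rule eqv_eqI) (auto intro: eqv_base)

lemma equiv_eqv: "equiv UNIV (eqv r)"
  by (auto intro!: equivI refl_onI symI transI intro: eqv_sym eqv_trans)

lemma eqv_class_eq_iff: "eqv r `` {a} = eqv r `` {b} \<longleftrightarrow> (a, b) \<in> eqv r"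
  by (rule eq_equiv_class_iff[OF equiv_eqv]) auto

lemma card_image_kernel:
  assumes "\<And>a b. a \<in> D \<Longrightarrow> b \<in> D \<Longrightarrow> g a = g b \<longleftrightarrow> h a = h b"
  shows "card (g ` D) = card (h ` D)"
proof (rule bij_betw_same_card)
  show "bij_betw (\<lambda>c. h (inv_into D g c)) (g ` D) (h ` D)"
    unfolding bij_betw_def
  proof (intro conjI inj_onI set_eqI iffI)
    fix c c' assume *: "c \<in> g ` D" "c' \<in> g ` D" "h (inv_into D g c) = h (inv_into D g c')"
    then have "g (inv_into D g c) = g (inv_into D g c')"
      using assms by (metis inv_into_into)
    then show "c = c'" using * by (simp add: f_inv_into_f)
  next
    fix y assume "y \<in> h ` D"
    then obtain a where a: "a \<in> D" "y = h a" by blast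
    then have "h (inv_into D g (g a)) = h a"
      using assms by (metis f_inv_into_f imageI inv_into_into)
    then show "y \<in> (\<lambda>c. h (inv_into D g c)) ` g ` D" using a by force
  qed (auto intro: inv_into_into)
qed

lemma ncl_image: "ncl V r = card ((\<lambda>a. eqv r `` {a}) ` V)"
  by (auto simp: ncl_def quotient_def intro!: arg_cong[where f = card])

lemma ncl_cong: "eqv r = eqv s \<Longrightarrow> ncl V r = ncl V s"
  by (simp add: ncl_def)

lemma ncl_transfer_iff:
  assumes "f ` D = V" "\<And>a b. a \<in> D \<Longrightarrow> b \<in> D \<Longrightarrow> (f a, f b) \<in> eqv r \<longleftrightarrow> (a, b) \<in> eqv q"
  shows "ncl V r = ncl D q"
proof -
  have "ncl V r = card ((\<lambda>a. eqv r `` {f a}) ` D)"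
    by (simp add: ncl_image image_image flip: assms(1))
  also have "\<dots> = ncl D q"
    unfolding ncl_image by (rule card_image_kernel) (simp add: eqv_class_eq_iff assms(2))
  finally show ?thesis .
qed

text \<open>Read \<open>f\<close> as a collapse of \<open>D\<close> onto \<open>V\<close>: the
  classes of \<open>q\<close> must contain the fibres and a lift of every pair of \<open>r\<close>,
  and \<open>q\<close> must not join more than \<open>r\<close> does below. It is applied to darts
  and arcs collapsing onto vertices, to an element swallowed by its successor in a cycle, and to the
  ends of a contracted edge.\<close>

lemma ncl_transfer:
  assumes im: "f ` D = V"
    and fwd: "\<And>a b. (a, b) \<in> q \<Longrightarrow> (f a, f b) \<in> eqv r"
    and ker: "\<And>a b. a \<in> D \<Longrightarrow> b \<in> D \<Longrightarrow> f a = f b \<Longrightarrow> (a, b) \<in> eqv q"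
    and bwd: "\<And>p p'. (p, p') \<in> r \<Longrightarrow> \<exists>a\<in>D. \<exists>b\<in>D. f a = p \<and> f b = p' \<and> (a, b) \<in> eqv q"
  shows "ncl V r = ncl D q"
proof (rule ncl_transfer_iff[OF im])
  fix a b assume ab: "a \<in> D" "b \<in> D"
  show "(f a, f b) \<in> eqv r \<longleftrightarrow> (a, b) \<in> eqv q"
  proof
    assume "(f a, f b) \<in> eqv r"
    \<comment> \<open>The claim covers the whole fibre over \<open>f b\<close>, because lifts of
      consecutive pairs of \<open>r\<close> meet only in a common fibre, not in a common
      point.\<close>
    then have "\<forall>c\<in>D. f c = f b \<longrightarrow> (a, c) \<in> eqv q"
      unfolding eqv_def[of r]
    proof (induction "f b" arbitrary: b rule: rtrancl_induct)
      case base then show ?case using ab ker by metis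
    next
      case (step y)
      have "\<exists>a'\<in>D. \<exists>b'\<in>D. f a' = y \<and> f b' = f b \<and> (a', b') \<in> eqv q"
        using step(2) bwd[of y "f b"] bwd[of "f b" y] eqv_sym[of _ _ q] by blast
      then obtain a' b' where *: "a' \<in> D" "b' \<in> D" "f a' = y" "f b' = f b" "(a', b') \<in> eqv q"
        by blast
      then have "(a, a') \<in> eqv q" using step(3) by blast
      then have "(a, b') \<in> eqv q" using *(5) by (rule eqv_trans)
      show ?case
      proof (intro ballI impI)
        fix c assume "c \<in> D" "f c = f b"
        then have "(b', c) \<in> eqv q" using * ker by simp
        with \<open>(a, b') \<in> eqv q\<close> show "(a, c) \<in> eqv q" by (rule eqv_trans)
      qed
    qed
    then show "(a, b) \<in> eqv q" using ab by blast
  next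
    assume "(a, b) \<in> eqv q"
    then show "(f a, f b) \<in> eqv r"
      unfolding eqv_def[of q]
    proof induction
      case (step y z)
      then have "(f y, f z) \<in> eqv r" using fwd[of y z] fwd[of z y] by (auto intro: eqv_sym)
      with step(3) show ?case by (rule eqv_trans)
    qed simp
  qed
qed

text \<open>The class of \<open>u\<close> is set aside: on the remaining elements the old and the
  new classes correspond one to one, and the merged class is still represented there by
  \<open>v\<close>.\<close>

lemma ncl_insert:
  assumes "finite V" "u \<in> V" "v \<in> V" "(u, v) \<notin> eqv r"
  shows "ncl V r = Suc (ncl V (insert (u, v) r))"
proof -
  let ?r' = "insert (u, v) r" and ?c = "\<lambda>r a. eqv r `` {a}"
  define V' where "V' = {z \<in> V. (z, u) \<notin> eqv r}"
  have v: "v \<in> V'" using assms by (auto simp: V'_def dest: eqv_sym)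
  have 1: "?c r ` V = insert (?c r u) (?c r ` V')"
  proof (intro equalityI subsetI)
    fix c assume "c \<in> ?c r ` V"
    then obtain z where "z \<in> V" "c = ?c r z" by blast
    then show "c \<in> insert (?c r u) (?c r ` V')"
      using eqv_class_eq_iff[of r z u] by (cases "(z, u) \<in> eqv r") (auto simp: V'_def)
  qed (use assms in \<open>auto simp: V'_def\<close>)
  have 2: "?c r u \<notin> ?c r ` V'"
    by (auto simp: V'_def eqv_class_eq_iff dest: eqv_sym)
  have "?c ?r' z \<in> ?c ?r' ` V'" if "z \<in> V" for z
  proof (cases "z \<in> V'")
    case False
    then have "(z, v) \<in> eqv ?r'" using that by (auto simp: V'_def eqv_insert_iff)
    then show ?thesis using v eqv_class_eq_iff[of ?r' z v] by auto
  qed simp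
  then have 3: "?c ?r' ` V = ?c ?r' ` V'" by (auto simp: V'_def)
  have "card (?c r ` V') = card (?c ?r' ` V')"
    by (rule card_image_kernel) (auto simp: V'_def eqv_class_eq_iff eqv_insert_iff dest: eqv_sym)
  moreover have "finite V'" using assms by (simp add: V'_def)
  ultimately show ?thesis using 1 2 3 by (simp add: ncl_image)
qed

lemma ncl_insert_if:
  assumes "finite V" "u \<in> V" "v \<in> V"
  shows "ncl V r = (if (u, v) \<in> eqv r then 0 else 1) + ncl V (insert (u, v) r)"
  using ncl_insert[OF assms] by (simp add: ncl_cong[OF eqv_insert_absorb])

lemma ncl_isolated:
  assumes "finite V" "finite W" "V \<inter> W = {}" "r \<subseteq> V \<times> V"
  shows "ncl (V \<union> W) r = ncl V r + card W"
proof -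
  let ?c = "\<lambda>a. eqv r `` {a}"
  have W: "(w, z) \<in> eqv r \<longleftrightarrow> w = z" if "w \<in> W" for w z
  proof -
    have "(w, z) \<in> eqv r \<Longrightarrow> w = z"
      by (subst eqv_closed[where X = "{w}", of w z r, simplified]) (use that assms in auto)
    then show ?thesis by auto
  qed
  have "?c ` V \<inter> ?c ` W = {}"
  proof -
    have "(v, w) \<notin> eqv r" if "v \<in> V" "w \<in> W" for v w
      using W[of w v] eqv_sym[of v w r] that assms(3) by blast
    then show ?thesis by (force simp: eqv_class_eq_iff)
  qed
  then have "card (?c ` (V \<union> W)) = card (?c ` V) + card (?c ` W)"
    using assms by (simp add: image_Un card_Un_disjoint)
  also have "card (?c ` W) = card W"
    by (rule card_image) (auto intro!: inj_onI simp: eqv_class_eq_iff W)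
  finally show ?thesis by (simp add: ncl_image)
qed

section \<open>The rank generating polynomial\<close>

text \<open>Whitney's expansion of the Tutte polynomial, with \<open>k A\<close> the number of
  components of the spanning subgraph with edge set \<open>A\<close>; \<open>k {}\<close> stands for
  the number of vertices. For a \<open>graphic\<close> count the subtractions of natural numbers are
  exact, by \<open>antimono\<close> and \<open>nullity\<close>.\<close>

definition rank_poly :: "'r::comm_ring_1 \<Rightarrow> 'r \<Rightarrow> 'b set \<Rightarrow> ('b set \<Rightarrow> nat) \<Rightarrow> 'r" where
  "rank_poly x y E k = (\<Sum>A\<in>Pow E. (x - 1) ^ (k A - k E) * (y - 1) ^ (card A + k A - k {}))"

lemma sum_Pow_split:
  assumes "e \<in> E" "finite E"
  shows "(\<Sum>A\<in>Pow E. g A) = (\<Sum>A\<in>Pow (E - {e}). g A) + (\<Sum>A\<in>Pow (E - {e}). g (insert e A))"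
proof -
  have "Pow E = Pow (E - {e}) \<union> insert e ` Pow (E - {e})"
    using Pow_insert[of e "E - {e}"] assms by (simp add: insert_absorb)
  moreover have "Pow (E - {e}) \<inter> insert e ` Pow (E - {e}) = {}" by auto
  moreover have "inj_on (insert e) (Pow (E - {e}))" by (auto simp: inj_on_def)
  ultimately show ?thesis using assms by (simp add: sum.union_disjoint sum.reindex)
qed

text \<open>The constant cancels in both exponents. This absorbs isolated vertices, vanished
  half-edges and the vertex created by splitting at a loop.\<close>

lemma rank_poly_shift:
  assumes "\<And>A. A \<subseteq> E \<Longrightarrow> k A = k' A + c"
  shows "rank_poly x y E k = rank_poly x y E k'"
  unfolding rank_poly_def by (rule sum.cong) (auto simp: assms)

lemma rank_poly_reindex:
  assumes "inj_on h E" "finite E" "\<And>A. A \<subseteq> E \<Longrightarrow> k' (h ` A) = k A"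
  shows "rank_poly x y (h ` E) k' = rank_poly x y E k"
proof -
  have "Pow (h ` E) = (`) h ` Pow E" by (simp add: image_Pow_surj)
  moreover have "inj_on ((`) h) (Pow E)" using assms(1) by (simp add: inj_on_image_Pow)
  moreover have "A \<subseteq> E \<Longrightarrow> card (h ` A) = card A" for A
    using assms(1) by (meson card_image inj_on_subset)
  ultimately show ?thesis
    using assms(3)[of "{}"] by (auto simp: rank_poly_def sum.reindex assms(3) intro!: sum.cong)
qed

text \<open>The rank axioms of a matroid, written for the number of vertices minus the rank:
  \<open>step\<close> is unit increase, and \<open>local\<close> says that an element spanned by
  \<open>A\<close> is spanned by every larger set. Dimaps and graphs share the deletion and
  contraction argument through this locale.\<close>

locale graphic =
  fixes E :: "'b set" and k :: "'b set \<Rightarrow> nat"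
  assumes finite_E: "finite E"
    and step: "A \<subseteq> E \<Longrightarrow> e \<in> E \<Longrightarrow> k A = k (insert e A) \<or> k A = Suc (k (insert e A))"
    and local: "A \<subseteq> B \<Longrightarrow> B \<subseteq> E \<Longrightarrow> e \<in> E \<Longrightarrow> k A = k (insert e A) \<Longrightarrow> k B = k (insert e B)"
begin

lemma antimono:
  assumes "A \<subseteq> B" "B \<subseteq> E" shows "k B \<le> k A"
proof -
  have "finite (B - A)" using finite_E assms finite_subset by blast
  moreover have "finite X \<Longrightarrow> X \<subseteq> E \<Longrightarrow> k (A \<union> X) \<le> k A" for X
  proof (induction X rule: finite_induct)
    case (insert e X)
    then have "A \<union> X \<subseteq> E" using assms by blast
    then show ?case using step[of "A \<union> X" e] insert by auto
  qed simp
  ultimately have "k (A \<union> (B - A)) \<le> k A" using assms by blast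
  moreover have "A \<union> (B - A) = B" using assms by blast
  ultimately show ?thesis by simp
qed

lemma nullity:
  assumes "A \<subseteq> E" shows "k {} \<le> card A + k A"
proof -
  have "finite A" using assms finite_E finite_subset by blast
  then show ?thesis using assms
  proof (induction A rule: finite_induct)
    case (insert e A)
    then show ?case using step[of A e] by auto
  qed simp
qed

text \<open>By \<open>local\<close>, an edge that lowers the count at the top lowers it over every
  \<open>A\<close>. Sets without \<open>e\<close> then contribute \<open>x - 1\<close> times the
  polynomial of the deletion and sets with \<open>e\<close> contribute it once, which adds up to the
  factor \<open>x\<close>.\<close>

lemma rank_poly_coloop:
  assumes e: "e \<in> E" and co: "k (E - {e}) \<noteq> k E"
  shows "rank_poly x y E k = x * rank_poly x y (E - {e}) k"
proof -
  have ins: "insert e (E - {e}) = E" using e by auto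
  have *: "k A = Suc (k (insert e A))" "card (insert e A) = Suc (card A)" "k {} \<le> card A + k A"
      "k (E - {e}) = Suc (k E)" "k (E - {e}) \<le> k A"
    if "A \<subseteq> E - {e}" for A
  proof -
    show "k A = Suc (k (insert e A))"
      using local[of A "E - {e}" e] step[of A e] that e co ins by auto
    show "card (insert e A) = Suc (card A)"
      using that finite_E finite_subset[of A E] by (subst card_insert_disjoint) auto
    show "k {} \<le> card A + k A" using nullity that by blast
    show "k (E - {e}) = Suc (k E)" using step[of "E - {e}" e] e co ins by auto
    show "k (E - {e}) \<le> k A" using antimono that by blast
  qed
  have "(\<Sum>A\<in>Pow (E - {e}). (x - 1) ^ (k A - k E) * (y - 1) ^ (card A + k A - k {})) =
        (x - 1) * rank_poly x y (E - {e}) k"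
    unfolding rank_poly_def sum_distrib_left
  proof (intro sum.cong refl)
    fix A assume "A \<in> Pow (E - {e})"
    then have "k A - k E = Suc (k A - k (E - {e}))" using *[of A] by auto
    then show "(x - 1) ^ (k A - k E) * (y - 1) ^ (card A + k A - k {}) =
        (x - 1) * ((x - 1) ^ (k A - k (E - {e})) * (y - 1) ^ (card A + k A - k {}))" by simp
  qed
  moreover have "(\<Sum>A\<in>Pow (E - {e}). (x - 1) ^ (k (insert e A) - k E) *
      (y - 1) ^ (card (insert e A) + k (insert e A) - k {})) = rank_poly x y (E - {e}) k"
    unfolding rank_poly_def
  proof (intro sum.cong refl)
    fix A assume "A \<in> Pow (E - {e})"
    then have "k (insert e A) - k E = k A - k (E - {e})"
       "card (insert e A) + k (insert e A) - k {} = card A + k A - k {}" using *[of A] by auto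
    then show "(x - 1) ^ (k (insert e A) - k E) * (y - 1) ^ (card (insert e A) + k (insert e A) - k {}) =
        (x - 1) ^ (k A - k (E - {e})) * (y - 1) ^ (card A + k A - k {})" by simp
  qed
  ultimately show ?thesis
    unfolding rank_poly_def[of x y E k] sum_Pow_split[OF e finite_E] by (simp add: algebra_simps)
qed

lemma not_coloop_sum:
  assumes e: "e \<in> E" and co: "k (E - {e}) = k E"
  shows "rank_poly x y E k = rank_poly x y (E - {e}) k +
    (\<Sum>A\<in>Pow (E - {e}). (x - 1) ^ (k (insert e A) - k E) * (y - 1) ^ (Suc (card A) + k (insert e A) - k {}))"
proof -
  have *: "card (insert e A) = Suc (card A)" if "A \<subseteq> E - {e}" for A
    using that finite_E finite_subset[of A E] by (subst card_insert_disjoint) auto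
  show ?thesis
    unfolding rank_poly_def[of x y E k] sum_Pow_split[OF e finite_E]
    by (auto simp: rank_poly_def co * intro!: sum.cong)
qed

text \<open>By \<open>local\<close> from the empty set, \<open>e\<close> never changes
  \<open>k\<close>. Sets with \<open>e\<close> contribute \<open>y - 1\<close> times and sets
  without it once; deletion and contraction of a loop have the same polynomial.\<close>

lemma rank_poly_loop:
  assumes e: "e \<in> E" and lo: "k {e} = k {}"
  shows "rank_poly x y E k = y * rank_poly x y (E - {e}) (\<lambda>A. k (insert e A))"
proof -
  have *: "k (insert e A) = k A" if "A \<subseteq> E - {e}" for A
  proof -
    have "A \<subseteq> E" using that by blast
    then show ?thesis using local[of "{}" A e] lo e by auto
  qed
  have co: "k (E - {e}) = k E" using *[of "E - {e}"] e by (simp add: insert_absorb)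
  have "(\<Sum>A\<in>Pow (E - {e}). (x - 1) ^ (k (insert e A) - k E) * (y - 1) ^ (Suc (card A) + k (insert e A) - k {}))
      = (y - 1) * rank_poly x y (E - {e}) k"
    unfolding rank_poly_def sum_distrib_left
  proof (intro sum.cong refl)
    fix A assume A: "A \<in> Pow (E - {e})"
    then have "k {} \<le> card A + k A" using nullity by blast
    then have "Suc (card A) + k (insert e A) - k {} = Suc (card A + k A - k {})" using * A by auto
    then show "(x - 1) ^ (k (insert e A) - k E) * (y - 1) ^ (Suc (card A) + k (insert e A) - k {}) =
      (y - 1) * ((x - 1) ^ (k A - k (E - {e})) * (y - 1) ^ (card A + k A - k {}))"
      using * A co by (simp add: mult_ac)
  qed
  moreover have "rank_poly x y (E - {e}) (\<lambda>A. k (insert e A)) = rank_poly x y (E - {e}) k"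
    by (rule rank_poly_shift[where c = 0]) (simp add: *)
  ultimately show ?thesis using not_coloop_sum[OF e co, of x y] by (simp add: algebra_simps)
qed

lemma rank_poly_ordinary:
  assumes e: "e \<in> E" and co: "k (E - {e}) = k E" and lo: "k {e} \<noteq> k {}"
  shows "rank_poly x y E k = rank_poly x y (E - {e}) (\<lambda>A. k (insert e A)) + rank_poly x y (E - {e}) k"
proof -
  \<comment> \<open>The drop from \<open>k {}\<close> to \<open>k {e}\<close> compensates for the
    extra element in \<open>Suc (card A)\<close>, as \<open>k {e}\<close> is the value of the
    contracted count at the empty set.\<close>
  have lo': "k {} = Suc (k {e})" using step[of "{}" e] e lo by auto
  have "(\<Sum>A\<in>Pow (E - {e}). (x - 1) ^ (k (insert e A) - k E) * (y - 1) ^ (Suc (card A) + k (insert e A) - k {}))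
      = rank_poly x y (E - {e}) (\<lambda>A. k (insert e A))"
    unfolding rank_poly_def by (intro sum.cong refl) (use e in \<open>simp add: lo' insert_absorb\<close>)
  then show ?thesis using not_coloop_sum[OF e co, of x y] by simp
qed

end

text \<open>Adding \<open>e\<close> lowers the count exactly if its ends are not yet equivalent, and
  equivalence persists when more pairs are added. The condition on \<open>q e\<close> admits one
  direction, both directions or the full square on the two ends; \<open>r\<close> carries the pairs
  that are always present.\<close>

lemma graphic_ncl:
  assumes "finite V" "finite E"
    and ends: "\<And>e. e \<in> E \<Longrightarrow> \<exists>u\<in>V. \<exists>v\<in>V. (u, v) \<in> q e \<and> q e \<subseteq> {u, v} \<times> {u, v}"
  shows "graphic E (\<lambda>A. ncl V (r \<union> (\<Union>e\<in>A. q e)))"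
proof
  fix A e assume e: "e \<in> E"
  then obtain u v where uv: "u \<in> V" "v \<in> V" "(u, v) \<in> q e" "q e \<subseteq> {u, v} \<times> {u, v}" using ends by blast
  have ins: "ncl V (r \<union> (\<Union>e\<in>insert e A. q e)) = ncl V (insert (u, v) (r \<union> (\<Union>e\<in>A. q e)))" for A
  proof (rule ncl_cong, rule eqv_eqI)
    let ?s = "insert (u, v) (r \<union> (\<Union>e\<in>A. q e))"
    have "q e \<subseteq> eqv ?s" using uv(4) eqv_base[of u v ?s] by (auto dest: eqv_sym)
    moreover have "r \<union> (\<Union>e\<in>A. q e) \<subseteq> eqv ?s" by (auto intro!: eqv_base)
    ultimately show "r \<union> (\<Union>e\<in>insert e A. q e) \<subseteq> eqv ?s" by auto
    show "?s \<subseteq> eqv (r \<union> (\<Union>e\<in>insert e A. q e))" using uv(3) by (auto intro!: eqv_base)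
  qed
  have iff: "ncl V (r \<union> (\<Union>e\<in>A. q e)) = (if (u, v) \<in> eqv (r \<union> (\<Union>e\<in>A. q e)) then 0 else 1)
      + ncl V (r \<union> (\<Union>e\<in>insert e A. q e))" for A
    unfolding ins by (rule ncl_insert_if[OF assms(1) uv(1,2)])
  then show "ncl V (r \<union> (\<Union>e\<in>A. q e)) = ncl V (r \<union> (\<Union>e\<in>insert e A. q e)) \<or>
     ncl V (r \<union> (\<Union>e\<in>A. q e)) = Suc (ncl V (r \<union> (\<Union>e\<in>insert e A. q e)))" by auto
  fix B assume "A \<subseteq> B" "ncl V (r \<union> (\<Union>e\<in>A. q e)) = ncl V (r \<union> (\<Union>e\<in>insert e A. q e))"
  then have "(u, v) \<in> eqv (r \<union> (\<Union>e\<in>A. q e))" using iff[of A] by (auto split: if_splits)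
  moreover have "eqv (r \<union> (\<Union>e\<in>A. q e)) \<subseteq> eqv (r \<union> (\<Union>e\<in>B. q e))"
    using \<open>A \<subseteq> B\<close> by (intro eqv_mono) auto
  ultimately show "ncl V (r \<union> (\<Union>e\<in>B. q e)) = ncl V (r \<union> (\<Union>e\<in>insert e B. q e))"
    using iff[of B] by auto
qed (use assms in simp)

section \<open>Cycles of permutations\<close>

definition gr :: "'a set \<Rightarrow> ('a \<Rightarrow> 'a) \<Rightarrow> 'a rel" where
  "gr D \<pi> = (\<lambda>z. (z, \<pi> z)) ` D"

lemma gr_iff: "(a, b) \<in> gr D \<pi> \<longleftrightarrow> a \<in> D \<and> b = \<pi> a"
  by (auto simp: gr_def)

definition ncyc :: "'a set \<Rightarrow> ('a \<Rightarrow> 'a) \<Rightarrow> nat" where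
  "ncyc D \<pi> = card (orbit \<pi> ` D)"

lemma permutes_permutation: "\<pi> permutes D \<Longrightarrow> finite D \<Longrightarrow> permutation \<pi>"
  by (auto simp: permutation_permutes)

lemma orbit_eq_iff: "permutation \<pi> \<Longrightarrow> orbit \<pi> a = orbit \<pi> b \<longleftrightarrow> b \<in> orbit \<pi> a"
  by (metis cyclic_on_orbit' orbit_cyclic_eq3 permutation_self_in_orbit)

lemma orbit_sym: "permutation \<pi> \<Longrightarrow> a \<in> orbit \<pi> b \<longleftrightarrow> b \<in> orbit \<pi> a"
  by (metis orbit_eq_iff)

lemma orbit_step_iff: "permutation \<pi> \<Longrightarrow> \<pi> u \<in> orbit \<pi> a \<longleftrightarrow> u \<in> orbit \<pi> a"
  by (metis orbit_eq_iff permutation_orbit_step)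

text \<open>An orbit follows \<pi> forwards only, but on a finite set every cycle returns, so
  backward steps add nothing.\<close>

lemma in_orbit_iff_eqv:
  assumes "\<pi> permutes D" "finite D"
  shows "b \<in> orbit \<pi> a \<longleftrightarrow> (a, b) \<in> eqv (gr D \<pi>)"
proof
  have step: "(z, \<pi> z) \<in> eqv (gr D \<pi>)" for z
    using permutes_not_in[OF assms(1), of z] by (cases "z \<in> D") (auto simp: gr_def intro: eqv_base)
  assume "b \<in> orbit \<pi> a"
  then show "(a, b) \<in> eqv (gr D \<pi>)"
    by induction (auto intro: step eqv_trans)
next
  note p = permutes_permutation[OF assms]
  assume "(a, b) \<in> eqv (gr D \<pi>)"
  then have "a \<in> orbit \<pi> a \<longleftrightarrow> b \<in> orbit \<pi> a"
    by (rule eqv_closed) (auto simp: gr_def orbit_step_iff[OF p])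
  then show "b \<in> orbit \<pi> a" using p by (simp add: permutation_self_in_orbit)
qed

lemma ncyc_eq_ncl: "\<pi> permutes D \<Longrightarrow> finite D \<Longrightarrow> ncyc D \<pi> = ncl D (gr D \<pi>)"
  unfolding ncyc_def ncl_image
  by (rule card_image_kernel)
    (simp add: eqv_class_eq_iff orbit_eq_iff permutes_permutation in_orbit_iff_eqv)

lemma ncyc_id: "ncyc D id = card D"
proof -
  have "orbit id a = {a}" for a :: 'a by (simp add: orbit_eq_singleton_iff)
  then show ?thesis by (simp add: ncyc_def card_image inj_on_def)
qed

lemma ncyc_cong:
  assumes "\<And>z. z \<in> D \<Longrightarrow> \<pi> z = \<rho> z" "\<And>z. z \<in> D \<Longrightarrow> \<pi> z \<in> D" shows "ncyc D \<pi> = ncyc D \<rho>"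
  unfolding ncyc_def by (intro arg_cong[where f = card] image_cong refl orbit_cong0[where A = D]) (use assms in auto)

text \<open>The two products are conjugate: \<rho> carries the cycles of \<pi> \<circ> \<rho> onto
  those of \<rho> \<circ> \<pi>.\<close>

lemma ncyc_comp_commute:
  assumes "\<pi> permutes D" "\<rho> permutes D" "finite D"
  shows "ncyc D (\<pi> \<circ> \<rho>) = ncyc D (\<rho> \<circ> \<pi>)"
proof -
  have p: "permutation (\<pi> \<circ> \<rho>)"
    using assms permutes_permutation permutes_compose by blast
  have "\<rho> ` orbit (\<pi> \<circ> \<rho>) d = orbit (\<rho> \<circ> \<pi>) (\<rho> d)" for d
    by (rule orbit_inverse) (auto simp: p permutation_self_in_orbit)
  then have "orbit (\<rho> \<circ> \<pi>) ` \<rho> ` D = (`) \<rho> ` orbit (\<pi> \<circ> \<rho>) ` D" by (auto simp: image_image)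
  moreover have "inj ((`) \<rho>)" using permutes_inj[OF assms(2)] by (auto simp: inj_def inj_image_eq_iff)
  ultimately show ?thesis
    by (simp add: ncyc_def permutes_image[OF assms(2)] card_image inj_on_subset[OF _ subset_UNIV])
qed

text \<open>Multiplying by a transposition splits a cycle through both points and joins two cycles
  through one each. All is decided at time \<open>n\<close>, the first return of \<open>b\<close> to
  \<open>{a, b}\<close>.\<close>

lemma transpose_comp_orbit:
  assumes p: "permutation \<pi>" and ab: "a \<noteq> b"
  shows "b \<in> orbit (transpose a b \<circ> \<pi>) a \<longleftrightarrow> b \<notin> orbit \<pi> a"
proof -
  let ?\<rho> = "transpose a b \<circ> \<pi>"
  have p': "permutation ?\<rho>" using p by (intro permutation_compose permutation_swap_id)
  define n where "n = (LEAST n. 0 < n \<and> (\<pi> ^^ n) b \<in> {a, b})"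
  have "b \<in> orbit \<pi> b" using p by (rule permutation_self_in_orbit)
  then have "\<exists>n. 0 < n \<and> (\<pi> ^^ n) b \<in> {a, b}" unfolding orbit_altdef by fastforce
  then have n: "0 < n" "(\<pi> ^^ n) b \<in> {a, b}" unfolding n_def
    by (smt (verit, best) LeastI_ex)+
  have less: "(\<pi> ^^ i) b \<notin> {a, b}" if "0 < i" "i < n" for i
    using not_less_Least[of i "\<lambda>n. 0 < n \<and> (\<pi> ^^ n) b \<in> {a, b}"] that by (auto simp: n_def)
  \<comment> \<open>Before the return both permutations agree along the path of \<open>b\<close>; at
    the return, the transposition turns arrival at \<open>a\<close> into arrival at \<open>b\<close>
    and conversely.\<close>
  have \<rho>: "i < n \<Longrightarrow> (?\<rho> ^^ i) b = (\<pi> ^^ i) b" for i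
  proof (induction i)
    case (Suc i)
    then show ?case using less[of "Suc i"] by (simp add: transpose_def)
  qed simp
  obtain m where m: "n = Suc m" using n(1) by (cases n) auto
  have \<rho>n: "(?\<rho> ^^ n) b = transpose a b ((\<pi> ^^ n) b)" using \<rho>[of m] by (simp add: m)
  show ?thesis
  proof (cases "(\<pi> ^^ n) b = a")
    case True
    then have "a \<in> orbit \<pi> b" using n(1) by (auto simp: orbit_altdef)
    moreover have "orbit ?\<rho> b = {(?\<rho> ^^ i) b |i. i < n}"
      using \<rho>n True n(1) by (intro orbit_altdef_bounded) auto
    then have "a \<notin> orbit ?\<rho> b" using \<rho> less ab by (auto; metis funpow_0 gr0I insertI1)
    ultimately show ?thesis using p p' orbit_sym by metis
  next
    case False
    then have b: "(\<pi> ^^ n) b = b" using n(2) by simp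
    then have "orbit \<pi> b = {(\<pi> ^^ i) b |i. i < n}"
      using n(1) by (rule orbit_altdef_bounded)
    then have "a \<notin> orbit \<pi> b" using less ab by (auto; metis funpow_0 gr0I insertI1)
    moreover have "(?\<rho> ^^ n) b = a" using \<rho>n b by simp
    then have "a \<in> orbit ?\<rho> b"
      using n(1) unfolding orbit_altdef by (intro CollectI exI[of _ n]) simp
    ultimately show ?thesis using p p' orbit_sym by metis
  qed
qed

lemma eqv_gr_transpose:
  assumes "a \<in> D" "b \<in> D"
  shows "eqv (insert (a, b) (gr D (transpose a b \<circ> \<pi>))) = eqv (insert (a, b) (gr D \<pi>))"
proof -
  have *: "(\<pi> z, (transpose a b \<circ> \<pi>) z) \<in> eqv (insert (a, b) r)" for z r
  proof -
    have "(a, b) \<in> eqv (insert (a, b) r)" by (simp add: eqv_base)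
    then show ?thesis by (auto simp: transpose_def dest: eqv_sym)
  qed
  have 1: "(z, \<rho> z) \<in> eqv (insert (a, b) (gr D \<rho>))" if "z \<in> D" for z \<rho>
    using that by (auto simp: gr_def intro: eqv_base)
  have 2: "(z, (transpose a b \<circ> \<pi>) z) \<in> eqv (insert (a, b) (gr D \<pi>))" if "z \<in> D" for z
    using 1[of z \<pi>, OF that] * by (rule eqv_trans)
  have 3: "(z, \<pi> z) \<in> eqv (insert (a, b) (gr D (transpose a b \<circ> \<pi>)))" if "z \<in> D" for z
    using 1[of z "transpose a b \<circ> \<pi>", OF that] eqv_sym[OF *] by (rule eqv_trans)
  show ?thesis
    by (rule eqv_eqI) (use 2 3 in \<open>auto simp: gr_def intro: eqv_base\<close>)
qed

lemma eqv_gr_merge: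
  assumes "\<pi> permutes D" "finite D" "a \<in> D" "b \<in> D" "b \<notin> orbit \<pi> a"
  shows "eqv (gr D (transpose a b \<circ> \<pi>)) = eqv (insert (a, b) (gr D \<pi>))"
proof -
  have "a \<noteq> b" using assms permutation_self_in_orbit[OF permutes_permutation] by metis
  then have "b \<in> orbit (transpose a b \<circ> \<pi>) a"
    using assms transpose_comp_orbit permutes_permutation by metis
  moreover have "transpose a b \<circ> \<pi> permutes D"
    using assms by (intro permutes_compose permutes_swap_id)
  ultimately have "(a, b) \<in> eqv (gr D (transpose a b \<circ> \<pi>))"
    using assms by (simp add: in_orbit_iff_eqv)
  then show ?thesis using eqv_gr_transpose[OF assms(3,4)] eqv_insert_absorb by metis
qed

lemma ncyc_merge:
  assumes "\<pi> permutes D" "finite D" "a \<in> D" "b \<in> D" "b \<notin> orbit \<pi> a"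
  shows "ncyc D \<pi> = Suc (ncyc D (transpose a b \<circ> \<pi>))"
proof -
  have "transpose a b \<circ> \<pi> permutes D"
    using assms by (intro permutes_compose permutes_swap_id)
  then have "ncyc D (transpose a b \<circ> \<pi>) = ncl D (insert (a, b) (gr D \<pi>))"
    using ncyc_eq_ncl ncl_cong[OF eqv_gr_merge[OF assms]] assms by metis
  then show ?thesis using ncl_insert_if[of D a b "gr D \<pi>"] assms
    by (simp add: ncyc_eq_ncl in_orbit_iff_eqv)
qed

lemma ncyc_split:
  assumes "\<pi> permutes D" "finite D" "a \<in> D" "b \<in> D" "a \<noteq> b" "b \<in> orbit \<pi> a"
  shows "ncyc D (transpose a b \<circ> \<pi>) = Suc (ncyc D \<pi>)"
proof -
  have "b \<notin> orbit (transpose a b \<circ> \<pi>) a"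
    using assms transpose_comp_orbit permutes_permutation by metis
  moreover have "transpose a b \<circ> \<pi> permutes D"
    using assms by (intro permutes_compose permutes_swap_id)
  moreover have "transpose a b \<circ> (transpose a b \<circ> \<pi>) = \<pi>" by (simp add: fun_eq_iff)
  ultimately show ?thesis using ncyc_merge[of "transpose a b \<circ> \<pi>" D a b] assms by simp
qed

section \<open>The Euler defect of a pair of permutations\<close>

text \<open>For the map with vertices the cycles of \<open>S\<close>, edges the cycles of \<open>C\<close> and faces the cycles of
  \<open>C \<circ> S\<close>, this is twice the total genus.\<close>

definition defect :: "'a set \<Rightarrow> ('a \<Rightarrow> 'a) \<Rightarrow> ('a \<Rightarrow> 'a) \<Rightarrow> int" where
  "defect D S C = 2 * int (ncl D (gr D S \<union> gr D C)) + int (card D)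
     - int (ncyc D S) - int (ncyc D C) - int (ncyc D (C \<circ> S))"

lemma eqv_gr_swap:
  assumes "e \<in> D" "f \<in> D" "C e = f" "C f = e"
  shows "eqv (insert (e, f) (gr D (transpose e f \<circ> C))) = eqv (gr D C)"
proof -
  have "(e, f) \<in> eqv (gr D C)" using assms by (auto simp: gr_def intro!: eqv_base)
  then show ?thesis using eqv_gr_transpose[OF assms(1,2)] eqv_insert_absorb by metis
qed

text \<open>Cutting adds a cycle to \<open>C\<close>. If a face cycle splits as well, the two gains
  pay for a possible new component; if two face cycles merge, gain and loss cancel and a new
  component must be excluded.\<close>

lemma defect_cut:
  assumes S: "S permutes D" and C: "C permutes D" and fin: "finite D"
    and ef: "e \<in> D" "f \<in> D" "C e = f" "C f = e" "e \<noteq> f"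
  shows "defect D S (transpose e f \<circ> C) \<le> defect D S C"
proof -
  let ?C0 = "transpose e f \<circ> C"
  have C0: "?C0 permutes D" using C ef by (intro permutes_compose permutes_swap_id)
  have CS: "C \<circ> S permutes D" "?C0 \<circ> S permutes D" using S C C0 by (auto intro: permutes_compose)
  have eq: "?C0 \<circ> S = transpose e f \<circ> (C \<circ> S)" by (simp add: comp_assoc)
  have c: "ncyc D ?C0 = Suc (ncyc D C)" using ncyc_split[OF C fin ef(1,2,5)] orbit.base[of C e] ef(3) by simp
  have "eqv (insert (e, f) (gr D S \<union> gr D ?C0)) = eqv (gr D S \<union> gr D C)"
    using eqv_union[OF eqv_gr_swap[OF ef(1-4)], of "gr D S"] by (simp add: Un_commute)
  then have k: "ncl D (gr D S \<union> gr D ?C0) = (if (e, f) \<in> eqv (gr D S \<union> gr D ?C0) then 0 else 1)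
       + ncl D (gr D S \<union> gr D C)"
    using ncl_insert_if[OF fin ef(1,2), of "gr D S \<union> gr D ?C0"] ncl_cong by metis
  show ?thesis
  proof (cases "f \<in> orbit (C \<circ> S) e")
    case True
    then have "ncyc D (?C0 \<circ> S) = Suc (ncyc D (C \<circ> S))"
      unfolding eq using ncyc_split CS(1) fin ef by metis
    then show ?thesis using k c by (auto simp: defect_def)
  next
    case False
    \<comment> \<open>The merged face cycle leads from \<open>e\<close> to \<open>f\<close> using
      only \<open>S\<close> and the cut involution, so the two stay connected.\<close>
    then have "f \<in> orbit (?C0 \<circ> S) e"
      unfolding eq using transpose_comp_orbit CS(1) fin ef permutes_permutation by metis
    then have 1: "(e, f) \<in> eqv (gr D (?C0 \<circ> S))" using in_orbit_iff_eqv CS(2) fin by metis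
    have "eqv (gr D (?C0 \<circ> S)) \<subseteq> eqv (gr D S \<union> gr D ?C0)"
    proof (intro eqv_least subrelI)
      fix a b assume "(a, b) \<in> gr D (?C0 \<circ> S)"
      then have ab: "a \<in> D" "b = ?C0 (S a)" by (auto simp: gr_iff)
      have "S a \<in> D" using ab(1) S by (simp add: permutes_in_image)
      then have "(S a, b) \<in> eqv (gr D S \<union> gr D ?C0)" by (intro eqv_base) (simp add: gr_iff ab(2))
      moreover have "(a, S a) \<in> eqv (gr D S \<union> gr D ?C0)" by (intro eqv_base) (simp add: gr_iff ab(1))
      ultimately show "(a, b) \<in> eqv (gr D S \<union> gr D ?C0)" by (blast intro: eqv_trans)
    qed
    then have "(e, f) \<in> eqv (gr D S \<union> gr D ?C0)" using 1 by blast
    moreover have "ncyc D (C \<circ> S) = Suc (ncyc D (?C0 \<circ> S))"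
      unfolding eq using ncyc_merge[OF CS(1) fin ef(1,2) False] .
    ultimately show ?thesis using k c by (auto simp: defect_def)
  qed
qed

text \<open>The edges are cut one by one, which never increases the defect. Without edges the defect
  is zero, since vertices, faces and components then all correspond to the cycles of
  \<open>S\<close>.\<close>

lemma defect_nonneg:
  assumes S: "S permutes D" and fin: "finite D"
    and "C permutes D" "\<And>z. C (C z) = z"
  shows "0 \<le> defect D S C"
  using assms(3,4)
proof (induction "card {z. C z \<noteq> z}" arbitrary: C rule: less_induct)
  case less
  have D: "{z. C z \<noteq> z} \<subseteq> D" using less.prems(1) by (auto simp: permutes_def)
  show ?case
  proof (cases "\<exists>e. C e \<noteq> e")
    case True
    then obtain e f where e: "C e = f" "e \<noteq> f" by metis
    let ?C0 = "transpose e f \<circ> C"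
    have f: "C f = e" using less.prems(2) e by metis
    have ef: "e \<in> D" "f \<in> D" using D e f by auto
    have iff: "C z = e \<longleftrightarrow> z = f" "C z = f \<longleftrightarrow> z = e" for z using less.prems(2) e f by metis+
    have 0: "?C0 z = (if z \<in> {e, f} then z else C z)" for z
      using iff e f by (auto simp: transpose_def)
    have "{z. ?C0 z \<noteq> z} = {z. C z \<noteq> z} - {e, f}" unfolding 0 by auto
    moreover have "e \<in> {z. C z \<noteq> z}" using e by auto
    ultimately have "{z. ?C0 z \<noteq> z} \<subset> {z. C z \<noteq> z}" by blast
    then have "card {z. ?C0 z \<noteq> z} < card {z. C z \<noteq> z}"
      using D fin by (meson finite_subset psubset_card_mono)
    moreover have "?C0 permutes D" using less.prems(1) ef by (intro permutes_compose permutes_swap_id)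
    moreover have "?C0 (?C0 z) = z" for z
      unfolding 0 using less.prems(2) iff by auto
    ultimately have "0 \<le> defect D S ?C0" by (rule less.hyps)
    then show ?thesis using defect_cut[OF S less.prems(1) fin ef e(1) f e(2)] by simp
  next
    case False
    then have C: "C = id" by auto
    have "eqv (gr D S \<union> gr D id) = eqv (gr D S)"
      by (rule eqv_eqI) (auto simp: gr_def intro: eqv_base)
    then have "ncl D (gr D S \<union> gr D id) = ncl D (gr D S)" by (rule ncl_cong)
    then show ?thesis using ncyc_eq_ncl[OF S fin] by (simp add: C defect_def ncyc_id)
  qed
qed

subsection \<open>Removing an element from its cycle\<close>

lemma bypass_self [simp]: "bypass e \<pi> e = e"
  by (simp add: bypass_def)

lemma bypass_fixed: "\<pi> e = e \<Longrightarrow> bypass e \<pi> = \<pi>"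
  by (auto simp: bypass_def)

lemma bypass_permutes:
  assumes "\<pi> permutes D" shows "bypass e \<pi> permutes (D - {e})"
proof (cases "\<pi> e = e")
  case True
  then have "\<pi> permutes (D - {e})"
    using assms unfolding permutes_def by (metis Diff_iff singletonD)
  then show ?thesis using True by (simp add: bypass_fixed)
next
  case False
  then have "e \<in> D" using assms by (auto simp: permutes_def)
  moreover have "bypass e \<pi> = transpose e (\<pi> e) \<circ> \<pi>"
    using permutes_inj[OF assms] False by (auto simp: fun_eq_iff bypass_def transpose_def inj_eq)
  ultimately have "bypass e \<pi> permutes D"
    using assms by (auto intro!: permutes_compose permutes_swap_id simp: permutes_in_image)
  then show ?thesis unfolding permutes_def by (metis Diff_iff bypass_self singletonD)
qed

text \<open>A fixed point \<open>e\<close> of \<pi> is a class of its own, because \<open>B\<close>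
  avoids it, and this class disappears. Otherwise \<open>e\<close> is identified with its successor
  and no class is lost.\<close>

lemma ncl_bypass:
  assumes p: "\<pi> permutes D" and fin: "finite D" and e: "e \<in> D" and B: "B \<subseteq> (D - {e}) \<times> (D - {e})"
  shows "ncl D (gr D \<pi> \<union> B) = ncl (D - {e}) (gr (D - {e}) (bypass e \<pi>) \<union> B) + (if \<pi> e = e then 1 else 0)"
proof -
  let ?D = "D - {e}"
  have im: "z \<in> D \<Longrightarrow> \<pi> z \<in> D" for z using p by (simp add: permutes_in_image)
  show ?thesis
  proof (cases "\<pi> e = e")
    case True
    have img: "gr ?D \<pi> \<subseteq> ?D \<times> ?D"
      using im permutes_inj[OF p] True by (auto simp: gr_def inj_eq dest: injD)
    have "eqv (gr D \<pi> \<union> B) = eqv (gr ?D \<pi> \<union> B)"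
    proof (rule eqv_eqI)
      have "gr D \<pi> \<subseteq> insert (e, e) (gr ?D \<pi>)" using True by (auto simp: gr_def)
      then show "gr D \<pi> \<union> B \<subseteq> eqv (gr ?D \<pi> \<union> B)" by (auto intro: eqv_base)
    qed (auto simp: gr_def intro: eqv_base)
    then have "ncl D (gr D \<pi> \<union> B) = ncl D (gr ?D \<pi> \<union> B)" by (rule ncl_cong)
    also have "D = ?D \<union> {e}" using e by auto
    also have "ncl \<dots> (gr (?D \<union> {e} - {e}) \<pi> \<union> B) = ncl ?D (gr ?D \<pi> \<union> B) + card {e}"
      using img B fin by (subst ncl_isolated) auto
    finally show ?thesis using True by (simp add: bypass_fixed insert_absorb e)
  next
    case False
    define f where "f z = (if z = e then \<pi> e else z)" for z
    have "ncl ?D (gr ?D (bypass e \<pi>) \<union> B) = ncl D (gr D \<pi> \<union> B)"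
    proof (rule ncl_transfer)
      show "f ` D = ?D" using False im[OF e] by (force simp: f_def)
      have step: "(z, \<pi> z) \<in> eqv (gr D \<pi> \<union> B)" if "z \<in> D" for z
        using that by (auto simp: gr_def intro: eqv_base)
      fix a b
      show "(f a, f b) \<in> eqv (gr ?D (bypass e \<pi>) \<union> B)" if ab: "(a, b) \<in> gr D \<pi> \<union> B"
      proof -
        consider "(a, b) \<in> B" | "a \<in> D" "a \<noteq> e" "b = \<pi> a" | "a = e" "b = \<pi> e"
          using ab by (auto simp: gr_iff)
        then show ?thesis
        proof cases
          case 1
          then have "(f a, f b) \<in> B" using B by (auto simp: f_def)
          then show ?thesis by (simp add: eqv_base)
        next
          case 2
          then have "(f a, f b) \<in> gr ?D (bypass e \<pi>)" by (auto simp: f_def gr_iff bypass_def)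
          then show ?thesis by (simp add: eqv_base)
        next
          case 3
          then show ?thesis using False by (simp add: f_def)
        qed
      qed
      show "(a, b) \<in> eqv (gr D \<pi> \<union> B)" if "a \<in> D" "b \<in> D" "f a = f b"
        using that step[OF e] by (auto simp: f_def dest: eqv_sym split: if_splits)
      show "\<exists>a'\<in>D. \<exists>b'\<in>D. f a' = a \<and> f b' = b \<and> (a', b') \<in> eqv (gr D \<pi> \<union> B)"
        if "(a, b) \<in> gr ?D (bypass e \<pi>) \<union> B"
      proof -
        have "a \<in> ?D" "b \<in> ?D" using that B im permutes_inj[OF p] False e
          by (auto simp: gr_def bypass_def inj_eq split: if_splits)
        moreover have "(a, b) \<in> eqv (gr D \<pi> \<union> B)"
        proof (cases "(a, b) \<in> B")
          case True then show ?thesis by (simp add: eqv_base)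
        next
          case False
          then have ab: "a \<in> ?D" "b = bypass e \<pi> a" using that by (auto simp: gr_iff)
          show ?thesis
          proof (cases "\<pi> a = e")
            case True
            then have "b = \<pi> e" using ab by (simp add: bypass_def)
            then show ?thesis using step[of a] step[OF e] ab True eqv_trans by fastforce
          next
            case False
            then show ?thesis using step[of a] ab by (simp add: bypass_def)
          qed
        qed
        ultimately show ?thesis by (intro bexI[of _ a] bexI[of _ b]) (auto simp: f_def)
      qed
    qed
    then show ?thesis using False by simp
  qed
qed

lemma ncyc_bypass:
  assumes "\<pi> permutes D" "finite D" "e \<in> D"
  shows "ncyc D \<pi> = ncyc (D - {e}) (bypass e \<pi>) + (if \<pi> e = e then 1 else 0)"
  using ncl_bypass[OF assms, of "{}"] ncyc_eq_ncl[OF assms(1,2)] ncyc_eq_ncl[OF bypass_permutes[OF assms(1), of e]] assms(2)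
  by simp

lemma orbit_bypass:
  assumes "\<pi> permutes D" "finite D" "a \<noteq> e" "b \<noteq> e"
  shows "b \<in> orbit (bypass e \<pi>) a \<longleftrightarrow> b \<in> orbit \<pi> a"
proof -
  have p: "permutation \<pi>" "permutation (bypass e \<pi>)"
    using permutes_permutation[OF assms(1,2)] permutes_permutation[OF bypass_permutes[OF assms(1)]] assms(2) by auto
  have 1: "z \<in> orbit (bypass e \<pi>) a \<Longrightarrow> z \<in> orbit \<pi> a" for z
    by (induction rule: orbit.induct) (use assms(3) in \<open>auto simp: bypass_def intro: orbit.intros split: if_splits\<close>)
  \<comment> \<open>At \<open>e\<close> itself, which the shortened cycle never visits, the
    invariant records instead that the successor of \<open>e\<close> has been reached, unless
    \<open>e\<close> is fixed.\<close>
  have 2: "z \<in> orbit \<pi> a \<Longrightarrow> (if z = e then \<pi> e = e \<or> \<pi> e \<in> orbit (bypass e \<pi>) a else z \<in> orbit (bypass e \<pi>) a)" for z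
  proof (induction rule: orbit.induct)
    case base
    have "bypass e \<pi> a \<in> orbit (bypass e \<pi>) a" by (rule orbit.base)
    then show ?case using assms(3) by (auto simp: bypass_def)
  next
    case (step z)
    show ?case
    proof (cases "z = e")
      case True then show ?thesis using step(2) by auto
    next
      case False
      then have "bypass e \<pi> z \<in> orbit (bypass e \<pi>) a" using step(2) by (auto intro: orbit.step)
      then show ?thesis using False by (auto simp: bypass_def)
    qed
  qed
  show ?thesis using 1 2 assms(4) by auto
qed

text \<open>Since \<open>C\<close> fixes \<open>e\<close>, removing \<open>e\<close> from the face
  permutation \<open>C \<circ> S\<close> amounts to removing it from \<open>S\<close>. The losses of
  a point and of a cycle of \<open>C\<close> cancel; if \<open>S\<close> fixes \<open>e\<close> too,
  the lost component, counted twice, cancels against a cycle of \<open>S\<close> and one of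
  \<open>C \<circ> S\<close>.\<close>

lemma defect_remove:
  assumes S: "S permutes D" and C: "C permutes D" and fin: "finite D" and e: "e \<in> D" "C e = e"
  shows "defect (D - {e}) (bypass e S) C = defect D S C"
proof -
  let ?D = "D - {e}"
  have C': "bypass e C = C" "C permutes ?D" using bypass_permutes[OF C, of e] e by (simp_all add: bypass_fixed)
  have "bypass e (C \<circ> S) = C \<circ> bypass e S"
    using permutes_inj[OF C] e by (auto simp: bypass_def fun_eq_iff inj_eq; metis injD)
  then have "ncyc D (C \<circ> S) = ncyc ?D (C \<circ> bypass e S) + (if S e = e then 1 else 0)"
    using ncyc_bypass[OF permutes_compose[OF S C] fin e(1)] permutes_inj[OF C] e(2)
    by (simp add: inj_eq) (metis e(2) injD)
  moreover have gr: "gr ?D C \<subseteq> ?D \<times> ?D" using permutes_in_image[OF C'(2)] by (auto simp: gr_def)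
  have "eqv (gr D S \<union> gr D C) = eqv (gr D S \<union> gr ?D C)"
  proof (rule eqv_eqI)
    have "gr D C \<subseteq> insert (e, e) (gr ?D C)" using e by (auto simp: gr_def)
    then show "gr D S \<union> gr D C \<subseteq> eqv (gr D S \<union> gr ?D C)" by (auto intro: eqv_base)
  qed (auto simp: gr_def intro: eqv_base)
  then have "ncl D (gr D S \<union> gr D C) = ncl ?D (gr ?D (bypass e S) \<union> gr ?D C) + (if S e = e then 1 else 0)"
    using ncl_bypass[OF S fin e(1), of "gr ?D C"] ncl_cong[of "gr D S \<union> gr D C"] gr by simp
  moreover have "ncyc D C = ncyc ?D C + 1" using ncyc_bypass[OF C fin e(1)] C' e by simp
  moreover have "card D = card ?D + 1" using e fin by (metis card_Suc_Diff1 Suc_eq_plus1)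
  ultimately show ?thesis using ncyc_bypass[OF S fin e(1)] by (simp add: defect_def)
qed

subsection \<open>Contraction\<close>

locale swapped_pair =
  fixes D :: "'a set" and S C :: "'a \<Rightarrow> 'a" and e f :: 'a
  assumes S: "S permutes D" and C: "C permutes D" and fin: "finite D"
    and inv: "C (C z) = z"
    and e: "e \<in> D" and f: "C e = f" "e \<noteq> f"
begin

abbreviation "\<tau> \<equiv> transpose e f"

lemma f': "f \<in> D" "C f = e"
  using C e f inv by (auto simp: permutes_in_image)

lemma perms: "\<tau> \<circ> S permutes D" "\<tau> \<circ> C permutes D"
  using S C e f' by (auto intro!: permutes_compose permutes_swap_id)

lemma C_eq_iff: "C z = e \<longleftrightarrow> z = f" "C z = f \<longleftrightarrow> z = e"
  using inv f f' by metis+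

lemma cut_apply: "(\<tau> \<circ> C) z = (if z \<in> {e, f} then z else C z)"
  using C_eq_iff f f' by (auto simp: transpose_def)

lemma cut_invol: "(\<tau> \<circ> C) ((\<tau> \<circ> C) z) = z"
  unfolding cut_apply using C_eq_iff inv by auto

text \<open>An involution commutes with the transposition of one of its 2-cycles, so the two factors
  \<open>\<tau>\<close> cancel: contraction does not touch the face permutation at all.\<close>

lemma faces: "(\<tau> \<circ> C) \<circ> (\<tau> \<circ> S) = C \<circ> S"
proof -
  have "\<tau> (C (\<tau> z)) = C z" for z
  proof (cases "z \<in> {e, f}")
    case True then show ?thesis using f(1) f'(2) by auto
  next
    case False
    then have "C z \<notin> {e, f}" using C_eq_iff by auto
    then show ?thesis using False by (simp add: transpose_apply_other)
  qed
  then show ?thesis by (simp add: fun_eq_iff)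
qed

lemma ncyc_C: "ncyc D (\<tau> \<circ> C) = Suc (ncyc D C)"
  using ncyc_split C fin e f'(1) f orbit.base[of C e] by metis

lemma eqv_C: "eqv (insert (e, f) (r \<union> gr D (\<tau> \<circ> C))) = eqv (r \<union> gr D C)"
  using eqv_union[OF eqv_gr_swap[OF e f'(1) f(1) f'(2)], of r] by (simp add: Un_commute)

lemma eqv_contract_nonloop:
  assumes "f \<notin> orbit S e"
  shows "eqv (gr D (\<tau> \<circ> S) \<union> r) = eqv (insert (e, f) (gr D S \<union> r))"
  using eqv_union[OF eqv_gr_merge[OF S fin e f'(1) assms]] by simp

text \<open>There is one cycle of \<open>S\<close> fewer and one cycle of \<open>C\<close> more,
  while components and faces stay the same.\<close>

lemma defect_contract_nonloop:
  assumes "f \<notin> orbit S e"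
  shows "defect D (\<tau> \<circ> S) (\<tau> \<circ> C) = defect D S C"
proof -
  have "eqv (gr D (\<tau> \<circ> S) \<union> gr D (\<tau> \<circ> C)) = eqv (gr D S \<union> gr D C)"
    using eqv_contract_nonloop[OF assms] eqv_C by simp
  then have "ncl D (gr D (\<tau> \<circ> S) \<union> gr D (\<tau> \<circ> C)) = ncl D (gr D S \<union> gr D C)" by (rule ncl_cong)
  then show ?thesis
    using ncyc_merge[OF S fin e f'(1) assms] by (simp add: defect_def faces ncyc_C)
qed

lemma eqv_contract_loop:
  assumes "f \<in> orbit S e"
  shows "eqv (insert (e, f) (gr D (\<tau> \<circ> S) \<union> r)) = eqv (gr D S \<union> r)"
proof -
  have "(e, f) \<in> eqv (gr D S)" using assms in_orbit_iff_eqv[OF S fin] by simp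
  then have "eqv (insert (e, f) (gr D (\<tau> \<circ> S))) = eqv (gr D S)"
    using eqv_gr_transpose[OF e f'(1)] eqv_insert_absorb by metis
  then have "eqv (insert (e, f) (gr D (\<tau> \<circ> S)) \<union> r) = eqv (gr D S \<union> r)" by (rule eqv_union)
  then show ?thesis by simp
qed

text \<open>A combinatorial Jordan curve theorem: splitting the vertex of a loop adds a vertex and keeps
  the faces, so by \<open>defect_nonneg\<close> the two halves cannot remain connected.\<close>

lemma defect_contract_loop:
  assumes loop: "f \<in> orbit S e" and planar: "defect D S C = 0"
  shows "defect D (\<tau> \<circ> S) (\<tau> \<circ> C) = 0" "(e, f) \<notin> eqv (gr D (\<tau> \<circ> S) \<union> gr D (\<tau> \<circ> C))"
proof -
  let ?r = "gr D (\<tau> \<circ> S) \<union> gr D (\<tau> \<circ> C)"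
  have "eqv (insert (e, f) ?r) = eqv (gr D S \<union> gr D (\<tau> \<circ> C))"
    by (rule eqv_contract_loop[OF loop])
  also have "\<dots> = eqv (insert (e, f) (gr D S \<union> gr D (\<tau> \<circ> C)))"
  proof (rule eqv_insert_absorb[symmetric])
    have "(e, f) \<in> eqv (gr D S)" using loop in_orbit_iff_eqv[OF S fin] by simp
    then show "(e, f) \<in> eqv (gr D S \<union> gr D (\<tau> \<circ> C))" using eqv_mono by blast
  qed
  also have "\<dots> = eqv (gr D S \<union> gr D C)" by (rule eqv_C)
  finally have "ncl D (insert (e, f) ?r) = ncl D (gr D S \<union> gr D C)" by (rule ncl_cong)
  then have "defect D (\<tau> \<circ> S) (\<tau> \<circ> C) = defect D S C + 2 * (if (e, f) \<in> eqv ?r then 0 else 1) - 2"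
    using ncyc_split[OF S fin e f'(1) f(2) loop] ncl_insert_if[OF fin e f'(1), of ?r]
    by (simp add: defect_def faces ncyc_C)
  moreover have "0 \<le> defect D (\<tau> \<circ> S) (\<tau> \<circ> C)"
    by (rule defect_nonneg[OF perms(1) fin perms(2) cut_invol])
  ultimately show "defect D (\<tau> \<circ> S) (\<tau> \<circ> C) = 0" "(e, f) \<notin> eqv ?r"
    using planar by (auto split: if_splits)
qed

lemma defect_delete:
  assumes "defect D S C = 0" shows "defect D S (\<tau> \<circ> C) = 0"
proof (rule antisym)
  show "defect D S (\<tau> \<circ> C) \<le> 0" using defect_cut[OF S C fin e f'(1) f(1) f'(2) f(2)] assms by simp
  show "0 \<le> defect D S (\<tau> \<circ> C)" by (rule defect_nonneg[OF S fin perms(2) cut_invol])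
qed

end

section \<open>The rank polynomial of a pair of permutations\<close>

definition edge_pairs :: "'a set \<Rightarrow> ('a \<Rightarrow> 'a) \<Rightarrow> 'a set set" where
  "edge_pairs D C = (\<lambda>z. {z, C z}) ` {z \<in> D. C z \<noteq> z}"

definition pairing :: "'a set set \<Rightarrow> 'a rel" where
  "pairing A = (\<Union>X\<in>A. X \<times> X)"

text \<open>Vertices are the cycles of \<open>S\<close>, represented by their points; at the empty
  edge set this is the number of vertices.\<close>

definition comps :: "'a set \<Rightarrow> ('a \<Rightarrow> 'a) \<Rightarrow> 'a set set \<Rightarrow> nat" where
  "comps D S A = ncl D (gr D S \<union> pairing A)"

definition map_poly :: "'r::comm_ring_1 \<Rightarrow> 'r \<Rightarrow> 'a set \<Rightarrow> ('a \<Rightarrow> 'a) \<Rightarrow> ('a \<Rightarrow> 'a) \<Rightarrow> 'r" where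
  "map_poly x y D S C = rank_poly x y (edge_pairs D C) (comps D S)"

lemma eqv_edge_pairs:
  assumes "\<And>z. C (C z) = z"
  shows "eqv (r \<union> pairing (edge_pairs D C)) = eqv (r \<union> gr D C)"
proof (rule eqv_eqI)
  have "(z, C z) \<in> eqv (r \<union> gr D C)" if "z \<in> D" for z
    using that by (auto simp: gr_iff intro: eqv_base)
  then have "pairing (edge_pairs D C) \<subseteq> eqv (r \<union> gr D C)"
    by (auto simp: pairing_def edge_pairs_def intro: eqv_sym)
  then show "r \<union> pairing (edge_pairs D C) \<subseteq> eqv (r \<union> gr D C)" by (auto intro: eqv_base)
  have "(z, C z) \<in> eqv (r \<union> pairing (edge_pairs D C))" if "z \<in> D" for z
  proof (cases "C z = z")
    case False
    then have "(z, C z) \<in> pairing (edge_pairs D C)" using that by (auto simp: pairing_def edge_pairs_def)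
    then show ?thesis by (simp add: eqv_base)
  qed simp
  then show "r \<union> gr D C \<subseteq> eqv (r \<union> pairing (edge_pairs D C))" by (auto simp: gr_def intro: eqv_base)
qed

lemma comps_edge_pairs:
  "(\<And>z. C (C z) = z) \<Longrightarrow> comps D S (edge_pairs D C) = ncl D (gr D S \<union> gr D C)"
  unfolding comps_def by (intro ncl_cong eqv_edge_pairs)

lemma pairing_mono: "A \<subseteq> B \<Longrightarrow> pairing A \<subseteq> pairing B"
  by (auto simp: pairing_def)

lemma eqv_pairing_insert: "eqv (r \<union> pairing (insert {e, f} A)) = eqv (insert (e, f) (r \<union> pairing A))"
proof (rule eqv_eqI)
  have "(e, f) \<in> eqv (insert (e, f) (r \<union> pairing A))" by (simp add: eqv_base)
  then show "r \<union> pairing (insert {e, f} A) \<subseteq> eqv (insert (e, f) (r \<union> pairing A))"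
    by (auto simp: pairing_def intro: eqv_base eqv_sym)
qed (auto simp: pairing_def intro: eqv_base)

lemma graphic_comps:
  assumes "finite D" "C permutes D" shows "graphic (edge_pairs D C) (comps D S)"
  unfolding comps_def pairing_def
  by (rule graphic_ncl) (use assms permutes_in_image[OF assms(2)] in \<open>fastforce simp: edge_pairs_def\<close>)+

text \<open>The count changes only if \<open>e\<close> is a cycle of \<open>S\<close> by itself, and
  then by one for every edge set alike, since no edge contains \<open>e\<close>.\<close>

lemma map_poly_remove:
  assumes S: "S permutes D" and C: "\<And>z. C (C z) = z" "C permutes D" and fin: "finite D" and e: "e \<in> D" "C e = e"
  shows "map_poly x y (D - {e}) (bypass e S) C = map_poly x y D S C"
proof -
  have "edge_pairs (D - {e}) C = edge_pairs D C" using e by (auto simp: edge_pairs_def)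
  moreover have "comps D S A = comps (D - {e}) (bypass e S) A + (if S e = e then 1 else 0)"
    if A: "A \<subseteq> edge_pairs D C" for A
  proof -
    have "X \<subseteq> D - {e}" if X: "X \<in> A" for X
    proof -
      obtain z where z: "z \<in> D" "C z \<noteq> z" "X = {z, C z}" using X A by (auto simp: edge_pairs_def)
      then have "z \<noteq> e" "C z \<noteq> e" using C(1)[of z] e(2) by auto
      then show ?thesis using z permutes_in_image[OF C(2)] by auto
    qed
    then have "pairing A \<subseteq> (D - {e}) \<times> (D - {e})" unfolding pairing_def by blast
    then show ?thesis unfolding comps_def by (rule ncl_bypass[OF S fin e(1)])
  qed
  then have "rank_poly x y (edge_pairs D C) (comps D S) =
      rank_poly x y (edge_pairs D C) (comps (D - {e}) (bypass e S))"
    by (rule rank_poly_shift)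
  ultimately show ?thesis by (simp add: map_poly_def)
qed

section \<open>Deletion and contraction in the rank polynomial of a plane map\<close>

context swapped_pair
begin

lemma pair_in: "{e, f} \<in> edge_pairs D C"
  using e f by (auto simp: edge_pairs_def)

lemma edge_pairs_cut: "edge_pairs D (\<tau> \<circ> C) = edge_pairs D C - {{e, f}}"
proof -
  have "{z, C z} \<noteq> {e, f}" if "z \<notin> {e, f}" for z using that by (auto simp: doubleton_eq_iff)
  moreover have "{z, C z} = {e, f}" if "z \<in> {e, f}" for z using that f f' by auto
  ultimately have "edge_pairs D C - {{e, f}} = (\<lambda>z. {z, C z}) ` {z \<in> D. C z \<noteq> z \<and> z \<notin> {e, f}}"
    unfolding edge_pairs_def by blast
  also have "\<dots> = edge_pairs D (\<tau> \<circ> C)"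
    unfolding edge_pairs_def cut_apply by (rule image_cong) auto
  finally show ?thesis ..
qed

interpretation graphic "edge_pairs D C" "comps D S"
  by (rule graphic_comps[OF fin C])

lemma comps_cut: "comps D S' (edge_pairs D C - {{e, f}}) = ncl D (gr D S' \<union> gr D (\<tau> \<circ> C))"
  unfolding edge_pairs_cut[symmetric] by (rule comps_edge_pairs) (rule cut_invol)

lemma coloop_iff:
  "comps D S (edge_pairs D C - {{e, f}}) \<noteq> comps D S (edge_pairs D C) \<longleftrightarrow>
   (e, f) \<notin> eqv (gr D S \<union> gr D (\<tau> \<circ> C))"
  unfolding comps_cut comps_edge_pairs[OF inv]
  using ncl_insert_if[OF fin e f'(1), of "gr D S \<union> gr D (\<tau> \<circ> C)"] ncl_cong[OF eqv_C, of D "gr D S"]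
  by simp

lemma loop_iff: "comps D S {{e, f}} = comps D S {} \<longleftrightarrow> f \<in> orbit S e"
proof -
  have "eqv (gr D S \<union> pairing {{e, f}}) = eqv (insert (e, f) (gr D S))"
    using eqv_pairing_insert[of "gr D S" e f "{}"] by (simp add: pairing_def)
  then have "comps D S {{e, f}} = ncl D (insert (e, f) (gr D S))"
    unfolding comps_def by (rule ncl_cong)
  moreover have "comps D S {} = ncl D (gr D S)" by (simp add: comps_def pairing_def)
  ultimately show ?thesis
    using ncl_insert_if[OF fin e f'(1), of "gr D S"] in_orbit_iff_eqv[OF S fin, of f e] by auto
qed

text \<open>The contraction demanded by the rank polynomial and the one performed on the map have
  component counts that agree for a non-loop and differ by a constant for a loop.\<close>

lemma contraction_poly:
  assumes planar: "defect D S C = 0"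
  shows "rank_poly x y (edge_pairs D C - {{e, f}}) (\<lambda>A. comps D S (insert {e, f} A)) =
         map_poly x y D (\<tau> \<circ> S) (\<tau> \<circ> C)"
proof (cases "f \<in> orbit S e")
  case False
  have "comps D S (insert {e, f} A) = comps D (\<tau> \<circ> S) A" for A
    unfolding comps_def
    by (intro ncl_cong) (simp only: eqv_pairing_insert eqv_contract_nonloop[OF False])
  then show ?thesis by (simp add: map_poly_def edge_pairs_cut)
next
  case True
  have "comps D (\<tau> \<circ> S) A = comps D S (insert {e, f} A) + 1" if "A \<subseteq> edge_pairs D C - {{e, f}}" for A
  proof -
    let ?r = "gr D (\<tau> \<circ> S) \<union> pairing A"
    \<comment> \<open>The Jordan argument separates \<open>e\<close> from \<open>f\<close> with all
      other edges present. Fewer edges cannot reconnect them, so the shift is the same for every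
      \<open>A\<close>.\<close>
    have "eqv ?r \<subseteq> eqv (gr D (\<tau> \<circ> S) \<union> pairing (edge_pairs D (\<tau> \<circ> C)))"
      using pairing_mono that edge_pairs_cut by (intro eqv_mono) blast
    also have "\<dots> = eqv (gr D (\<tau> \<circ> S) \<union> gr D (\<tau> \<circ> C))"
      by (rule eqv_edge_pairs[OF cut_invol])
    finally have "(e, f) \<notin> eqv ?r" using defect_contract_loop(2)[OF True planar] by blast
    moreover have eq: "eqv (insert (e, f) ?r) = eqv (gr D S \<union> pairing (insert {e, f} A))"
    proof -
      have ef: "(e, f) \<in> eqv (gr D S)" using True in_orbit_iff_eqv[OF S fin] by simp
      then have "(e, f) \<in> eqv (gr D S \<union> pairing A)" using eqv_mono by blast
      then show ?thesis
        unfolding eqv_contract_loop[OF True] eqv_pairing_insert by (simp add: eqv_insert_absorb)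
    qed
    ultimately show ?thesis
      using ncl_insert_if[OF fin e f'(1), of ?r] ncl_cong[OF eq, of D] unfolding comps_def by simp
  qed
  then show ?thesis
    unfolding map_poly_def edge_pairs_cut by (intro rank_poly_shift[symmetric]) blast
qed

lemma map_poly_coloop:
  assumes "(e, f) \<notin> eqv (gr D S \<union> gr D (\<tau> \<circ> C))"
  shows "map_poly x y D S C = x * map_poly x y D S (\<tau> \<circ> C)"
  using rank_poly_coloop[OF pair_in, of x y] coloop_iff assms by (simp add: map_poly_def edge_pairs_cut)

lemma map_poly_loop:
  assumes "defect D S C = 0" "f \<in> orbit S e"
  shows "map_poly x y D S C = y * map_poly x y D (\<tau> \<circ> S) (\<tau> \<circ> C)"
  using rank_poly_loop[OF pair_in, of x y] loop_iff assms(2)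
  unfolding contraction_poly[OF assms(1)] by (simp add: map_poly_def)

lemma map_poly_ordinary:
  assumes "defect D S C = 0" "f \<notin> orbit S e" "(e, f) \<in> eqv (gr D S \<union> gr D (\<tau> \<circ> C))"
  shows "map_poly x y D S C = map_poly x y D (\<tau> \<circ> S) (\<tau> \<circ> C) + map_poly x y D S (\<tau> \<circ> C)"
  using rank_poly_ordinary[OF pair_in, of x y] loop_iff coloop_iff assms(2,3)
  unfolding contraction_poly[OF assms(1)] by (simp add: map_poly_def edge_pairs_cut)

end

section \<open>Alternating dimaps with c-faces of size at most two\<close>

text \<open>The head of \<open>z\<close> is followed clockwise by the tail of its left successor,
  and the tail of \<open>z\<close> by the head of its c-face partner \<open>C z\<close>. Two turns
  thus take a head to the next head by \<open>S\<close>. That the left successor is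
  \<open>C \<circ> S\<close> is the product identity of the three permutations of a dimap, with
  \<open>C\<close> as right successor.\<close>

locale coded_dimap =
  fixes H :: "'a dimap" and S C :: "'a \<Rightarrow> 'a"
  assumes fin: "finite (arcs H)" and S: "S permutes arcs H" and C: "C permutes arcs H"
    and inv: "C (C z) = z"
    and turn: "z \<in> arcs H \<Longrightarrow> turn H (z, True) = (C (S z), False)"
      "z \<in> arcs H \<Longrightarrow> turn H (z, False) = (C z, True)"
      "z \<notin> arcs H \<Longrightarrow> turn H (z, b) = (z, b)"
begin

abbreviation "D \<equiv> arcs H"

lemma C_inj: "C u = C v \<longleftrightarrow> u = v"
  by (metis inv)

lemma S_eq_iff: "S u = S v \<longleftrightarrow> u = v"
  using permutes_inj[OF S] by (simp add: inj_eq)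

lemma im [simp]: "C z \<in> D \<longleftrightarrow> z \<in> D" "S z \<in> D \<longleftrightarrow> z \<in> D"
  using S C by (simp_all add: permutes_in_image)

lemma S_permutation: "permutation S"
  using S fin by (rule permutes_permutation)

lemma turn_permutes: "turn H permutes D \<times> UNIV"
proof (rule inj_imp_permutes)
  show "inj_on (turn H) (D \<times> UNIV)"
  proof (rule inj_onI, clarify)
    fix u b v c assume "u \<in> D" "v \<in> D" "turn H (u, b) = turn H (v, c)"
    then show "u = v \<and> b = c" by (cases b; cases c) (auto simp: turn C_inj S_eq_iff)
  qed
  show "turn H d \<in> D \<times> UNIV" if "d \<in> D \<times> UNIV" for d
  proof -
    obtain u b where "d = (u, b)" by force
    then show ?thesis using that by (cases b) (auto simp: turn)
  qed
  show "turn H d = d" if "d \<notin> D \<times> UNIV" for d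
    using that turn(3)[of "fst d" "snd d"] by (cases d) auto
qed (use fin in simp)

lemma turn_permutation: "permutation (turn H)"
  using turn_permutes fin by (intro permutes_permutation[of _ "D \<times> UNIV"]) auto

lemma right_succ_eq: "right_succ H = C"
proof
  fix z
  have "inv (turn H) (z, True) = (C z, if z \<in> D then False else True)"
  proof (rule inv_f_eq)
    show "inj (turn H)" using turn_permutes by (rule permutes_inj)
    show "turn H (C z, if z \<in> D then False else True) = (z, True)"
      using permutes_not_in[OF C, of z] by (auto simp: turn inv)
  qed
  then show "right_succ H z = C z" by (simp add: right_succ_def)
qed

lemma left_succ_eq: "left_succ H z = C (S z)"
  using permutes_not_in[OF C, of z] permutes_not_in[OF S, of z]
  by (cases "z \<in> D") (auto simp: left_succ_def turn)

lemma loop_\<omega>2_iff: "loop_\<omega>2 H e \<longleftrightarrow> C e = e"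
  by (simp add: loop_\<omega>2_def c_face_def right_succ_eq orbit_eq_singleton_iff)

lemma loop_\<omega>_iff: "loop_\<omega> H e \<longleftrightarrow> C (S e) = e"
  by (simp add: loop_\<omega>_def a_face_def orbit_eq_singleton_iff left_succ_eq)

lemma turn_twice: "z \<in> D \<Longrightarrow> turn H (turn H (z, True)) = (S z, True)"
  by (simp add: turn inv)

lemma head_orbit_iff: "z \<in> D \<Longrightarrow> (w, True) \<in> orbit (turn H) (z, True) \<longleftrightarrow> w \<in> orbit S z"
proof
  assume z: "z \<in> D"
  have self: "z \<in> orbit S z" using S_permutation by (rule permutation_self_in_orbit)
  \<comment> \<open>Invariant of the walk around the vertex: a head end is recorded by its arc, a
    tail end of \<open>u\<close> by \<open>C u\<close>, whose head comes next.\<close>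
  have step: "fst (turn H d) \<in> D \<and> (if snd (turn H d) then fst (turn H d) \<in> orbit S z else C (fst (turn H d)) \<in> orbit S z)"
    if "fst d \<in> D" "if snd d then fst d \<in> orbit S z else C (fst d) \<in> orbit S z" for d
    using that by (cases d; cases "snd d") (auto simp: turn inv intro: orbit.step)
  have "fst d \<in> D \<and> (if snd d then fst d \<in> orbit S z else C (fst d) \<in> orbit S z)"
    if "d \<in> orbit (turn H) (z, True)" for d
    using that by induction (rule step; use z self in auto)+
  then show "(w, True) \<in> orbit (turn H) (z, True) \<Longrightarrow> w \<in> orbit S z" by fastforce
  have self': "(z, True) \<in> orbit (turn H) (z, True)" using turn_permutation by (rule permutation_self_in_orbit)
  have "w \<in> D \<and> (w, True) \<in> orbit (turn H) (z, True)" if "w \<in> orbit S z"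
    using that
  proof induction
    case base
    then show ?case using z orbit.step[OF orbit.step[OF self']] turn_twice[OF z] by simp
  next
    case (step u)
    then show ?case using orbit.step[OF orbit.step, of "(u, True)" "turn H" "(z, True)"] turn_twice[of u] by simp
  qed
  then show "w \<in> orbit S z \<Longrightarrow> (w, True) \<in> orbit (turn H) (z, True)" by blast
qed

lemma head_vertex_eq_iff:
  "a \<in> D \<Longrightarrow> head_vertex H a = head_vertex H b \<longleftrightarrow> b \<in> orbit S a"
  unfolding head_vertex_def by (simp add: orbit_eq_iff[OF turn_permutation] head_orbit_iff)

lemma tail_vertex_eq: "z \<in> D \<Longrightarrow> tail_vertex H z = head_vertex H (C z)"
  using permutation_orbit_step[OF turn_permutation, of "(z, False)"]
  by (simp add: tail_vertex_def head_vertex_def turn)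

lemma semiloop_1_iff: "e \<in> D \<Longrightarrow> semiloop_1 H e \<longleftrightarrow> C e \<in> orbit S e"
  using head_vertex_eq_iff[of e "C e"] by (auto simp: semiloop_1_def tail_vertex_eq)

text \<open>Such a loop puts three distinct ends at its vertex: its own two and the head of its
  partner. Hence it can fail to be a proper semiloop only by being an \<omega>-loop, and the factor
  \<open>y\<close> applies to both.\<close>

lemma semiloop_1_not_loop_1:
  assumes "e \<in> D" "C e \<noteq> e" "semiloop_1 H e" shows "\<not> loop_1 H e"
proof
  assume "loop_1 H e"
  then have card: "card (head_vertex H e) = 2" by (simp add: loop_1_def)
  have "(e, True) \<in> head_vertex H e"
    unfolding head_vertex_def using turn_permutation by (rule permutation_self_in_orbit)
  moreover have "(e, False) \<in> head_vertex H e"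
    using assms(3) permutation_self_in_orbit[OF turn_permutation, of "(e, False)"]
    by (simp add: semiloop_1_def tail_vertex_def)
  moreover have "(C e, True) \<in> head_vertex H e"
    using assms(1,3) semiloop_1_iff by (simp add: head_vertex_def head_orbit_iff)
  ultimately have sub: "{(e, True), (e, False), (C e, True)} \<subseteq> head_vertex H e" by blast
  have "finite (head_vertex H e)" using card by (metis card.infinite zero_neq_numeral)
  then show False using card_mono[OF _ sub] card assms(2) by simp
qed

subsection \<open>Reductions\<close>

lemma remove_arc_coded:
  assumes e: "e \<in> D" "C e = e"
  shows "coded_dimap (remove_arc e H) (bypass e S) C"
proof
  show "finite (arcs (remove_arc e H))" using fin by (simp add: remove_arc_def)
  show "bypass e S permutes arcs (remove_arc e H)"
    using bypass_permutes[OF S] by (simp add: remove_arc_def)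
  show "C permutes arcs (remove_arc e H)"
    using bypass_permutes[OF C, of e] e by (simp add: remove_arc_def bypass_fixed)
  show "C (C z) = z" for z by (rule inv)
  fix z
  have Ce: "C u = e \<longleftrightarrow> u = e" for u using e(2) inv by metis
  show "turn (remove_arc e H) (z, True) = (C (bypass e S z), False)" if "z \<in> arcs (remove_arc e H)"
    using that e by (auto simp: remove_arc_def bypass_edge_def bypass_def turn Ce)
  show "turn (remove_arc e H) (z, False) = (C z, True)" if "z \<in> arcs (remove_arc e H)"
    using that e by (auto simp: remove_arc_def bypass_edge_def bypass_def turn Ce)
  show "turn (remove_arc e H) (z, b) = (z, b)" if "z \<notin> arcs (remove_arc e H)" for b
  proof (cases "z = e")
    case True
    then show ?thesis by (cases b) (auto simp: remove_arc_def bypass_edge_def bypass_def)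
  next
    case False
    then have "z \<notin> D" using that by (simp add: remove_arc_def)
    then show ?thesis using False by (simp add: remove_arc_def bypass_edge_def bypass_def turn(3))
  qed
qed

text \<open>The tail of \<open>e\<close> is immediately followed by its head, so the transposition
  only takes the head out of the cycle, and the head is bypassed anyway: the 1-reduction is plain
  removal.\<close>

lemma reduce_1_fixed_coded:
  assumes e: "e \<in> D" "C e = e"
  shows "coded_dimap (reduce_1 H e) (bypass e S) C"
proof -
  have Ce: "C u = e \<longleftrightarrow> u = e" for u using e(2) inv by metis
  have "turn (reduce_1 H e) d = turn (remove_arc e H) d" for d
    by (cases d; cases "snd d"; cases "fst d \<in> D")
      (use e in \<open>auto simp: remove_arc_def reduce_1_def bypass_edge_def bypass_def turn Ce transpose_def\<close>)
  then have "reduce_1 H e = remove_arc e H"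
    by (intro dimap.equality ext) (simp_all add: reduce_1_def remove_arc_def)
  then show ?thesis using remove_arc_coded[OF e] by simp
qed

end

locale coded_dimap_pair = coded_dimap H S C for H :: "'a dimap" and S C +
  fixes e f :: 'a
  assumes e: "e \<in> arcs H" and f: "C e = f" "e \<noteq> f"
begin

sublocale pair?: swapped_pair "arcs H" S C e f
  by unfold_locales (use fin S C inv e f in auto)

lemma reduce_\<omega>2_coded: "coded_dimap (reduce_\<omega>2 H e) (bypass e S) (\<tau> \<circ> C)"
proof -
  \<comment> \<open>Exchanging the tails already yields the code of the deletion: heads keep their
    order, so \<open>S\<close> stays, while \<open>e\<close> and \<open>f\<close> become
    \<omega>2-loops. Only the removal of a fixed point of the involution is left.\<close>
  have "coded_dimap (exchange_tails e f H) S (\<tau> \<circ> C)"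
  proof
    fix z
    show "turn (exchange_tails e f H) (z, True) = ((\<tau> \<circ> C) (S z), False)" if "z \<in> arcs (exchange_tails e f H)"
      using that e by (auto simp: exchange_tails_def turn transpose_def)
    show "turn (exchange_tails e f H) (z, False) = ((\<tau> \<circ> C) z, True)" if "z \<in> arcs (exchange_tails e f H)"
      unfolding cut_apply using that e f'(1) f f'(2)
      by (auto simp: exchange_tails_def turn transpose_def C_eq_iff)
    show "turn (exchange_tails e f H) (z, b) = (z, b)" if "z \<notin> arcs (exchange_tails e f H)" for b
    proof -
      have "z \<notin> D" "z \<noteq> e" "z \<noteq> f" using that e f' by (auto simp: exchange_tails_def)
      then show ?thesis by (simp add: exchange_tails_def turn(3) transpose_def)
    qed
  qed (use fin S perms cut_invol in \<open>simp_all add: exchange_tails_def\<close>)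
  then show ?thesis
    unfolding reduce_\<omega>2_def right_succ_eq f(1)
    by (rule coded_dimap.remove_arc_coded) (use e cut_apply[of e] in \<open>simp_all add: exchange_tails_def\<close>)
qed

lemma reduce_1_coded: "coded_dimap (reduce_1 H e) (bypass e (\<tau> \<circ> S)) (\<tau> \<circ> C)"
proof
  have arcs: "arcs (reduce_1 H e) = D - {e}" by (simp add: reduce_1_def remove_arc_def)
  show "bypass e (\<tau> \<circ> S) permutes arcs (reduce_1 H e)"
    unfolding arcs by (rule bypass_permutes[OF perms(1)])
  show "\<tau> \<circ> C permutes arcs (reduce_1 H e)"
    unfolding arcs using bypass_permutes[OF perms(2), of e] cut_apply[of e] by (simp add: bypass_fixed)
  show "(\<tau> \<circ> C) ((\<tau> \<circ> C) z) = z" for z by (rule cut_invol)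
  fix z
  have Ce: "C u = e \<longleftrightarrow> u = f" for u using C_eq_iff by simp
  have fe: "f \<noteq> e" using f by simp
  show "turn (reduce_1 H e) (z, True) = ((\<tau> \<circ> C) (bypass e (\<tau> \<circ> S) z), False)" if "z \<in> arcs (reduce_1 H e)"
  proof -
    have z: "z \<in> D" "z \<noteq> e" using that by (auto simp: arcs)
    \<comment> \<open>By \<open>faces\<close> the left successor before removal of \<open>e\<close>
      is still \<open>C \<circ> S\<close>. Only the arc whose left successor was \<open>e\<close>,
      which means \<open>S z = f\<close>, is passed on to the left successor of
      \<open>e\<close>.\<close>
    have "(\<tau> \<circ> C) (bypass e (\<tau> \<circ> S) z) = (if S z = f then C (S e) else C (S z))"
    proof -
      have faces': "(\<tau> \<circ> C) ((\<tau> \<circ> S) u) = C (S u)" for u using faces by (metis comp_apply)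
      have "(\<tau> \<circ> S) z = e \<longleftrightarrow> S z = f" using fe by (auto simp: transpose_def)
      then show ?thesis using z(2) faces'[of z] faces'[of e] by (auto simp: bypass_def)
    qed
    moreover have "turn (reduce_1 H e) (z, True) = ((if S z = f then C (S e) else C (S z)), False)"
      using z e by (auto simp: reduce_1_def remove_arc_def bypass_edge_def bypass_def turn transpose_def Ce)
    ultimately show ?thesis by simp
  qed
  show "turn (reduce_1 H e) (z, False) = ((\<tau> \<circ> C) z, True)" if "z \<in> arcs (reduce_1 H e)"
  proof -
    have z: "z \<in> D" "z \<noteq> e" using that by (auto simp: arcs)
    then show ?thesis unfolding cut_apply
      using e f fe by (auto simp: reduce_1_def remove_arc_def bypass_edge_def bypass_def turn transpose_def Ce)
  qed
  show "turn (reduce_1 H e) (z, b) = (z, b)" if "z \<notin> arcs (reduce_1 H e)" for b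
  proof (cases "z = e")
    case True
    then show ?thesis by (cases b) (auto simp: reduce_1_def remove_arc_def bypass_edge_def bypass_def)
  next
    case False
    then have "z \<notin> D" using that by (simp add: arcs)
    then show ?thesis using False
      by (simp add: reduce_1_def remove_arc_def bypass_edge_def bypass_def turn(3) transpose_def)
  qed
qed (use fin in \<open>simp add: reduce_1_def remove_arc_def\<close>)

end

section \<open>Genus and separating pairs\<close>

definition adj :: "('e dart \<Rightarrow> 'v) \<Rightarrow> 'e set \<Rightarrow> 'v rel" where
  "adj p A = (\<lambda>d. (p d, p (opp d))) ` (A \<times> UNIV)"

text \<open>The flip is made the identity outside the darts so that it permutes them; it plays the
  part of \<open>C\<close> for an embedded graph.\<close>

definition opp_on :: "'e dart set \<Rightarrow> 'e dart \<Rightarrow> 'e dart" where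
  "opp_on D d = (if d \<in> D then opp d else d)"

lemma num_components_eq: "num_components G = ncl (verts G) (adj (endpt G) (edges G))"
proof -
  have "adjacency G = adj (endpt G) (edges G)"
    by (auto simp: adjacency_def adj_def darts_def)
  moreover have "(adjacency G)\<inverse> \<subseteq> adjacency G"
  proof (rule subrelI)
    fix u v assume "(u, v) \<in> (adjacency G)\<inverse>"
    then obtain d where "d \<in> darts G" "v = endpt G d" "u = endpt G (opp d)"
      by (auto simp: adjacency_def)
    then show "(u, v) \<in> adjacency G"
      unfolding adjacency_def by (intro CollectI exI[of _ "opp d"]) simp
  qed
  then have "adjacency G \<union> (adjacency G)\<inverse> = adjacency G" by blast
  ultimately show ?thesis by (simp add: num_components_def ncl_def eqv_def)
qed

lemma opp_on_permutes: "opp_on (darts G) permutes darts G"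
  unfolding permutes_def
proof (intro conjI allI)
  fix d
  show "d \<notin> darts G \<longrightarrow> opp_on (darts G) d = d" by (simp add: opp_on_def)
  have inv: "opp_on (darts G) (opp_on (darts G) u) = u" for u by (simp add: opp_on_def)
  then show "\<exists>!u. opp_on (darts G) u = d" by metis
qed

lemma opp_on_opp_on [simp]: "opp_on (darts G) (opp_on (darts G) d) = d"
  by (simp add: opp_on_def)

lemma ncyc_opp_on: "ncyc (darts G) (opp_on (darts G)) = card (edges G)"
proof -
  have "orbit (opp_on (darts G)) d = {fst d} \<times> UNIV" if "d \<in> darts G" for d
  proof -
    have 2: "(opp_on (darts G) ^^ 2) d = d" by (simp add: numeral_2_eq_2)
    have "orbit (opp_on (darts G)) d = {(opp_on (darts G) ^^ m) d |m. m < 2}"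
      by (rule orbit_altdef_bounded[OF 2]) simp
    also have "\<dots> = {d, opp d}"
      using that by (auto simp: less_2_cases_iff opp_on_def intro: exI[of _ 0] exI[of _ "Suc 0"])
    also have "\<dots> = {fst d} \<times> UNIV" by (cases d; cases "snd d") (auto simp: opp_def)
    finally show ?thesis .
  qed
  then have "orbit (opp_on (darts G)) ` darts G = (\<lambda>d. {fst d} \<times> UNIV) ` darts G"
    by (rule image_cong[OF refl])
  also have "\<dots> = (\<lambda>e. {e} \<times> UNIV) ` edges G" by (force simp: darts_def)
  also have "card \<dots> = card (edges G)" by (rule card_image) (auto simp: inj_on_def)
  finally show ?thesis by (simp add: ncyc_def)
qed

text \<open>Vertices that carry darts are the cycles of \<open>rot G\<close>; each of the others is
  a component by itself, and their number does not depend on \<open>A\<close>.\<close>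

lemma embedded_ncl:
  assumes G: "embedded_graph G" and A: "A \<subseteq> edges G"
  shows "ncl (verts G) (adj (endpt G) A) =
    ncl (darts G) (gr (darts G) (rot G) \<union> gr (A \<times> UNIV) opp) + card (verts G - endpt G ` darts G)"
proof -
  let ?D = "darts G" and ?r = "adj (endpt G) A"
  have fin: "finite (verts G)" "finite ?D" and sub: "endpt G ` ?D \<subseteq> verts G" and p: "rot G permutes ?D"
    using G by (auto simp: embedded_graph_def darts_def)
  have orb: "endpt G d = endpt G d' \<longleftrightarrow> d' \<in> orbit (rot G) d" if "d \<in> ?D" "d' \<in> ?D" for d d'
    using G that by (simp add: embedded_graph_def)
  have AD: "A \<times> UNIV \<subseteq> ?D" using A by (auto simp: darts_def)
  then have "?r \<subseteq> endpt G ` ?D \<times> endpt G ` ?D" by (auto simp: adj_def)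
  moreover have "verts G = endpt G ` ?D \<union> (verts G - endpt G ` ?D)" using sub by blast
  ultimately have "ncl (verts G) ?r = ncl (endpt G ` ?D) ?r + card (verts G - endpt G ` ?D)"
    using ncl_isolated[of "endpt G ` ?D" "verts G - endpt G ` ?D" ?r] fin by auto
  also have "ncl (endpt G ` ?D) ?r = ncl ?D (gr ?D (rot G) \<union> gr (A \<times> UNIV) opp)"
  proof (rule ncl_transfer[OF refl])
    fix a b
    show "(endpt G a, endpt G b) \<in> eqv ?r" if "(a, b) \<in> gr ?D (rot G) \<union> gr (A \<times> UNIV) opp"
    proof (cases "(a, b) \<in> gr ?D (rot G)")
      case True
      then have "endpt G a = endpt G b"
        using orb[of a b] p by (auto simp: gr_iff permutes_in_image orbit.base)
      then show ?thesis by simp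
    next
      case False
      then have "(endpt G a, endpt G b) \<in> ?r" using that unfolding adj_def gr_def by blast
      then show ?thesis by (rule eqv_base)
    qed
    show "(a, b) \<in> eqv (gr ?D (rot G) \<union> gr (A \<times> UNIV) opp)" if "a \<in> ?D" "b \<in> ?D" "endpt G a = endpt G b"
    proof -
      have "(a, b) \<in> eqv (gr ?D (rot G))" using orb that in_orbit_iff_eqv[OF p fin(2)] by blast
      then show ?thesis using eqv_mono by blast
    qed
  next
    fix u v assume "(u, v) \<in> ?r"
    then obtain d where d: "d \<in> A \<times> UNIV" "u = endpt G d" "v = endpt G (opp d)" by (auto simp: adj_def)
    then have "(d, opp d) \<in> gr (A \<times> UNIV) opp" by (simp add: gr_iff)
    then have "(d, opp d) \<in> eqv (gr ?D (rot G) \<union> gr (A \<times> UNIV) opp)" by (simp add: eqv_base)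
    then show "\<exists>a\<in>?D. \<exists>b\<in>?D. endpt G a = u \<and> endpt G b = v \<and> (a, b) \<in> eqv (gr ?D (rot G) \<union> gr (A \<times> UNIV) opp)"
      using d AD by (intro bexI[of _ d] bexI[of _ "opp d"]) auto
  qed
  finally show ?thesis .
qed

text \<open>An isolated vertex counts once as component, as vertex and as face, and so cancels. The
  face permutations \<open>rot G \<circ> opp\<close> and \<open>opp \<circ> rot G\<close> are
  conjugate on the darts, and the number of darts minus the number of flip cycles is the number of
  edges.\<close>

lemma genus_eq_defect:
  assumes G: "embedded_graph G"
  shows "2 * genus G = of_int (defect (darts G) (rot G) (opp_on (darts G)))"
proof -
  let ?D = "darts G" and ?iso = "card (verts G - endpt G ` darts G)"
  have fin: "finite (verts G)" "finite ?D" "finite (edges G)" and sub: "endpt G ` ?D \<subseteq> verts G" and p: "rot G permutes ?D"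
    using G by (auto simp: embedded_graph_def darts_def)
  have "gr (edges G \<times> UNIV) opp = gr ?D (opp_on ?D)" by (auto simp: gr_def opp_on_def darts_def)
  then have k: "num_components G = ncl ?D (gr ?D (rot G) \<union> gr ?D (opp_on ?D)) + ?iso"
    unfolding num_components_eq by (simp add: embedded_ncl[OF G])
  have "card (verts G) = card (endpt G ` ?D) + ?iso"
    using fin sub by (metis card_Diff_subset card_mono finite_imageI le_add_diff_inverse)
  also have "card (endpt G ` ?D) = ncyc ?D (rot G)"
    unfolding ncyc_def
  proof (rule card_image_kernel)
    fix a b assume "a \<in> ?D" "b \<in> ?D"
    then show "endpt G a = endpt G b \<longleftrightarrow> orbit (rot G) a = orbit (rot G) b"
      using G orbit_eq_iff[OF permutes_permutation[OF p fin(2)]] by (simp add: embedded_graph_def)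
  qed
  finally have v: "card (verts G) = ncyc ?D (rot G) + ?iso" .
  have "ncyc ?D (rot G \<circ> opp) = ncyc ?D (rot G \<circ> opp_on ?D)"
    using p by (intro ncyc_cong) (auto simp: opp_on_def permutes_in_image)
  also have "\<dots> = ncyc ?D (opp_on ?D \<circ> rot G)"
    using p opp_on_permutes fin(2) by (rule ncyc_comp_commute)
  finally have f: "num_faces G = ncyc ?D (opp_on ?D \<circ> rot G) + ?iso"
    by (simp add: num_faces_def ncyc_def)
  have "card ?D = 2 * card (edges G)" using fin by (simp add: darts_def card_cartesian_product)
  then show ?thesis
    unfolding genus_def k v f defect_def ncyc_opp_on by (simp add: field_simps)
qed

lemma embedded_delete_embedded:
  assumes G: "embedded_graph G" and e: "e \<in> edges G"
  shows "embedded_graph (embedded_delete G e)"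
    and "genus G = 0 \<Longrightarrow> genus (embedded_delete G e) = 0"
proof -
  let ?D = "darts G" and ?a = "(e, True)" and ?b = "(e, False)" and ?G = "embedded_delete G e"
  have fin: "finite (verts G)" "finite ?D" "finite (edges G)" and sub: "endpt G ` ?D \<subseteq> verts G" and p: "rot G permutes ?D"
    using G by (auto simp: embedded_graph_def darts_def)
  have D': "darts ?G = ?D - {?a} - {?b}" by (auto simp: embedded_delete_def darts_def; metis (full_types))
  have rot: "rot ?G = bypass ?b (bypass ?a (rot G))" by (simp add: embedded_delete_def bypass_edge_def)
  have p1: "bypass ?a (rot G) permutes (?D - {?a})" using p by (rule bypass_permutes)
  have p2: "rot ?G permutes darts ?G" unfolding rot D' using p1 by (rule bypass_permutes)
  have "d' \<in> orbit (rot ?G) d \<longleftrightarrow> d' \<in> orbit (rot G) d" if "d \<in> darts ?G" "d' \<in> darts ?G" for d d'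
    using that orbit_bypass[OF p1, of d ?b d'] orbit_bypass[OF p fin(2), of d ?a d'] fin(2)
    unfolding rot D' by auto
  then show emb: "embedded_graph ?G"
    using G p2 sub unfolding embedded_graph_def
    by (simp add: embedded_delete_def darts_def) blast
  assume "genus G = 0"
  then have 0: "defect ?D (rot G) (opp_on ?D) = 0" using genus_eq_defect[OF G] by simp
  have ab: "?a \<in> ?D" "?b \<in> ?D" using e by (auto simp: darts_def)
  then have oppa: "opp_on ?D ?a = ?b" by (simp add: opp_on_def opp_def)
  \<comment> \<open>Deletion is done in stages of known effect on the defect: the edge is cut into
    two half-edges, which are then removed one at a time.\<close>
  interpret swapped_pair ?D "rot G" "opp_on ?D" ?a ?b
    by unfold_locales (use p opp_on_permutes fin ab oppa in auto)
  have C: "\<tau> \<circ> opp_on ?D = opp_on (darts ?G)"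
    unfolding fun_eq_iff cut_apply D' by (auto simp: opp_on_def)
  have "defect (?D - {?a} - {?b}) (bypass ?b (bypass ?a (rot G))) (\<tau> \<circ> opp_on ?D) =
        defect (?D - {?a}) (bypass ?a (rot G)) (\<tau> \<circ> opp_on ?D)"
  proof (rule defect_remove[OF p1])
    show "\<tau> \<circ> opp_on ?D permutes ?D - {?a}"
      using bypass_permutes[OF perms(2), of ?a] cut_apply[of ?a] by (simp add: bypass_fixed)
  qed (use fin ab cut_apply[of ?b] in auto)
  also have "\<dots> = defect ?D (rot G) (\<tau> \<circ> opp_on ?D)"
    by (rule defect_remove[OF p perms(2) fin ab(1)]) (use cut_apply[of ?a] in auto)
  finally have "defect (darts ?G) (rot ?G) (opp_on (darts ?G)) = 0"
    using defect_delete[OF 0] unfolding C D' rot by simp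
  then show "genus ?G = 0" using genus_eq_defect[OF emb] by simp
qed

section \<open>Components, faces and genus of the underlying graph of a coded dimap\<close>

context coded_dimap
begin

lemma darts_underlying: "darts (underlying H) = D \<times> UNIV"
  by (simp add: underlying_def darts_def)

lemma verts_underlying: "verts (underlying H) = head_vertex H ` D"
proof -
  have "orbit (turn H) (z, b) \<in> head_vertex H ` D" if "z \<in> D" for z b
    using that tail_vertex_eq[of z] by (cases b) (auto simp: head_vertex_def tail_vertex_def)
  then show ?thesis by (auto simp: underlying_def head_vertex_def)
qed

lemma underlying_embedded: "embedded_graph (underlying H)"
  unfolding embedded_graph_def darts_underlying
  using fin turn_permutes orbit_eq_iff[OF turn_permutation] by (auto simp: underlying_def)

lemma ncl_underlying:
  assumes A: "A \<subseteq> D"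
  shows "ncl (head_vertex H ` D) (adj (orbit (turn H)) A) = ncl D (gr D S \<union> gr A C)"
proof (rule ncl_transfer[OF refl])
  have opp: "opp (z, True) = (z, False)" "opp (z, False) = (z, True)" for z by (simp_all add: opp_def)
  let ?r = "adj (orbit (turn H)) A"
  have r: "?r = (\<lambda>z. (head_vertex H z, head_vertex H (C z))) ` A \<union> (\<lambda>z. (head_vertex H (C z), head_vertex H z)) ` A"
  proof -
    have "A \<times> (UNIV :: bool set) = (\<lambda>z. (z, True)) ` A \<union> (\<lambda>z. (z, False)) ` A"
      by (auto; metis (full_types))
    then have "?r = (\<lambda>z. (head_vertex H z, tail_vertex H z)) ` A \<union> (\<lambda>z. (tail_vertex H z, head_vertex H z)) ` A"
      by (simp add: adj_def image_Un image_image opp head_vertex_def tail_vertex_def)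
    then show ?thesis using A tail_vertex_eq by (auto simp: image_iff; metis subsetD)
  qed
  fix a b
  show "(head_vertex H a, head_vertex H b) \<in> eqv ?r" if "(a, b) \<in> gr D S \<union> gr A C"
  proof (cases "(a, b) \<in> gr D S")
    case True
    then have "head_vertex H a = head_vertex H b"
      using head_vertex_eq_iff[of a b] by (auto simp: gr_iff orbit.base)
    then show ?thesis by simp
  next
    case False
    then have "(head_vertex H a, head_vertex H b) \<in> ?r" using that unfolding r by (auto simp: gr_iff)
    then show ?thesis by (rule eqv_base)
  qed
  show "(a, b) \<in> eqv (gr D S \<union> gr A C)" if "a \<in> D" "b \<in> D" "head_vertex H a = head_vertex H b"
  proof -
    have "(a, b) \<in> eqv (gr D S)" using that head_vertex_eq_iff in_orbit_iff_eqv[OF S fin] by blast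
    then show ?thesis using eqv_mono by blast
  qed
next
  let ?r = "adj (orbit (turn H)) A"
  fix u v assume "(u, v) \<in> ?r"
  then obtain z b where z: "z \<in> A" "u = orbit (turn H) (z, b)" "v = orbit (turn H) (z, \<not> b)"
    by (auto simp: adj_def opp_def)
  have zC: "(z, C z) \<in> eqv (gr D S \<union> gr A C)" using z by (intro eqv_base) (simp add: gr_iff)
  have "z \<in> D" using z A by blast
  then have "C z \<in> D" by simp
  have hz: "orbit (turn H) (z, True) = head_vertex H z" "orbit (turn H) (z, False) = head_vertex H (C z)"
    using tail_vertex_eq[OF \<open>z \<in> D\<close>] by (simp_all add: head_vertex_def tail_vertex_def)
  show "\<exists>a\<in>D. \<exists>b\<in>D. head_vertex H a = u \<and> head_vertex H b = v \<and> (a, b) \<in> eqv (gr D S \<union> gr A C)"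
  proof (cases b)
    case True
    then have "head_vertex H z = u" "head_vertex H (C z) = v" using z hz by simp_all
    then show ?thesis using zC \<open>z \<in> D\<close> \<open>C z \<in> D\<close> by blast
  next
    case False
    then have "head_vertex H (C z) = u" "head_vertex H z = v" using z hz by simp_all
    then show ?thesis using eqv_sym[OF zC] \<open>z \<in> D\<close> \<open>C z \<in> D\<close> by blast
  qed
qed

text \<open>Walks that leave along tail ends trace the a-faces, with permutation
  \<open>C \<circ> S\<close>; walks that leave along head ends trace the c-faces backwards, with
  \<open>C\<close>, which is its own inverse.\<close>

lemma num_faces_underlying: "num_faces (underlying H) = ncyc D (C \<circ> S) + ncyc D C"
proof -
  let ?p = "turn H \<circ> opp"
  have CS: "C \<circ> S permutes D" using S C by (rule permutes_compose)
  have in_D: "x \<in> D" if "x \<in> orbit \<pi> z" "z \<in> D" "\<pi> permutes D" for x z \<pi>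
    using permutes_orbit_subset[OF that(3,2)] that(1) by blast
  have self: "z \<in> orbit \<pi> z" if "\<pi> permutes D" for z \<pi>
    using permutation_self_in_orbit[OF permutes_permutation[OF that fin]] .
  have F: "orbit ?p (z, False) = (\<lambda>w. (w, False)) ` orbit (C \<circ> S) z" if "z \<in> D" for z
  proof (rule orbit_inverse[symmetric])
    fix x assume "x \<in> orbit (C \<circ> S) z"
    then have "x \<in> D" using that CS by (rule in_D)
    then show "?p (x, False) = ((C \<circ> S) x, False)" by (simp add: opp_def turn)
  qed (rule self[OF CS])
  have T: "orbit ?p (z, True) = (\<lambda>w. (w, True)) ` orbit C z" if "z \<in> D" for z
  proof (rule orbit_inverse[symmetric])
    fix x assume "x \<in> orbit C z"
    then have "x \<in> D" using that C by (rule in_D)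
    then show "?p (x, True) = (C x, True)" by (simp add: opp_def turn)
  qed (rule self[OF C])
  have "D \<times> (UNIV :: bool set) = (\<lambda>z. (z, False)) ` D \<union> (\<lambda>z. (z, True)) ` D"
    by (auto; metis (full_types))
  then have "orbit ?p ` (D \<times> UNIV) = (`) (\<lambda>w. (w, False)) ` (orbit (C \<circ> S) ` D) \<union> (`) (\<lambda>w. (w, True)) ` (orbit C ` D)"
    using F T by (simp add: image_Un image_image cong: image_cong_simp)
  moreover have "(`) (\<lambda>w. (w, False)) ` (orbit (C \<circ> S) ` D) \<inter> (`) (\<lambda>w. (w, True)) ` (orbit C ` D) = {}"
  proof -
    have snd: "snd ` X = {b}" if "X \<in> (`) (\<lambda>w. (w, b)) ` (orbit \<pi> ` D)" for X and b :: bool and \<pi>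
      using that by (auto simp: image_image image_constant_conv orbit_nonempty)
    show ?thesis
    proof (rule equals0I)
      fix X assume "X \<in> (`) (\<lambda>w. (w, False)) ` (orbit (C \<circ> S) ` D) \<inter> (`) (\<lambda>w. (w, True)) ` (orbit C ` D)"
      then have "snd ` X = {False}" "snd ` X = {True}" by (rule snd[OF IntD1], rule snd[OF IntD2])
      then show False by simp
    qed
  qed
  moreover have "card ((`) (\<lambda>w. (w, b)) ` X) = card X" for b :: bool and X :: "'a set set"
    by (rule card_image) (auto intro!: inj_onI simp: inj_image_eq_iff inj_def)
  ultimately have "card (orbit ?p ` (D \<times> UNIV)) = ncyc D (C \<circ> S) + ncyc D C"
    using fin by (simp add: card_Un_disjoint ncyc_def)
  moreover have "card (verts (underlying H) - endpt (underlying H) ` (D \<times> UNIV)) = 0"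
    by (simp add: underlying_def)
  moreover have "rot (underlying H) = turn H" by (simp add: underlying_def)
  ultimately show ?thesis by (simp add: num_faces_def darts_underlying)
qed

text \<open>The terms of the defect change their roles: cycles of \<open>C\<close>, the edges and
  half-edges of the map, are now c-faces, and the points of \<open>D\<close> are now edges. Euler's
  formula yields the same expression.\<close>

lemma genus_underlying: "2 * genus (underlying H) = of_int (defect D S C)"
proof -
  have "card (verts (underlying H)) = ncyc D S"
    unfolding verts_underlying ncyc_def
    by (rule card_image_kernel) (simp add: head_vertex_eq_iff orbit_eq_iff[OF S_permutation])
  moreover have "num_components (underlying H) = ncl D (gr D S \<union> gr D C)"
    unfolding num_components_eq verts_underlying ncl_underlying[OF subset_refl, symmetric]
    by (simp add: underlying_def)
  moreover have "card (edges (underlying H)) = card D" by (simp add: underlying_def)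
  ultimately show ?thesis
    unfolding genus_def num_faces_underlying defect_def by (simp add: field_simps)
qed

text \<open>Both genus terms vanish, because deleting edges from a plane graph keeps the genus zero;
  what remains of the definition is the growth of the number of components.\<close>

lemma separating_pair_iff:
  assumes planar: "defect D S C = 0" and eg: "e \<in> D" "g \<in> D" "g \<noteq> e"
  shows "separating_pair H e g \<longleftrightarrow> ncl D (gr D S \<union> gr D C) < ncl D (gr D S \<union> gr (D - {e, g}) C)"
proof -
  let ?G = "underlying H"
  let ?G1 = "embedded_delete ?G e" let ?G2 = "embedded_delete ?G1 g"
  have 0: "genus ?G = 0" using genus_underlying planar by simp
  have "e \<in> edges ?G" using eg by (simp add: underlying_def)
  then have 1: "embedded_graph ?G1" "genus ?G1 = 0"
    using embedded_delete_embedded[OF underlying_embedded] 0 by auto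
  have "g \<in> edges ?G1" using eg by (simp add: underlying_def embedded_delete_def)
  then have 2: "genus ?G2 = 0" using embedded_delete_embedded[OF 1(1)] 1(2) by auto
  have "verts ?G2 = head_vertex H ` D" "endpt ?G2 = orbit (turn H)" "edges ?G2 = D - {e, g}"
    using verts_underlying by (auto simp: embedded_delete_def underlying_def)
  then have "num_components ?G2 = ncl D (gr D S \<union> gr (D - {e, g}) C)"
    by (simp add: num_components_eq ncl_underlying)
  moreover have "num_components ?G = ncl D (gr D S \<union> gr D C)"
    unfolding num_components_eq verts_underlying ncl_underlying[OF subset_refl, symmetric]
    by (simp add: underlying_def)
  ultimately show ?thesis using 0 2 by (simp add: separating_pair_def Let_def)
qed

end

section \<open>Semiloops of plane coded dimaps as conditions on connectivity\<close>

context coded_dimap_pair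
begin

text \<open>The arcs \<open>e\<close> and \<open>f\<close> double a single edge of the map, so
  deleting both is cutting that edge, and the condition is that the edge is a coloop.\<close>

lemma semiloop_\<omega>_iff:
  assumes "defect D S C = 0"
  shows "semiloop_\<omega> H e \<longleftrightarrow> (e, f) \<notin> eqv (gr D S \<union> gr D (\<tau> \<circ> C))"
proof -
  have "eqv (gr D S \<union> gr (D - {e, f}) C) = eqv (gr D S \<union> gr D (\<tau> \<circ> C))"
  proof (rule eqv_eqI)
    have "gr (D - {e, f}) C \<subseteq> gr D (\<tau> \<circ> C)"
      unfolding gr_def cut_apply by force
    then show "gr D S \<union> gr (D - {e, f}) C \<subseteq> eqv (gr D S \<union> gr D (\<tau> \<circ> C))" by (auto intro: eqv_base)
    have "gr D (\<tau> \<circ> C) \<subseteq> gr (D - {e, f}) C \<union> {(e, e), (f, f)}"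
      unfolding gr_def cut_apply by force
    then show "gr D S \<union> gr D (\<tau> \<circ> C) \<subseteq> eqv (gr D S \<union> gr (D - {e, f}) C)" by (auto intro: eqv_base)
  qed
  then have "ncl D (gr D S \<union> gr (D - {e, f}) C) = ncl D (gr D S \<union> gr D (\<tau> \<circ> C))" by (rule ncl_cong)
  moreover have "semiloop_\<omega> H e \<longleftrightarrow> separating_pair H e f"
    using f by (auto simp: semiloop_\<omega>_def right_succ_eq)
  ultimately show ?thesis
    using separating_pair_iff[OF assms e f'(1)] f
      ncl_insert_if[OF fin e f'(1), of "gr D S \<union> gr D (\<tau> \<circ> C)"] ncl_cong[OF eqv_C, of D "gr D S"]
    by auto
qed

text \<open>This is what the last case of the recursion asks for beyond the failure of the earlier
  ones. If the left successor \<open>g\<close> is the partner of \<open>e\<close>, the pair is the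
  one already known not to separate; otherwise \<open>e\<close> has a partner that stays, and
  \<open>g\<close> has one too or is a half-edge, so no connection is lost.\<close>

lemma not_semiloop_\<omega>2:
  assumes "defect D S C = 0" "\<not> semiloop_\<omega> H e" "\<not> loop_\<omega> H e"
  shows "\<not> semiloop_\<omega>2 H e"
proof -
  define g where "g = C (S e)"
  have g: "g \<in> D" "g \<noteq> e" using e assms(3) by (auto simp: g_def loop_\<omega>_iff)
  have "\<not> separating_pair H e g"
  proof (cases "g = f")
    case True
    then show ?thesis using assms(2) f by (auto simp: semiloop_\<omega>_def right_succ_eq)
  next
    case False
    let ?r = "gr D S \<union> gr (D - {e, g}) C"
    have base: "z \<in> D - {e, g} \<Longrightarrow> (z, C z) \<in> eqv ?r" for z by (intro eqv_base) (simp add: gr_iff)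
    have "(e, C e) \<in> eqv ?r" using base[of f, THEN eqv_sym] f f' False by auto
    moreover have "(g, C g) \<in> eqv ?r"
    proof (cases "C g = g")
      case False
      have "C g \<noteq> e" using \<open>g \<noteq> f\<close> pair.C_eq_iff by auto
      then have "(C g, C (C g)) \<in> eqv ?r" using g False by (intro base) simp
      then show ?thesis unfolding inv by (rule eqv_sym)
    qed simp
    ultimately have "(z, C z) \<in> eqv ?r" if "z \<in> D" for z
      using base[of z] that by auto
    then have "gr D C \<subseteq> eqv ?r" by (auto simp: gr_def)
    then have "eqv ?r = eqv (gr D S \<union> gr D C)"
      by (intro eqv_eqI) (auto simp: gr_iff intro!: eqv_base)
    then have "ncl D ?r = ncl D (gr D S \<union> gr D C)" by (rule ncl_cong)
    then show ?thesis using separating_pair_iff[OF assms(1) e g] by simp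
  qed
  then show ?thesis using g by (simp add: semiloop_\<omega>2_def left_succ_eq g_def)
qed

end

section \<open>The recursion for alternating dimaps\<close>

context coded_dimap
begin

lemma reduce_1_fixed_planar:
  assumes "defect D S C = 0" "e \<in> D" "C e = e"
  shows "arcs (reduce_1 H e) = D - {e}" "defect (D - {e}) (bypass e S) C = 0"
    "map_poly x y (D - {e}) (bypass e S) C = map_poly x y D S C"
  using assms defect_remove[OF S C fin] map_poly_remove[OF S inv C fin]
  by (simp_all add: reduce_1_def remove_arc_def)

end

context coded_dimap_pair
begin

lemma arcs_reduce: "arcs (reduce_1 H e) = D - {e}" "arcs (reduce_\<omega>2 H e) = D - {e}"
  by (simp_all add: reduce_1_def reduce_\<omega>2_def remove_arc_def exchange_tails_def)

lemma cut_fixed: "(\<tau> \<circ> C) e = e"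
  using cut_apply[of e] by simp

lemma reduce_\<omega>2_planar:
  assumes "defect D S C = 0"
  shows "defect (D - {e}) (bypass e S) (\<tau> \<circ> C) = 0"
    "map_poly x y (D - {e}) (bypass e S) (\<tau> \<circ> C) = map_poly x y D S (\<tau> \<circ> C)"
proof -
  have "defect (D - {e}) (bypass e S) (\<tau> \<circ> C) = defect D S (\<tau> \<circ> C)"
    by (rule defect_remove[OF S perms(2) fin e cut_fixed])
  then show "defect (D - {e}) (bypass e S) (\<tau> \<circ> C) = 0" unfolding defect_delete[OF assms] .
  show "map_poly x y (D - {e}) (bypass e S) (\<tau> \<circ> C) = map_poly x y D S (\<tau> \<circ> C)"
    by (rule map_poly_remove[OF S cut_invol perms(2) fin e cut_fixed])
qed

lemma reduce_1_planar:
  assumes "defect D S C = 0"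
  shows "defect (D - {e}) (bypass e (\<tau> \<circ> S)) (\<tau> \<circ> C) = 0"
    "map_poly x y (D - {e}) (bypass e (\<tau> \<circ> S)) (\<tau> \<circ> C) = map_poly x y D (\<tau> \<circ> S) (\<tau> \<circ> C)"
proof -
  have "defect D (\<tau> \<circ> S) (\<tau> \<circ> C) = 0"
    using defect_contract_loop(1)[OF _ assms] defect_contract_nonloop assms by (cases "f \<in> orbit S e") auto
  moreover have "defect (D - {e}) (bypass e (\<tau> \<circ> S)) (\<tau> \<circ> C) = defect D (\<tau> \<circ> S) (\<tau> \<circ> C)"
    by (rule defect_remove[OF perms fin e cut_fixed])
  ultimately show "defect (D - {e}) (bypass e (\<tau> \<circ> S)) (\<tau> \<circ> C) = 0" by (rule trans[rotated])
  show "map_poly x y (D - {e}) (bypass e (\<tau> \<circ> S)) (\<tau> \<circ> C) = map_poly x y D (\<tau> \<circ> S) (\<tau> \<circ> C)"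
    by (rule map_poly_remove[OF perms(1) cut_invol perms(2) fin e cut_fixed])
qed

lemma loop_in_orbit:
  assumes "proper_semiloop_1 H e \<or> loop_\<omega> H e"
  shows "f \<in> orbit S e"
proof -
  have "f \<in> orbit S e" if "loop_\<omega> H e"
  proof -
    have "S e = f" using that inv[of "S e"] f by (simp add: loop_\<omega>_iff)
    then show ?thesis using orbit.base[of S e] by simp
  qed
  then show ?thesis using assms semiloop_1_iff[OF e] f by (auto simp: proper_semiloop_1_def)
qed

lemma not_loop_not_semiloop_1:
  assumes "\<not> (proper_semiloop_1 H e \<or> loop_\<omega> H e)"
  shows "\<not> semiloop_1 H e"
  using assms semiloop_1_not_loop_1[OF e] f loop_\<omega>2_iff
  by (auto simp: proper_semiloop_1_def triloop_def)

end

text \<open>Uniqueness of the value follows from any single arc, whereas its existence needs the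
  equation at every arc; stated as an equivalence, the induction hypothesis supplies both for the
  reductions.\<close>

lemma Tc_value_iff:
  assumes "coded_dimap H S C" "defect (arcs H) S C = 0"
  shows "Tc_value x y H p \<longleftrightarrow> p = map_poly x y (arcs H) S C"
  using assms
proof (induction "card (arcs H)" arbitrary: H S C p rule: less_induct)
  case less
  interpret coded_dimap H S C by (rule less.prems)
  note planar = less.prems(2)
  let ?W = "map_poly x y D S C"
  have card: "card (D - {e}) < card D" if "e \<in> D" for e
    using that fin by (meson card_Diff1_less)
  have fixed: "Tc_value x y (reduce_1 H e) q \<longleftrightarrow> q = ?W" if "e \<in> D" "C e = e" for e q
    using less.hyps[OF _ reduce_1_fixed_coded[OF that]] card[OF that(1)] reduce_1_fixed_planar(1,2)[OF planar that]
      reduce_1_fixed_planar(3)[OF planar that, of x y]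
    by simp
  \<comment> \<open>For each case of an arc that is no \<omega>2-loop, the universal part forces the
    value of \<open>H\<close>, and the existential part supplies values of the reductions when the
    rule is applied.\<close>
  have moved:
    "(semiloop_\<omega> H e \<longrightarrow> (\<forall>q. Tc_value x y (reduce_\<omega>2 H e) q \<longrightarrow> x * q = ?W) \<and>
          (\<exists>q. Tc_value x y (reduce_\<omega>2 H e) q)) \<and>
     (\<not> semiloop_\<omega> H e \<and> (proper_semiloop_1 H e \<or> loop_\<omega> H e) \<longrightarrow>
          (\<forall>q. Tc_value x y (reduce_1 H e) q \<longrightarrow> y * q = ?W) \<and> (\<exists>q. Tc_value x y (reduce_1 H e) q)) \<and>
     (\<not> semiloop_\<omega> H e \<and> \<not> (proper_semiloop_1 H e \<or> loop_\<omega> H e) \<longrightarrow> \<not> semiloop H e \<and>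
          (\<forall>q r. Tc_value x y (reduce_1 H e) q \<and> Tc_value x y (reduce_\<omega>2 H e) r \<longrightarrow> q + r = ?W) \<and>
          (\<exists>q. Tc_value x y (reduce_1 H e) q) \<and> (\<exists>r. Tc_value x y (reduce_\<omega>2 H e) r))"
    if e: "e \<in> D" and "C e \<noteq> e" for e
  proof -
    interpret coded_dimap_pair H S C e "C e" using that by unfold_locales auto
    have del: "Tc_value x y (reduce_\<omega>2 H e) q \<longleftrightarrow> q = map_poly x y D S (\<tau> \<circ> C)" for q
      using less.hyps[OF _ reduce_\<omega>2_coded] card[OF e] reduce_\<omega>2_planar(1)[OF planar] reduce_\<omega>2_planar(2)[OF planar, of x y] arcs_reduce by simp
    have con: "Tc_value x y (reduce_1 H e) q \<longleftrightarrow> q = map_poly x y D (\<tau> \<circ> S) (\<tau> \<circ> C)" for q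
      using less.hyps[OF _ reduce_1_coded] card[OF e] reduce_1_planar(1)[OF planar] reduce_1_planar(2)[OF planar, of x y] arcs_reduce by simp
    have "?W = x * map_poly x y D S (\<tau> \<circ> C)" if "semiloop_\<omega> H e"
      using that semiloop_\<omega>_iff[OF planar] map_poly_coloop by blast
    moreover have "?W = y * map_poly x y D (\<tau> \<circ> S) (\<tau> \<circ> C)" if "proper_semiloop_1 H e \<or> loop_\<omega> H e"
      using that loop_in_orbit map_poly_loop[OF planar] by blast
    moreover have "\<not> semiloop H e \<and> ?W = map_poly x y D (\<tau> \<circ> S) (\<tau> \<circ> C) + map_poly x y D S (\<tau> \<circ> C)"
      if "\<not> semiloop_\<omega> H e" "\<not> (proper_semiloop_1 H e \<or> loop_\<omega> H e)"
    proof -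
      have "\<not> semiloop_1 H e" using that(2) by (rule not_loop_not_semiloop_1)
      moreover from this have "C e \<notin> orbit S e" using semiloop_1_iff[OF e] by blast
      moreover have "(e, C e) \<in> eqv (gr D S \<union> gr D (\<tau> \<circ> C))" using that(1) semiloop_\<omega>_iff[OF planar] by blast
      moreover have "\<not> semiloop_\<omega>2 H e" using not_semiloop_\<omega>2[OF planar] that by blast
      ultimately show ?thesis using map_poly_ordinary[OF planar] that(1) by (simp add: semiloop_def)
    qed
    ultimately show ?thesis unfolding del con by auto
  qed
  show ?case
  proof
    assume "Tc_value x y H p"
    then show "p = ?W"
    proof cases
      case empty
      then show ?thesis by (simp add: map_poly_def rank_poly_def edge_pairs_def)
    next
      case step
      then obtain e where e: "e \<in> D" by blast
      note step = step(2-5)[OF e]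
      show ?thesis
      proof (cases "C e = e")
        case True
        then show ?thesis using step(1) fixed[OF e] by (simp add: loop_\<omega>2_iff)
      next
        case False
        then have "\<not> loop_\<omega>2 H e" by (simp add: loop_\<omega>2_iff)
        then show ?thesis using moved[OF e False] step(2-4) by metis
      qed
    qed
  next
    assume p: "p = ?W"
    show "Tc_value x y H p"
    proof (cases "D = {}")
      case True
      then have "p = 1" by (simp add: p map_poly_def rank_poly_def edge_pairs_def)
      then show ?thesis using Tc_value.empty[OF True] by simp
    next
      case False
      then show ?thesis
      proof (rule Tc_value.step)
        fix e assume e: "e \<in> D"
        show "Tc_value x y (reduce_1 H e) p" if "loop_\<omega>2 H e"
          using that fixed[OF e] p by (simp add: loop_\<omega>2_iff)
        assume "\<not> loop_\<omega>2 H e"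
        then have *: "C e \<noteq> e" by (simp add: loop_\<omega>2_iff)
        note moved = moved[OF e *]
        show "\<exists>q. Tc_value x y (reduce_\<omega>2 H e) q \<and> p = x * q" if "semiloop_\<omega> H e"
          using that moved p by metis
        show "\<exists>q. Tc_value x y (reduce_1 H e) q \<and> p = y * q"
          if "\<not> semiloop_\<omega> H e" "proper_semiloop_1 H e \<or> loop_\<omega> H e"
          using that moved p by metis
        show "\<not> semiloop H e \<and> (\<exists>q r. Tc_value x y (reduce_1 H e) q \<and> Tc_value x y (reduce_\<omega>2 H e) r \<and> p = q + r)"
          if "\<not> semiloop_\<omega> H e" "\<not> (proper_semiloop_1 H e \<or> loop_\<omega> H e)"
          using that moved p by metis
      qed
    qed
  qed
qed

section \<open>The recursion for graphs\<close>

lemma adj_UN: "adj p A = {} \<union> (\<Union>e\<in>A. adj p {e})"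
  by (auto simp: adj_def)

lemma adj_iff: "(u, v) \<in> adj p A \<longleftrightarrow> (\<exists>d. fst d \<in> A \<and> u = p d \<and> v = p (opp d))"
  by (auto simp: adj_def)

lemma adj_singleton: "adj p {e} = {(p (e, False), p (e, True)), (p (e, True), p (e, False))}"
  by (auto simp: adj_def opp_def UNIV_bool)

lemma eqv_adj_singleton: "eqv (adj p {e}) = eqv {(p (e, False), p (e, True))}"
proof (rule eqv_eqI)
  have "(p (e, False), p (e, True)) \<in> eqv {(p (e, False), p (e, True))}" by (simp add: eqv_base)
  then show "adj p {e} \<subseteq> eqv {(p (e, False), p (e, True))}" by (auto simp: adj_singleton dest: eqv_sym)
  show "{(p (e, False), p (e, True))} \<subseteq> eqv (adj p {e})" by (auto simp: adj_singleton intro: eqv_base)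
qed

locale finite_multigraph =
  fixes G :: "('v, 'e) multigraph"
  assumes finite_verts: "finite (verts G)" and finite_edges: "finite (edges G)"
    and ends: "endpt G ` darts G \<subseteq> verts G"
begin

abbreviation "k A \<equiv> ncl (verts G) (adj (endpt G) A)"

lemma ends_in: "e \<in> edges G \<Longrightarrow> endpt G (e, b) \<in> verts G"
  using ends by (auto simp: darts_def)

sublocale graphic "edges G" k
proof -
  have "graphic (edges G) (\<lambda>A. ncl (verts G) ({} \<union> (\<Union>e\<in>A. adj (endpt G) {e})))"
  proof (rule graphic_ncl[OF finite_verts finite_edges])
    fix e assume "e \<in> edges G"
    moreover have "(endpt G (e, False), endpt G (e, True)) \<in> adj (endpt G) {e}"
      by (simp add: adj_singleton)
    moreover have "adj (endpt G) {e} \<subseteq> {endpt G (e, False), endpt G (e, True)} \<times> {endpt G (e, False), endpt G (e, True)}"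
      by (simp add: adj_singleton)
    ultimately show "\<exists>u\<in>verts G. \<exists>v\<in>verts G. (u, v) \<in> adj (endpt G) {e} \<and> adj (endpt G) {e} \<subseteq> {u, v} \<times> {u, v}"
      using ends_in by blast
  qed
  then show "graphic (edges G) k" unfolding adj_UN[symmetric] .
qed

lemma is_coloop_iff: "e \<in> edges G \<Longrightarrow> is_coloop G e \<longleftrightarrow> k (edges G - {e}) \<noteq> k (edges G)"
  using antimono[of "edges G - {e}" "edges G"] by (auto simp: is_coloop_def num_components_eq delete_def)

lemma is_loop_iff: "e \<in> edges G \<Longrightarrow> is_loop G e \<longleftrightarrow> k {e} = k {}"
proof -
  assume e: "e \<in> edges G"
  let ?u = "endpt G (e, False)" and ?v = "endpt G (e, True)"
  have "k {e} = ncl (verts G) {(?u, ?v)}" by (rule ncl_cong[OF eqv_adj_singleton])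
  moreover have "k {} = ncl (verts G) {}" by (simp add: adj_def)
  moreover have "(?u, ?v) \<in> eqv {} \<longleftrightarrow> ?u = ?v" by (simp add: eqv_def)
  ultimately show ?thesis
    using ncl_insert_if[OF finite_verts ends_in[OF e, of False] ends_in[OF e, of True], of "{}"] by (auto simp: is_loop_def)
qed

text \<open>The contraction collapses the vertices, and the only fibre that can be nontrivial
  consists of the two ends of \<open>e\<close>, which \<open>e\<close> itself joins. A loop splits
  nothing here, so the counts agree without a shift.\<close>

lemma contract_comps:
  assumes e: "e \<in> edges G" and A: "A \<subseteq> edges G - {e}"
  shows "ncl (verts (contract G e)) (adj (endpt (contract G e)) A) = k (insert e A)"
proof -
  let ?u = "endpt G (e, False)" and ?v = "endpt G (e, True)"
  define m where "m w = (if w = ?u then ?v else w)" for w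
  have con: "verts (contract G e) = m ` verts G" "endpt (contract G e) = m \<circ> endpt G"
    by (auto simp: contract_def m_def Let_def fun_eq_iff)
  have muv: "m ?u = m ?v" by (simp add: m_def)
  have "ncl (m ` verts G) (adj (m \<circ> endpt G) A) = k (insert e A)"
  proof (rule ncl_transfer[OF refl])
    fix a b
    show "(m a, m b) \<in> eqv (adj (m \<circ> endpt G) A)" if ab: "(a, b) \<in> adj (endpt G) (insert e A)"
    proof -
      obtain d where d: "fst d \<in> insert e A" "a = endpt G d" "b = endpt G (opp d)"
        using ab unfolding adj_iff comp_apply by blast
      show ?thesis
      proof (cases "fst d = e")
        case True
        then have "m a = m b" using d muv by (cases d; cases "snd d") (auto simp: opp_def)
        then show ?thesis by simp
      next
        case False
        then have "(m a, m b) \<in> adj (m \<circ> endpt G) A"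
          using d unfolding adj_iff by (intro exI[of _ d]) simp
        then show ?thesis by (rule eqv_base)
      qed
    qed
    show "(a, b) \<in> eqv (adj (endpt G) (insert e A))" if "m a = m b"
    proof -
      have "(?u, ?v) \<in> adj (endpt G) (insert e A)"
        by (auto simp: adj_def opp_def intro!: image_eqI[of _ _ "(e, False)"])
      then have "(?u, ?v) \<in> eqv (adj (endpt G) (insert e A))" by (rule eqv_base)
      then show ?thesis using that by (auto simp: m_def dest: eqv_sym split: if_splits)
    qed
    show "\<exists>a'\<in>verts G. \<exists>b'\<in>verts G. m a' = a \<and> m b' = b \<and> (a', b') \<in> eqv (adj (endpt G) (insert e A))"
      if ab: "(a, b) \<in> adj (m \<circ> endpt G) A"
    proof -
      obtain d where d: "fst d \<in> A" "a = m (endpt G d)" "b = m (endpt G (opp d))"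
        using ab unfolding adj_iff comp_apply by blast
      have "endpt G d \<in> verts G" "endpt G (opp d) \<in> verts G"
        using d A ends_in[of "fst d" "snd d"] ends_in[of "fst d" "\<not> snd d"] by (auto simp: opp_def)
      moreover have "(endpt G d, endpt G (opp d)) \<in> adj (endpt G) (insert e A)"
        using d unfolding adj_iff by (intro exI[of _ d]) simp
      then have "(endpt G d, endpt G (opp d)) \<in> eqv (adj (endpt G) (insert e A))" by (rule eqv_base)
      ultimately show ?thesis using d by blast
    qed
  qed
  then show ?thesis by (simp add: con)
qed

lemma finite_multigraph_delete: "finite_multigraph (delete G e)"
  using finite_verts finite_edges ends by (auto simp: finite_multigraph_def delete_def darts_def)

lemma finite_multigraph_contract: "finite_multigraph (contract G e)"
  using finite_verts finite_edges ends_in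
  by (auto simp: finite_multigraph_def contract_def darts_def Let_def)

end

lemma tutte_value_iff:
  assumes "finite_multigraph G"
  shows "tutte_value x y G p \<longleftrightarrow> p = rank_poly x y (edges G) (\<lambda>A. ncl (verts G) (adj (endpt G) A))"
  using assms
proof (induction "card (edges G)" arbitrary: G p rule: less_induct)
  case less
  interpret finite_multigraph G by (rule less.prems)
  let ?W = "rank_poly x y (edges G) k"
  have del: "tutte_value x y (delete G e) q \<longleftrightarrow> q = rank_poly x y (edges G - {e}) k"
    and con: "tutte_value x y (contract G e) q \<longleftrightarrow> q = rank_poly x y (edges G - {e}) (\<lambda>A. k (insert e A))"
    if e: "e \<in> edges G" for e q
  proof -
    have card: "card (edges G - {e}) < card (edges G)" using e finite_edges by (meson card_Diff1_less)
    show "tutte_value x y (delete G e) q \<longleftrightarrow> q = rank_poly x y (edges G - {e}) k"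
      using less.hyps[OF _ finite_multigraph_delete] card by (simp add: delete_def)
    have E: "edges (contract G e) = edges G - {e}" by (simp add: contract_def Let_def)
    have "rank_poly x y (edges G - {e}) (\<lambda>A. ncl (verts (contract G e)) (adj (endpt (contract G e)) A)) =
          rank_poly x y (edges G - {e}) (\<lambda>A. k (insert e A))"
      by (rule rank_poly_shift[where c = 0]) (simp add: contract_comps[OF e])
    then show "tutte_value x y (contract G e) q \<longleftrightarrow> q = rank_poly x y (edges G - {e}) (\<lambda>A. k (insert e A))"
      using less.hyps[OF _ finite_multigraph_contract] card E by simp
  qed
  note rules = rank_poly_coloop[of _ x y] rank_poly_loop[of _ x y] rank_poly_ordinary[of _ x y]
  show ?case
  proof
    assume "tutte_value x y G p"
    then show "p = ?W"
    proof cases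
      case empty
      then show ?thesis by (simp add: rank_poly_def)
    next
      case step
      then obtain e where e: "e \<in> edges G" by blast
      show ?thesis
        using step(2-4)[OF e] rules[OF e] unfolding del[OF e] con[OF e] is_coloop_iff[OF e] is_loop_iff[OF e]
        by metis
    qed
  next
    assume p: "p = ?W"
    show "tutte_value x y G p"
    proof (cases "edges G = {}")
      case True
      then have "p = 1" by (simp add: p rank_poly_def)
      then show ?thesis using tutte_value.empty[OF True] by simp
    next
      case False
      then show ?thesis
      proof (rule tutte_value.step)
        fix e assume e: "e \<in> edges G"
        note iff = del[OF e] con[OF e] is_coloop_iff[OF e] is_loop_iff[OF e]
        show "\<exists>q. tutte_value x y (delete G e) q \<and> p = x * q" if "is_coloop G e"
          using that rules[OF e] p unfolding iff by metis
        show "\<exists>q. tutte_value x y (contract G e) q \<and> p = y * q" if "is_loop G e"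
          using that rules[OF e] p unfolding iff by metis
        show "\<exists>q r. tutte_value x y (contract G e) q \<and> tutte_value x y (delete G e) r \<and> p = q + r"
          if "\<not> is_coloop G e" "\<not> is_loop G e"
          using that rules[OF e] p unfolding iff by metis
      qed
    qed
  qed
qed

section \<open>Mirror images\<close>

definition mirror :: "'e dimap \<Rightarrow> 'e dimap" where
  "mirror H = H\<lparr>turn := inv (turn H)\<rparr>"

definition mirror_graph :: "('v, 'e) embedded_graph \<Rightarrow> ('v, 'e) embedded_graph" where
  "mirror_graph G = G\<lparr>rot := inv (rot G)\<rparr>"

text \<open>Skipping a point of a cycle commutes with reading the cycle backwards.\<close>

lemma bypass_inv:
  assumes "bij \<pi>" shows "bypass d (inv \<pi>) = inv (bypass d \<pi>)"
proof -
  have inj: "\<pi> u = \<pi> v \<longleftrightarrow> u = v" for u v using assms by (simp add: bij_is_inj inj_eq)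
  have inv: "inv \<pi> u = v \<longleftrightarrow> u = \<pi> v" for u v using assms by (metis bij_inv_eq_iff)
  have sur: "\<pi> (inv \<pi> u) = u" for u using assms by (simp add: bij_is_surj surj_f_inv_f)
  have inv': "inv \<pi> (\<pi> u) = u" for u by (simp add: inv)
  have "bypass d \<pi> \<circ> bypass d (inv \<pi>) = id" "bypass d (inv \<pi>) \<circ> bypass d \<pi> = id"
    by (auto simp: fun_eq_iff bypass_def inv' sur inj inv)
  then show ?thesis by (rule inv_unique_comp[symmetric])
qed

lemma bypass_bij: assumes "bij \<pi>" shows "bij (bypass d \<pi>)"
proof -
  have "\<pi> permutes UNIV" using assms by (intro bij_imp_permutes) auto
  then have "bypass d \<pi> permutes (UNIV - {d})" by (rule bypass_permutes)
  then show ?thesis by (rule permutes_bij)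
qed

lemma bypass_edge_inv: "bij \<pi> \<Longrightarrow> bypass_edge e (inv \<pi>) = inv (bypass_edge e \<pi>)"
  by (simp add: bypass_edge_def bypass_inv bypass_bij)

lemma ncyc_inv:
  assumes "\<pi> permutes D" "finite D" shows "ncyc D (inv \<pi>) = ncyc D \<pi>"
  using orbit_inv_eq[OF permutes_permutation[OF assms]] by (simp add: ncyc_def)

text \<open>On the darts the mirrored face permutation is the inverse of
  \<open>opp \<circ> rot G\<close>, which is conjugate to \<open>rot G \<circ> opp\<close>; neither
  change affects the number of cycles. The other terms do not involve the rotation.\<close>

lemma genus_mirror_graph:
  assumes p: "rot G permutes darts G" and fin: "finite (edges G)"
  shows "genus (mirror_graph G) = genus G"
proof -
  let ?D = "darts G" and ?R = "rot G"
  have finD: "finite ?D" using fin by (simp add: darts_def)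
  have p': "inv ?R permutes ?D" using p by (rule permutes_inv)
  have faces: "ncyc ?D (\<pi> \<circ> opp) = ncyc ?D (\<pi> \<circ> opp_on ?D)" if "\<pi> permutes ?D" for \<pi>
    by (rule ncyc_cong) (use that in \<open>auto simp: opp_on_def permutes_in_image\<close>)
  have inv_opp: "inv (opp_on ?D) = opp_on ?D" by (rule inv_unique_comp) (auto simp: fun_eq_iff)
  have "ncyc ?D (inv ?R \<circ> opp_on ?D) = ncyc ?D (inv (opp_on ?D \<circ> ?R))"
    using p opp_on_permutes[of G] inv_opp by (simp add: o_inv_distrib permutes_bij)
  also have "\<dots> = ncyc ?D (opp_on ?D \<circ> ?R)"
    by (rule ncyc_inv[OF permutes_compose[OF p opp_on_permutes] finD])
  also have "\<dots> = ncyc ?D (?R \<circ> opp_on ?D)"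
    using opp_on_permutes p finD by (rule ncyc_comp_commute)
  finally have "ncyc ?D (inv ?R \<circ> opp) = ncyc ?D (?R \<circ> opp)" using faces[OF p] faces[OF p'] by simp
  then have "num_faces (mirror_graph G) = num_faces G"
    by (simp add: num_faces_def ncyc_def mirror_graph_def darts_def)
  then show ?thesis by (simp add: genus_def num_components_eq) (simp add: mirror_graph_def)
qed

lemma embedded_graph_mirror:
  assumes "embedded_graph G" shows "embedded_graph (mirror_graph G)"
proof -
  have p: "rot G permutes darts G" and fin: "finite (darts G)"
    using assms by (auto simp: embedded_graph_def darts_def)
  then have "orbit (inv (rot G)) d = orbit (rot G) d" for d
    by (intro orbit_inv_eq permutes_permutation)
  then show ?thesis
    using assms permutes_inv[OF p] unfolding embedded_graph_def
    by (simp add: mirror_graph_def darts_def)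
qed

text \<open>A property stable under mirror images and all reductions, so that it can accompany the
  induction along the recursion.\<close>

locale rotating_dimap =
  fixes H :: "'e dimap"
  assumes fin: "finite (arcs H)" and turn_permutes: "turn H permutes (arcs H \<times> UNIV)"
begin

lemma turn_bij: "bij (turn H)"
  using turn_permutes by (rule permutes_bij)

lemma turn_permutation: "permutation (turn H)"
  using turn_permutes fin by (auto simp: permutation_permutes intro!: exI[of _ "arcs H \<times> UNIV"])

lemma rotating_mirror: "rotating_dimap (mirror H)"
  using fin turn_permutes by (simp add: rotating_dimap_def mirror_def permutes_inv)

lemma mirror_mirror: "mirror (mirror H) = H"
  by (simp add: mirror_def inv_inv_eq turn_bij)

lemma arcs_mirror: "arcs (mirror H) = arcs H"
  by (simp add: mirror_def)

lemma succ_mirror: "left_succ (mirror H) = right_succ H" "right_succ (mirror H) = left_succ H"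
  by (simp_all add: fun_eq_iff left_succ_def right_succ_def mirror_def inv_inv_eq turn_bij)

lemma loops_mirror: "loop_\<omega> (mirror H) e = loop_\<omega>2 H e" "loop_\<omega>2 (mirror H) e = loop_\<omega> H e"
  by (simp_all add: loop_\<omega>_def loop_\<omega>2_def a_face_def c_face_def succ_mirror)

lemma orbit_mirror: "orbit (turn (mirror H)) = orbit (turn H)"
  by (simp add: fun_eq_iff mirror_def orbit_inv_eq turn_permutation)

lemma semiloop_1_mirror: "semiloop_1 (mirror H) e = semiloop_1 H e"
  by (simp add: semiloop_1_def tail_vertex_def head_vertex_def orbit_mirror)

lemma proper_semiloop_1_mirror: "proper_semiloop_1 (mirror H) e = proper_semiloop_1 H e"
  by (auto simp: proper_semiloop_1_def semiloop_1_mirror triloop_def loops_mirror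
      loop_1_def head_vertex_def orbit_mirror)

lemma embedded_delete_mirror:
  "bij (rot G) \<Longrightarrow> embedded_delete (mirror_graph G) e = mirror_graph (embedded_delete G e)"
  by (simp add: embedded_delete_def mirror_graph_def bypass_edge_inv)

text \<open>Deletion commutes with inverting the rotation, component counts do not see the rotation,
  and the genus is invariant under reflection.\<close>

lemma separating_pair_mirror: "separating_pair (mirror H) e f = separating_pair H e f"
proof -
  let ?G = "underlying H"
  have U: "underlying (mirror H) = mirror_graph ?G"
    unfolding underlying_def orbit_mirror by (simp add: mirror_graph_def mirror_def)
  have bij: "bij (rot ?G)" using turn_bij by (simp add: underlying_def)
  have p: "rot (embedded_delete G e) permutes darts (embedded_delete G e)"
    if "rot G permutes darts G" for G :: "('e dart set, 'e) embedded_graph" and e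
  proof -
    have "darts (embedded_delete G e) = darts G - {(e, True)} - {(e, False)}"
      by (auto simp: embedded_delete_def darts_def; metis (full_types))
    then show ?thesis
      using bypass_permutes[OF bypass_permutes[OF that, of "(e, True)"], of "(e, False)"]
      by (simp add: embedded_delete_def bypass_edge_def)
  qed
  have p0: "rot ?G permutes darts ?G" using turn_permutes by (simp add: underlying_def darts_def)
  let ?G2 = "embedded_delete (embedded_delete ?G e) f"
  have "embedded_delete (embedded_delete (mirror_graph ?G) e) f = mirror_graph ?G2"
    using embedded_delete_mirror[OF bij] embedded_delete_mirror[of "embedded_delete ?G e" f]
      permutes_bij[OF p[OF p0]] by simp
  moreover have "genus (mirror_graph ?G2) = genus ?G2" "genus (mirror_graph ?G) = genus ?G"
    using fin p0 p[OF p[OF p0]]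
    by (auto intro!: genus_mirror_graph simp: underlying_def embedded_delete_def)
  moreover have "num_components (mirror_graph G) = num_components G" for G :: "('e dart set, 'e) embedded_graph"
    by (simp add: num_components_eq mirror_graph_def)
  ultimately show ?thesis by (simp add: separating_pair_def Let_def U)
qed

lemma semiloops_mirror:
  "semiloop_\<omega> (mirror H) e = semiloop_\<omega>2 H e" "semiloop_\<omega>2 (mirror H) e = semiloop_\<omega> H e"
  "semiloop (mirror H) e = semiloop H e"
  by (auto simp: semiloop_\<omega>_def semiloop_\<omega>2_def semiloop_def succ_mirror separating_pair_mirror semiloop_1_mirror)

lemma remove_arc_rotating: "rotating_dimap (remove_arc e H)"
proof -
  have "arcs (remove_arc e H) \<times> (UNIV :: bool set) = arcs H \<times> UNIV - {(e, True)} - {(e, False)}"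
    by (auto simp: remove_arc_def; metis (full_types))
  then show ?thesis
    using fin bypass_permutes[OF bypass_permutes[OF turn_permutes, of "(e, True)"], of "(e, False)"]
    by (simp add: rotating_dimap_def remove_arc_def bypass_edge_def)
qed

lemma remove_arc_mirror: "remove_arc e (mirror H) = mirror (remove_arc e H)"
  by (simp add: remove_arc_def mirror_def bypass_edge_inv turn_bij)

lemma exchange_tails_mirror: "exchange_tails e g (mirror H) = mirror (exchange_tails e g H)"
proof -
  have "inv (transpose (e, False) (g, False) \<circ> turn H \<circ> transpose (e, False) (g, False)) =
      transpose (e, False) (g, False) \<circ> inv (turn H) \<circ> transpose (e, False) (g, False)"
    using turn_bij by (simp add: o_inv_distrib bij_comp comp_assoc)
  then show ?thesis by (simp add: exchange_tails_def mirror_def)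
qed

lemma exchange_tails_rotating:
  assumes "e \<in> arcs H" "g \<in> arcs H" shows "rotating_dimap (exchange_tails e g H)"
proof -
  have "transpose (e, False) (g, False) permutes arcs H \<times> UNIV"
    using assms by (intro permutes_swap_id) auto
  then show ?thesis using fin turn_permutes
    by (simp add: rotating_dimap_def exchange_tails_def permutes_compose)
qed

lemma succ_in_arcs:
  assumes "e \<in> arcs H" shows "left_succ H e \<in> arcs H" "right_succ H e \<in> arcs H"
proof -
  have "turn H (e, True) \<in> arcs H \<times> UNIV" "inv (turn H) (e, True) \<in> arcs H \<times> UNIV"
    using permutes_in_image[OF turn_permutes] permutes_in_image[OF permutes_inv[OF turn_permutes]] assms by auto
  then show "left_succ H e \<in> arcs H" "right_succ H e \<in> arcs H"
    by (auto simp: left_succ_def right_succ_def mem_Times_iff)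
qed

lemma reduce_rotating:
  assumes e: "e \<in> arcs H"
  shows "rotating_dimap (reduce_1 H e)" "rotating_dimap (reduce_\<omega> H e)" "rotating_dimap (reduce_\<omega>2 H e)"
proof -
  have "transpose (e, False) (e, True) permutes arcs H \<times> UNIV"
    using e by (intro permutes_swap_id) auto
  then have "rotating_dimap (H\<lparr>turn := turn H \<circ> transpose (e, False) (e, True)\<rparr>)"
    using fin turn_permutes by (simp add: rotating_dimap_def permutes_compose)
  then show "rotating_dimap (reduce_1 H e)"
    unfolding reduce_1_def by (rule rotating_dimap.remove_arc_rotating)
  show "rotating_dimap (reduce_\<omega> H e)" "rotating_dimap (reduce_\<omega>2 H e)"
    unfolding reduce_\<omega>_def reduce_\<omega>2_def
    using e succ_in_arcs by (auto intro: rotating_dimap.remove_arc_rotating exchange_tails_rotating)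
qed

lemma reduce_\<omega>_mirror:
  assumes "e \<in> arcs H"
  shows "reduce_\<omega> (mirror H) e = mirror (reduce_\<omega>2 H e)" "reduce_\<omega>2 (mirror H) e = mirror (reduce_\<omega> H e)"
  unfolding reduce_\<omega>_def reduce_\<omega>2_def exchange_tails_mirror succ_mirror
  by (intro rotating_dimap.remove_arc_mirror exchange_tails_rotating succ_in_arcs assms)+

text \<open>The two products are conjugate by the transposition, which only interchanges the names
  of the two ends of \<open>e\<close>, and both ends are skipped. It serves to undo the change of
  sides of the transposition when \<open>turn\<close> is inverted in a 1-reduction.\<close>

lemma bypass_edge_transpose:
  assumes "inj \<rho>"
  shows "bypass_edge e (\<rho> \<circ> transpose (e, False) (e, True)) = bypass_edge e (transpose (e, False) (e, True) \<circ> \<rho>)"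
proof
  fix z
  have inj: "\<rho> u = \<rho> v \<longleftrightarrow> u = v" for u v using assms by (simp add: inj_eq)
  consider "z = (e, False)" | "z = (e, True)" | "z \<noteq> (e, False)" "z \<noteq> (e, True)" by blast
  then show "bypass_edge e (\<rho> \<circ> transpose (e, False) (e, True)) z = bypass_edge e (transpose (e, False) (e, True) \<circ> \<rho>) z"
    by cases (auto simp: bypass_edge_def bypass_def transpose_def inj; metis inj)+
qed

lemma reduce_1_mirror: "reduce_1 (mirror H) e = mirror (reduce_1 H e)"
proof -
  let ?t = "transpose (e, False) (e, True)"
  have "bypass_edge e (inv (turn H) \<circ> ?t) = bypass_edge e (?t \<circ> inv (turn H))"
    by (rule bypass_edge_transpose) (use turn_bij in \<open>simp add: bij_imp_bij_inv bij_is_inj\<close>)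
  also have "?t \<circ> inv (turn H) = inv (turn H \<circ> ?t)"
    using turn_bij by (simp add: o_inv_distrib)
  also have "bypass_edge e \<dots> = inv (bypass_edge e (turn H \<circ> ?t))"
    using turn_bij by (intro bypass_edge_inv bij_comp) simp_all
  finally have eq: "bypass_edge e (inv (turn H) \<circ> ?t) = inv (bypass_edge e (turn H \<circ> ?t))" .
  show ?thesis by (simp add: reduce_1_def remove_arc_def mirror_def eq)
qed

lemmas mirror_simps = arcs_mirror loops_mirror semiloops_mirror proper_semiloop_1_mirror
  reduce_\<omega>_mirror reduce_1_mirror

end

text \<open>Reflection interchanges left and right successors, hence \<omega> and \<omega>2 in
  loops, semiloops and reductions, and keeps the notions for 1; each clause of one recursion becomes
  a clause of the other.\<close>

lemma Ta_imp_Tc_mirror: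
  "Ta_value x y H p \<Longrightarrow> rotating_dimap H \<Longrightarrow> Tc_value x y (mirror H) p"
proof (induction rule: Ta_value.induct)
  case (empty H)
  then show ?case by (intro Tc_value.empty) (simp add: mirror_def)
next
  case (step H p)
  interpret rotating_dimap H by (rule step.prems)
  show ?case
  proof (rule Tc_value.step)
    fix e assume "e \<in> arcs (mirror H)"
    then have e: "e \<in> arcs H" by (simp add: arcs_mirror)
    note s = step.IH[OF e] mirror_simps e reduce_rotating[OF e]
    show "loop_\<omega>2 (mirror H) e \<Longrightarrow> Tc_value x y (reduce_1 (mirror H) e) p"
      using s by simp
    show "\<lbrakk>\<not> loop_\<omega>2 (mirror H) e; semiloop_\<omega> (mirror H) e\<rbrakk>
       \<Longrightarrow> \<exists>q. Tc_value x y (reduce_\<omega>2 (mirror H) e) q \<and> p = x * q"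
      using s by auto
    show "\<lbrakk>\<not> loop_\<omega>2 (mirror H) e; \<not> semiloop_\<omega> (mirror H) e; proper_semiloop_1 (mirror H) e \<or> loop_\<omega> (mirror H) e\<rbrakk>
       \<Longrightarrow> \<exists>q. Tc_value x y (reduce_1 (mirror H) e) q \<and> p = y * q"
      using s by auto
    show "\<lbrakk>\<not> loop_\<omega>2 (mirror H) e; \<not> semiloop_\<omega> (mirror H) e; \<not> (proper_semiloop_1 (mirror H) e \<or> loop_\<omega> (mirror H) e)\<rbrakk>
       \<Longrightarrow> \<not> semiloop (mirror H) e \<and>
         (\<exists>q r. Tc_value x y (reduce_1 (mirror H) e) q \<and> Tc_value x y (reduce_\<omega>2 (mirror H) e) r \<and> p = q + r)"
      using s by auto
  qed (use step.hyps arcs_mirror in simp)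
qed

lemma Tc_imp_Ta_mirror:
  "Tc_value x y H p \<Longrightarrow> rotating_dimap H \<Longrightarrow> Ta_value x y (mirror H) p"
proof (induction rule: Tc_value.induct)
  case (empty H)
  then show ?case by (intro Ta_value.empty) (simp add: mirror_def)
next
  case (step H p)
  interpret rotating_dimap H by (rule step.prems)
  show ?case
  proof (rule Ta_value.step)
    fix e assume "e \<in> arcs (mirror H)"
    then have e: "e \<in> arcs H" by (simp add: arcs_mirror)
    note s = step.IH[OF e] mirror_simps e reduce_rotating[OF e]
    show "loop_\<omega> (mirror H) e \<Longrightarrow> Ta_value x y (reduce_1 (mirror H) e) p"
      using s by simp
    show "\<lbrakk>\<not> loop_\<omega> (mirror H) e; semiloop_\<omega>2 (mirror H) e\<rbrakk>
       \<Longrightarrow> \<exists>q. Ta_value x y (reduce_\<omega> (mirror H) e) q \<and> p = x * q"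
      using s by auto
    show "\<lbrakk>\<not> loop_\<omega> (mirror H) e; \<not> semiloop_\<omega>2 (mirror H) e; proper_semiloop_1 (mirror H) e \<or> loop_\<omega>2 (mirror H) e\<rbrakk>
       \<Longrightarrow> \<exists>q. Ta_value x y (reduce_1 (mirror H) e) q \<and> p = y * q"
      using s by auto
    show "\<lbrakk>\<not> loop_\<omega> (mirror H) e; \<not> semiloop_\<omega>2 (mirror H) e; \<not> (proper_semiloop_1 (mirror H) e \<or> loop_\<omega>2 (mirror H) e)\<rbrakk>
       \<Longrightarrow> \<not> semiloop (mirror H) e \<and>
         (\<exists>q r. Ta_value x y (reduce_1 (mirror H) e) q \<and> Ta_value x y (reduce_\<omega> (mirror H) e) r \<and> p = q + r)"
      using s by auto
  qed (use step.hyps arcs_mirror in simp)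
qed

lemma Ta_value_iff_mirror:
  assumes "rotating_dimap H" shows "Ta_value x y H p \<longleftrightarrow> Tc_value x y (mirror H) p"
  using Ta_imp_Tc_mirror[OF _ assms] Tc_imp_Ta_mirror[OF _ rotating_dimap.rotating_mirror[OF assms]]
    rotating_dimap.mirror_mirror[OF assms] by metis

section \<open>Doubled graphs\<close>

text \<open>Reflection also reverses the order of the two arc ends that replace a dart, which is
  exactly the difference between the two doublings.\<close>

lemma mirror_alt_a:
  assumes "embedded_graph G" shows "mirror (alt_a G) = alt_c (mirror_graph G)"
proof -
  have p: "rot G permutes darts G" using assms by (simp add: embedded_graph_def)
  have D: "darts (mirror_graph G) = darts G" by (simp add: mirror_graph_def darts_def)
  have im: "rot G d \<in> darts G \<longleftrightarrow> d \<in> darts G" "inv (rot G) d \<in> darts G \<longleftrightarrow> d \<in> darts G" for d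
    using permutes_in_image[OF p] permutes_in_image[OF permutes_inv[OF p]] by auto
  have rot: "rot (mirror_graph G) = inv (rot G)" by (simp add: mirror_graph_def)
  note simps = alt_a_def alt_c_def D rot im permutes_inverses[OF p]
  have "turn (alt_a G) (turn (alt_c (mirror_graph G)) (d, b)) = (d, b)" for d b
    by (cases b) (simp_all add: simps)
  then have "turn (alt_a G) \<circ> turn (alt_c (mirror_graph G)) = id" by (simp add: fun_eq_iff)
  moreover have "turn (alt_c (mirror_graph G)) (turn (alt_a G) (d, b)) = (d, b)" for d b
    by (cases b) (simp_all add: simps)
  then have "turn (alt_c (mirror_graph G)) \<circ> turn (alt_a G) = id" by (simp add: fun_eq_iff)
  ultimately have "inv (turn (alt_a G)) = turn (alt_c (mirror_graph G))" by (rule inv_unique_comp)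
  then show ?thesis
    by (intro dimap.equality) (simp_all add: mirror_def, simp_all add: alt_a_def alt_c_def D)
qed

locale rotation_system =
  fixes G :: "('v, 'e) embedded_graph"
  assumes G: "embedded_graph G"
begin

abbreviation "D \<equiv> darts G"
abbreviation "R \<equiv> rot G"
abbreviation "C \<equiv> opp_on (darts G)"
abbreviation "edge_darts e \<equiv> {e} \<times> (UNIV :: bool set)"

lemma R: "R permutes D" and finD: "finite D"
  using G by (auto simp: embedded_graph_def darts_def)

lemma in_star_permutes: "C \<circ> R \<circ> C permutes D"
  using R opp_on_permutes[of G] by (intro permutes_compose)

text \<open>The arc \<open>d\<close> has its head at the vertex of \<open>opp d\<close>, so the
  in-star rotation is \<open>rot G\<close> conjugated by the flip.\<close>

lemma alt_c_coded: "coded_dimap (alt_c G) (C \<circ> R \<circ> C) C"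
proof
  show "finite (arcs (alt_c G))" using finD by (simp add: alt_c_def)
  show "C \<circ> R \<circ> C permutes arcs (alt_c G)" using in_star_permutes by (simp add: alt_c_def)
  show "C permutes arcs (alt_c G)" using opp_on_permutes[of G] by (simp add: alt_c_def)
qed (use permutes_in_image[OF R] in \<open>auto simp: alt_c_def opp_on_def\<close>)

text \<open>The flip sends an arc to the dart at its head vertex, which carries the in-star rotation
  to \<open>rot G\<close>, and it maps the pair of each edge to itself.\<close>

lemma comps_alt_c:
  assumes A: "A \<subseteq> edges G"
  shows "comps D (C \<circ> R \<circ> C) (edge_darts ` A) = ncl D (gr D R \<union> gr (A \<times> UNIV) opp)"
  unfolding comps_def
proof (rule ncl_transfer[symmetric])
  let ?q = "gr D (C \<circ> R \<circ> C) \<union> pairing (edge_darts ` A)"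
  let ?r = "gr D R \<union> gr (A \<times> UNIV) opp"
  have CD: "C d \<in> D \<longleftrightarrow> d \<in> D" for d by (simp add: opp_on_def)
  have RD: "R d \<in> D \<longleftrightarrow> d \<in> D" for d using R by (rule permutes_in_image)
  have AD: "d \<in> D" if "fst d \<in> A" for d using that A by (auto simp: darts_def mem_Times_iff)
  show "C ` D = D" using opp_on_permutes by (rule permutes_image)
  fix a b
  show "(C a, C b) \<in> eqv ?r" if ab: "(a, b) \<in> ?q"
  proof (cases "(a, b) \<in> gr D (C \<circ> R \<circ> C)")
    case True
    then have "(C a, C b) \<in> gr D R" by (auto simp: gr_iff CD)
    then show ?thesis by (simp add: eqv_base)
  next
    case False
    then obtain e where e: "e \<in> A" "fst a = e" "fst b = e" using ab by (auto simp: pairing_def)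
    then have "a = b \<or> b = opp a" by (cases a; cases b) (auto simp: opp_def)
    moreover have "(opp a, opp (opp a)) \<in> gr (A \<times> UNIV) opp" using e by (simp add: gr_iff opp_def mem_Times_iff)
    then have "(opp a, a) \<in> eqv ?r" by (simp add: eqv_base)
    ultimately show ?thesis using e AD by (auto simp: opp_on_def)
  qed
  show "(a, b) \<in> eqv ?q" if "C a = C b"
    using that opp_on_opp_on by (metis eqv_refl)
  show "\<exists>a'\<in>D. \<exists>b'\<in>D. C a' = a \<and> C b' = b \<and> (a', b') \<in> eqv ?q" if ab: "(a, b) \<in> ?r"
  proof (rule bexI[of _ "C a"], rule bexI[of _ "C b"], intro conjI)
    have "a \<in> D \<and> b = R a \<or> fst a \<in> A \<and> b = opp a" using ab by (auto simp: gr_iff mem_Times_iff)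
    then have D: "a \<in> D" "b \<in> D" using AD[of a] RD[of a] by auto
    then show "C a \<in> D" "C b \<in> D" by (simp_all add: CD)
    have "(C a, C b) \<in> ?q"
    proof (cases "(a, b) \<in> gr D R")
      case True
      then show ?thesis by (auto simp: gr_iff CD)
    next
      case False
      then have "fst a \<in> A" "b = opp a" using ab by (auto simp: gr_iff mem_Times_iff)
      moreover from this have "fst (C a) = fst a" "fst (C b) = fst a" by (simp_all add: opp_on_def opp_def)
      ultimately show ?thesis by (auto simp: pairing_def mem_Times_iff)
    qed
    then show "(C a, C b) \<in> eqv ?q" by (rule eqv_base)
  qed simp_all
qed

lemma edge_pairs_alt_c: "edge_pairs D C = edge_darts ` edges G"
proof -
  have "{d, C d} = edge_darts (fst d)" if "d \<in> D" for d
    using that by (cases d; cases "snd d") (auto simp: opp_on_def opp_def UNIV_bool)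
  moreover have "C d \<noteq> d" if "d \<in> D" for d using that by (simp add: opp_on_def)
  ultimately have "edge_pairs D C = (\<lambda>d. edge_darts (fst d)) ` D"
    unfolding edge_pairs_def by (intro image_cong) auto
  then show ?thesis by (force simp: darts_def)
qed

text \<open>Doubling keeps the genus: the in-star rotation is conjugate to \<open>R\<close>, and the
  face permutation simplifies to \<open>R \<circ> C\<close>, which is conjugate to
  \<open>C \<circ> R\<close>.\<close>

lemma alt_c_planar:
  assumes "genus G = 0" shows "defect D (C \<circ> R \<circ> C) C = 0"
proof -
  note C = opp_on_permutes[of G]
  have CC: "C \<circ> C = id" by (simp add: fun_eq_iff)
  have "gr (edges G \<times> UNIV) opp = gr D C" by (auto simp: gr_def opp_on_def darts_def)
  then have "ncl D (gr D (C \<circ> R \<circ> C) \<union> gr D C) = ncl D (gr D R \<union> gr D C)"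
    using comps_edge_pairs[of C D "C \<circ> R \<circ> C"] comps_alt_c[OF subset_refl] edge_pairs_alt_c by simp
  moreover have "ncyc D (C \<circ> R \<circ> C) = ncyc D R"
    using ncyc_comp_commute[OF permutes_compose[OF R C] C finD] CC by (simp flip: comp_assoc)
  moreover have "ncyc D (C \<circ> (C \<circ> R \<circ> C)) = ncyc D (C \<circ> R)"
    using ncyc_comp_commute[OF R C finD] CC by (simp flip: comp_assoc)
  ultimately show ?thesis
    using genus_eq_defect[OF G] assms by (simp add: defect_def)
qed

text \<open>Edges of \<open>G\<close> correspond to pairs of opposite arcs, and the component counts
  differ only by the isolated vertices of \<open>G\<close>, which have no trace in the
  dimap.\<close>

lemma map_poly_alt_c:
  "map_poly x y D (C \<circ> R \<circ> C) C = rank_poly x y (edges G) (\<lambda>A. ncl (verts G) (adj (endpt G) A))"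
proof -
  have "map_poly x y D (C \<circ> R \<circ> C) C = rank_poly x y (edges G) (\<lambda>A. ncl D (gr D R \<union> gr (A \<times> UNIV) opp))"
    unfolding map_poly_def edge_pairs_alt_c
    by (rule rank_poly_reindex) (use G comps_alt_c in \<open>auto simp: inj_on_def embedded_graph_def\<close>)
  also have "\<dots> = rank_poly x y (edges G) (\<lambda>A. ncl (verts G) (adj (endpt G) A))"
    by (rule rank_poly_shift[symmetric]) (rule embedded_ncl[OF G])
  finally show ?thesis .
qed

end

lemma Tc_value_alt_c:
  assumes "plane_graph G"
  shows "Tc_value x y (alt_c G) p \<longleftrightarrow> p = rank_poly x y (edges G) (\<lambda>A. ncl (verts G) (adj (endpt G) A))"
proof -
  have plane: "embedded_graph G" "genus G = 0" using assms by (simp_all add: plane_graph_def)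
  interpret rotation_system G using plane(1) by unfold_locales
  have "arcs (alt_c G) = darts G" by (simp add: alt_c_def)
  then show ?thesis
    using Tc_value_iff[OF alt_c_coded, of x y p] alt_c_planar[OF plane(2)] map_poly_alt_c[of x y] by simp
qed

theorem theorem25:
  fixes G :: "('v, 'e) embedded_graph" and x y :: "'r::comm_ring_1"
  assumes "plane_graph G"
  shows "\<exists>P. \<forall>p. (tutte_value x y (multigraph.truncate G) p \<longleftrightarrow> p = P) \<and>
                 (Tc_value x y (alt_c G) p \<longleftrightarrow> p = P) \<and>
                 (Ta_value x y (alt_a G) p \<longleftrightarrow> p = P)"
proof -
  let ?P = "rank_poly x y (edges G) (\<lambda>A. ncl (verts G) (adj (endpt G) A))"
  have G: "embedded_graph G" "genus G = 0" using assms by (simp_all add: plane_graph_def)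
  have p: "rot G permutes darts G" "finite (edges G)" using G(1) by (simp_all add: embedded_graph_def)
  have "finite_multigraph (multigraph.truncate G)"
    using G(1) by (simp add: finite_multigraph_def embedded_graph_def multigraph.truncate_def darts_def)
  then have "tutte_value x y (multigraph.truncate G) p \<longleftrightarrow> p = ?P" for p
    using tutte_value_iff[of "multigraph.truncate G" x y p] by (simp add: multigraph.truncate_def)
  moreover have "Tc_value x y (alt_c G) p \<longleftrightarrow> p = ?P" for p
    by (rule Tc_value_alt_c[OF assms])
  moreover have "Ta_value x y (alt_a G) p \<longleftrightarrow> p = ?P" for p
  proof -
    have "plane_graph (mirror_graph G)"
      using embedded_graph_mirror[OF G(1)] genus_mirror_graph[OF p] G(2) by (simp add: plane_graph_def)
    moreover have "rotating_dimap (alt_a G)"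
      using alternating_dimap_alt_a[OF G(1)] by (simp add: alternating_dimap_def rotating_dimap_def)
    \<comment> \<open>Mirroring changes only \<open>rot\<close>, while the polynomial depends on
      vertices, edges and ends alone, so \<open>G\<close> and its mirror image share it.\<close>
    ultimately show ?thesis
      using Tc_value_alt_c[of "mirror_graph G" x y p]
      by (simp add: Ta_value_iff_mirror mirror_alt_a[OF G(1)]) (simp add: mirror_graph_def)
  qed
  ultimately show ?thesis by blast
qed

end
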